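(* Let $[M]=I_0\sqcup I_1\sqcup\dots\sqcup I_k$ be a partition with $I_1,\dots,I_k\neq\emptyset$, let $A_1,\dots,A_k\in\mathbb{K}^N$, $b_1,\dots,b_k\in\mathbb{K}$, and $b^{(i)}_1,\dots,b^{(i)}_k\in\mathbb{K}$ for all $i\in I_0$. Consider the following SDSE on $\mathcal{H}^{D_{M,N}}$: $$\forall p\ge1,\ \forall i\in I_p:\quad X_i=\sum_{\alpha\in\mathbb{N}^N_*}B_{(i,\alpha)}\left(\prod_{q=1}^kF_{A_q\cdot\alpha,b_q}\Big(\sum_{j\in I_q}X_j\Big)\Big(1+b_p\sum_{j\in I_p}X_j\Big)\right),$$ $$\forall i\in I_0:\quad X_i=\sum_{\alpha\in\mathbb{N}^N_*}B_{(i,\alpha)}\left(\prod_{q=1}^kF_{A_q\cdot\alpha,b_q}\Big(\sum_{j\in I_q}X_j\Big)\prod_{q=1}^kF_{b^{(i)}_q,b_q}\Big(\sum_{j\in I_q}X_j\Big)\right).$$ The $\mathbb{N}^N$-graded subalgebra of $\mathcal{H}^{D_{M,N}}$ generated by the homogeneous components $X_i(\alpha)$ ($i\in[M]$, $\alpha\in\mathbb N^N$) of the unique solution of this SDSE is a Hopf subalgebra. Its graded dual is the enveloping algebra of the fundamental deg1 pre-Lie algebra with parameters $I=(I_0,\dots,I_k)$, $A=(A_1,\dots,A_k)$, $b=(b_1,\dots,b_k)$ and $(b^{(i)}_q)$.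
   Context: $\mathbb{K}$ is a field of characteristic zero; $M,N\geq 1$; $[M]=\{1,\dots,M\}$; $\mathbb{N}^N_*=\mathbb{N}^N\setminus\{0\}$; $\cdot$ is the usual inner product of $\mathbb{K}^N$. For $a,b\in\mathbb{K}$, $F_{a,b}(X)=\sum_{n\ge0}\frac{a(a-b)\cdots(a-b(n-1))}{n!}X^n$, i.e. $(1+bX)^{a/b}$ if $b\neq0$ and $e^{aX}$ if $b=0$. For a set $D$, $\mathbb{T}^D$ is the set of isoclasses of rooted trees whose vertices are decorated by elements of $D$; $\mathcal{H}^D$ is the free commutative algebra generated by $\mathbb{T}^D$, with basis the set $\mathbb F^D$ of rooted forests. For $d\in D$, $B_d:\mathcal{H}^D\to\mathcal{H}^D$ is the linear map sending a forest to the tree obtained by grafting all its trees on a common root decorated by $d$. $\mathcal{H}^D$ is a Hopf algebra (Connes-Kreimer), with coproduct the unique algebra morphism such that $\Delta\circ B_d(x)=B_d(x)\otimes1+(\mathrm{Id}\otimes B_d)\circ\Delta(x)$ for all $d,x$. $\widehat{\mathcal{H}^D}$ is the algebra of formal series (infinite linear combinations) of forests, and $B_d$ extends to it. $D_{M,N}=[M]\times\mathbb{N}^N_*$, with $(i,\alpha)$ of degree $\alpha$. The degree of a forest is the sum of the degrees of the decorations of its vertices; this gives a connected $\mathbb{N}^N$-graduation of the Hopf algebra $\mathcal{H}^{D_{M,N}}$. The SDSE (system of Dyson-Schwinger equations) has unknown $(X_1,\dots,X_M)$ in $\widehat{\mathcal{H}^{D_{M,N}}}^M$ (components without constant term) and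 has a unique solution; $X_i(\alpha)$ is the homogeneous component of $X_i$ of degree $\alpha$. A (left) pre-Lie algebra is a vector space with a bilinear product $*$ such that $(x*y)*z-x*(y*z)=(y*x)*z-y*(x*z)$; it is a Lie algebra with $[x,y]=x*y-y*x$, and its enveloping algebra is that of this Lie algebra. The fundamental deg1 pre-Lie algebra with the given parameters has basis $(f_i(\alpha))_{i\in[M],\alpha\in\mathbb{N}^N_*}$ (with $f_i(\alpha)$ homogeneous of degree $\alpha$) and product, for $i\in I_p$, $j\in I_q$: $f_j(\beta)*f_i(\alpha)=(A_q\cdot\alpha+\delta_{p,q}b_q)f_i(\alpha+\beta)$ if $p,q\ne0$; $=(A_q\cdot\alpha+b^{(i)}_q)f_i(\alpha+\beta)$ if $p=0$, $q\neq0$; $=0$ if $q=0$. *)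

theory Defs
  imports
    "HOL-Library.Poly_Mapping"
    "HOL-Library.Product_Plus"
    "HOL-Library.Multiset"
    "HOL-Library.Disjoint_Sets"
    "HOL-Analysis.Finite_Cartesian_Product"
    "HOL-Algebra.QuotRing"
begin

section \<open>Free vector spaces\<close>

text \<open>The vector space with basis \<^typ>\<open>'a\<close> is \<^typ>\<open>'a \<Rightarrow>\<^sub>0 'k\<close>. If the basis is a monoid,
  written additively, the multiplication of the library is that of the monoid algebra. The
  tensor product of two such spaces has the pairs of basis elements as a basis.\<close>

definition smul :: "'k::field \<Rightarrow> ('a \<Rightarrow>\<^sub>0 'k) \<Rightarrow> ('a \<Rightarrow>\<^sub>0 'k)" where
  "smul c x = Poly_Mapping.map ((*) c) x"

definition lin_ext :: "('a \<Rightarrow> ('b \<Rightarrow>\<^sub>0 'k)) \<Rightarrow> ('a \<Rightarrow>\<^sub>0 'k::field) \<Rightarrow> ('b \<Rightarrow>\<^sub>0 'k)" where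
  "lin_ext g x = (\<Sum>a\<in>Poly_Mapping.keys x. smul (Poly_Mapping.lookup x a) (g a))"

definition tens :: "('a \<Rightarrow>\<^sub>0 'k::field) \<Rightarrow> ('b \<Rightarrow>\<^sub>0 'k) \<Rightarrow> ('a \<times> 'b \<Rightarrow>\<^sub>0 'k)" where
  "tens x y = (\<Sum>a\<in>Poly_Mapping.keys x. \<Sum>b\<in>Poly_Mapping.keys y.
     Poly_Mapping.single (a, b) (Poly_Mapping.lookup x a * Poly_Mapping.lookup y b))"

lemma lookup_smul [simp]: "Poly_Mapping.lookup (smul c x) a = c * Poly_Mapping.lookup x a"
  by (simp add: smul_def map.rep_eq when_def)

lemma lin_ext_superset:
  assumes "finite S" "Poly_Mapping.keys x \<subseteq> S"
  shows "lin_ext g x = (\<Sum>a\<in>S. smul (Poly_Mapping.lookup x a) (g a))"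
  unfolding lin_ext_def
proof (rule sum.mono_neutral_left)
  show "\<forall>i\<in>S - Poly_Mapping.keys x. smul (Poly_Mapping.lookup x i) (g i) = 0"
    by (auto intro!: poly_mapping_eqI simp: in_keys_iff)
qed (use assms in auto)

lemma smul_add: "smul c (x + y) = smul c x + smul c y"
  by (rule poly_mapping_eqI) (simp add: lookup_add distrib_left)

lemma smul_add_left: "smul (c + d) x = smul c x + smul d x"
  by (rule poly_mapping_eqI) (simp add: lookup_add distrib_right)

lemma smul_smul: "smul c (smul d x) = smul (c * d) x"
  by (rule poly_mapping_eqI) (simp add: mult.assoc)

lemma smul_one [simp]: "smul 1 x = x"
  by (rule poly_mapping_eqI) simp

lemma smul_zero [simp]: "smul c 0 = 0" "smul 0 x = 0"
  by (auto intro!: poly_mapping_eqI)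

lemma smul_sum: "smul c (sum f S) = (\<Sum>a\<in>S. smul c (f a))"
  by (induction S rule: infinite_finite_induct) (simp_all add: smul_add)

lemma smul_single: "smul c (Poly_Mapping.single a d) = Poly_Mapping.single a (c * d)"
  by (rule poly_mapping_eqI) (simp add: lookup_single when_def)

lemma monomials_sum:
  fixes x :: "'a \<Rightarrow>\<^sub>0 'b::comm_monoid_add"
  shows "x = (\<Sum>a\<in>Poly_Mapping.keys x. Poly_Mapping.single a (Poly_Mapping.lookup x a))"
  by (rule poly_mapping_eqI) (auto simp: lookup_sum lookup_single when_def in_keys_iff)

lemma free_induct [case_names single add]:
  fixes x :: "'a \<Rightarrow>\<^sub>0 'b::comm_monoid_add"
  assumes "\<And>a c. P (Poly_Mapping.single a c)" "\<And>x y. P x \<Longrightarrow> P y \<Longrightarrow> P (x + y)"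
  shows "P x"
proof -
  have "P (\<Sum>a\<in>S. Poly_Mapping.single a (Poly_Mapping.lookup x a))" if "finite S" for S
    using that
  proof (induction S)
    case empty
    show ?case using assms(1)[of undefined 0] by simp
  qed (simp add: assms)
  from this[OF finite_keys] show ?thesis by (subst monomials_sum)
qed

lemma lin_ext_add: "lin_ext g (x + y) = lin_ext g x + lin_ext g y"
proof -
  let ?S = "Poly_Mapping.keys x \<union> Poly_Mapping.keys y"
  have "Poly_Mapping.keys (x + y) \<subseteq> ?S" by (rule Poly_Mapping.keys_add)
  then show ?thesis
    by (simp add: lin_ext_superset[of ?S] lookup_add smul_add_left sum.distrib)
qed

lemma lin_ext_smul: "lin_ext g (smul c x) = smul c (lin_ext g x)"
proof -
  have "Poly_Mapping.keys (smul c x) \<subseteq> Poly_Mapping.keys x" by (auto simp: in_keys_iff)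
  then show ?thesis
    by (simp add: lin_ext_superset[of "Poly_Mapping.keys x"] smul_sum smul_smul)
qed

lemma lin_ext_zero [simp]: "lin_ext g 0 = 0"
  by (simp add: lin_ext_def)

lemma lin_ext_single [simp]: "lin_ext g (Poly_Mapping.single a c) = smul c (g a)"
  by (simp add: lin_ext_superset[of "{a}"])

lemma lin_ext_sum: "lin_ext g (sum f S) = (\<Sum>a\<in>S. lin_ext g (f a))"
  by (induction S rule: infinite_finite_induct) (simp_all add: lin_ext_add)

lemma smul_mult: "smul c x * y = smul c (x * y)" "x * smul c y = smul c (x * y)"
  for x y :: "'a::comm_monoid_add \<Rightarrow>\<^sub>0 'k::field"
proof -
  have eq: "smul c z = Poly_Mapping.single 0 c * z" for z :: "'a \<Rightarrow>\<^sub>0 'k"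
  proof (induction z rule: free_induct)
    case (single a d)
    show ?case by (simp add: smul_single mult_single)
  next
    case (add x y)
    then show ?case by (simp add: smul_add distrib_left)
  qed
  show "smul c x * y = smul c (x * y)" "x * smul c y = smul c (x * y)"
    by (simp_all add: eq ac_simps)
qed

lemma lin_ext_pointwise: "lin_ext (\<lambda>a. g a + h a) x = lin_ext g x + lin_ext h x"
  by (simp add: lin_ext_def smul_add sum.distrib)

lemma vector_space_smul: "vector_space (smul :: 'k::field \<Rightarrow> ('a \<Rightarrow>\<^sub>0 'k) \<Rightarrow> _)"
  by unfold_locales (simp_all add: smul_add smul_add_left smul_smul)

lemma linear_lin_ext: "Vector_Spaces.linear smul smul (lin_ext g)"
  by (simp add: Vector_Spaces.linear_iff vector_space_smul lin_ext_add lin_ext_smul)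

lemma linear_eq_lin_ext:
  assumes "Vector_Spaces.linear smul smul f"
  shows "f x = lin_ext (\<lambda>a. f (Poly_Mapping.single a 1)) x"
proof (induction x rule: free_induct)
  case (single a c)
  have "f (smul c (Poly_Mapping.single a 1)) = smul c (f (Poly_Mapping.single a 1))"
    using assms by (simp add: Vector_Spaces.linear_iff)
  then show ?case by (simp add: smul_single)
next
  case (add x y)
  then show ?case using assms by (simp add: Vector_Spaces.linear_iff lin_ext_add)
qed

lemma tens_eq_lin_ext: "tens x y = lin_ext (\<lambda>a. lin_ext (\<lambda>b. Poly_Mapping.single (a, b) 1) y) x"
  by (simp add: tens_def lin_ext_def smul_sum smul_smul smul_single)

lemma tens_add_left: "tens (x + x') y = tens x y + tens x' y"
  by (simp add: tens_eq_lin_ext lin_ext_add)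

lemma tens_single:
  "tens (Poly_Mapping.single a c) (Poly_Mapping.single b d) = Poly_Mapping.single (a, b) (c * d)"
  by (simp add: tens_eq_lin_ext smul_single)


section \<open>The Connes-Kreimer Hopf algebra of decorated rooted trees\<close>

datatype 'd rtree = Node 'd "'d rtree multiset"

type_synonym 'd forest = "'d rtree multiset"

type_synonym ('d, 'k) ck = "'d forest \<Rightarrow>\<^sub>0 'k"

definition graft :: "'d \<Rightarrow> ('d, 'k::field) ck \<Rightarrow> ('d, 'k) ck" where
  "graft d = lin_ext (\<lambda>F. Poly_Mapping.single {#Node d F#} 1)"

definition graft_right ::
    "'d \<Rightarrow> ('d forest \<times> 'd forest \<Rightarrow>\<^sub>0 'k::field) \<Rightarrow> ('d forest \<times> 'd forest \<Rightarrow>\<^sub>0 'k)" where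
  "graft_right d = lin_ext (\<lambda>(F, G). Poly_Mapping.single (F, {#Node d G#}) 1)"

primrec tree_coproduct :: "'d rtree \<Rightarrow> ('d forest \<times> 'd forest \<Rightarrow>\<^sub>0 'k::field)" where
  "tree_coproduct (Node d F) =
     Poly_Mapping.single ({#Node d F#}, {#}) 1 +
     graft_right d (\<Prod>\<^sub># (image_mset tree_coproduct F))"

definition coproduct :: "('d, 'k::field) ck \<Rightarrow> ('d forest \<times> 'd forest \<Rightarrow>\<^sub>0 'k)" where
  "coproduct = lin_ext (\<lambda>F. \<Prod>\<^sub># (image_mset tree_coproduct F))"

definition counit :: "('a::zero \<Rightarrow>\<^sub>0 'k::zero) \<Rightarrow> 'k" where
  "counit x = Poly_Mapping.lookup x 0"

definition is_coproduct :: "(('d, 'k::field) ck \<Rightarrow> ('d forest \<times> 'd forest \<Rightarrow>\<^sub>0 'k)) \<Rightarrow> bool" where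
  "is_coproduct \<Delta> \<longleftrightarrow>
     Vector_Spaces.linear smul smul \<Delta> \<and> \<Delta> 1 = 1 \<and> (\<forall>x y. \<Delta> (x * y) = \<Delta> x * \<Delta> y) \<and>
     (\<forall>d x. \<Delta> (graft d x) = tens (graft d x) 1 + graft_right d (\<Delta> x))"

lemma is_coproduct_coproduct:
  "is_coproduct (coproduct :: ('d, 'k::field) ck \<Rightarrow> _)"
proof -
  have mult: "coproduct (x * y) = coproduct x * coproduct y" for x y :: "('d, 'k) ck"
  proof (induction x rule: free_induct)
    case (single F c)
    show ?case
    proof (induction y rule: free_induct)
      case (single G d)
      show ?case
        by (simp add: coproduct_def mult_single smul_mult smul_smul ac_simps)
    next
      case (add x y)
      then show ?case by (simp add: coproduct_def lin_ext_add distrib_left)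
    qed
  next
    case (add x z)
    then show ?case by (simp add: coproduct_def lin_ext_add distrib_right)
  qed
  have cocycle: "coproduct (graft d x) = tens (graft d x) 1 + graft_right d (coproduct x)"
    for d and x :: "('d, 'k) ck"
  proof (induction x rule: free_induct)
    case (single F c)
    have "tens (Poly_Mapping.single {#Node d F#} c) (1 :: ('d, 'k) ck) =
        Poly_Mapping.single ({#Node d F#}, {#}) c"
      by (simp flip: single_one add: tens_single zero_multiset_def)
    then show ?case
      by (simp add: coproduct_def graft_def graft_right_def smul_single smul_add lin_ext_smul)
  next
    case (add x y)
    then show ?case
      by (simp add: coproduct_def graft_def graft_right_def lin_ext_add tens_add_left)
  qed
  have "coproduct (1 :: ('d, 'k) ck) = 1"
    by (simp flip: single_one add: coproduct_def)
  with mult cocycle show ?thesis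
    unfolding is_coproduct_def by (simp add: coproduct_def linear_lin_ext)
qed

lemma is_coproduct_unique:
  assumes "is_coproduct (\<Delta> :: ('d, 'k::field) ck \<Rightarrow> _)"
  shows "\<Delta> = coproduct"
proof -
  have lin: "Vector_Spaces.linear smul smul \<Delta>" and one: "\<Delta> 1 = 1"
    and mult: "\<Delta> (x * y) = \<Delta> x * \<Delta> y"
    and cocycle: "\<Delta> (graft d x) = tens (graft d x) 1 + graft_right d (\<Delta> x)" for x y d
    using assms by (auto simp: is_coproduct_def)
  have forest: "\<Delta> (Poly_Mapping.single F 1) = \<Prod>\<^sub># (image_mset tree_coproduct F)"
    if "\<forall>t\<in>#F. \<Delta> (Poly_Mapping.single {#t#} 1) = tree_coproduct t" for F
    using that
  proof (induction F)
    case empty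
    show ?case using one by simp
  next
    case (add t F)
    have "Poly_Mapping.single (add_mset t F) (1 :: 'k) =
        Poly_Mapping.single {#t#} 1 * Poly_Mapping.single F 1"
      by (simp add: mult_single)
    then show ?case using add by (simp add: mult)
  qed
  have tree: "\<Delta> (Poly_Mapping.single {#t#} 1) = tree_coproduct t" for t
  proof (induction t)
    case (Node d F)
    have "graft d (Poly_Mapping.single F 1) = Poly_Mapping.single {#Node d F#} (1 :: 'k)"
      by (simp add: graft_def)
    moreover have "tens (Poly_Mapping.single {#Node d F#} 1) (1 :: ('d, 'k) ck) =
        Poly_Mapping.single ({#Node d F#}, {#}) 1"
      by (simp flip: single_one add: tens_single zero_multiset_def)
    ultimately show ?case
      using cocycle[of d "Poly_Mapping.single F 1"] forest[of F] Node by simp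
  qed
  show ?thesis
  proof
    fix x
    show "\<Delta> x = coproduct x"
      by (subst linear_eq_lin_ext[OF lin]) (simp add: coproduct_def forest tree)
  qed
qed

definition is_antipode :: "(('d, 'k::field) ck \<Rightarrow> ('d, 'k) ck) \<Rightarrow> bool" where
  "is_antipode S \<longleftrightarrow> Vector_Spaces.linear smul smul S \<and>
     (\<forall>x. lin_ext (\<lambda>(F, G). S (Poly_Mapping.single F 1) * Poly_Mapping.single G 1) (coproduct x)
            = smul (counit x) 1) \<and>
     (\<forall>x. lin_ext (\<lambda>(F, G). Poly_Mapping.single F 1 * S (Poly_Mapping.single G 1)) (coproduct x)
            = smul (counit x) 1)"

definition is_subalgebra :: "('a::monoid_add \<Rightarrow>\<^sub>0 'k::field) set \<Rightarrow> bool" where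
  "is_subalgebra V \<longleftrightarrow> 1 \<in> V \<and> (\<forall>x\<in>V. \<forall>y\<in>V. x + y \<in> V) \<and> (\<forall>c. \<forall>x\<in>V. smul c x \<in> V) \<and>
     (\<forall>x\<in>V. \<forall>y\<in>V. x * y \<in> V)"

definition hopf_subalgebra :: "('d, 'k::field) ck set \<Rightarrow> bool" where
  "hopf_subalgebra V \<longleftrightarrow> is_subalgebra V \<and>
     (\<forall>x\<in>V. coproduct x \<in> module.span smul {tens y z |y z. y \<in> V \<and> z \<in> V}) \<and>
     (\<exists>S. is_antipode S \<and> S ` V \<subseteq> V)"


section \<open>Formal series of forests\<close>

typedef ('a, 'k) series = "UNIV :: ('a multiset \<Rightarrow> 'k) set"
  morphisms coef Series
  by simp

setup_lifting type_definition_series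

lemma series_eqI: "(\<And>F. coef f F = coef g F) \<Longrightarrow> f = g"
  by transfer auto

lemma finite_splits: "finite {(G, H). G + H = (F :: 'a multiset)}"
proof -
  have "{G. G \<subseteq># F} \<subseteq> mset ` {ts. set ts \<subseteq> set_mset F \<and> length ts \<le> size F}"
  proof
    fix G assume G: "G \<in> {G. G \<subseteq># F}"
    obtain ts where "G = mset ts" by (metis ex_mset)
    with G show "G \<in> mset ` {ts. set ts \<subseteq> set_mset F \<and> length ts \<le> size F}"
      using set_mset_mono[of G F] size_mset_mono[of G F] by auto
  qed
  then have "finite {G. G \<subseteq># F}"
    by (rule finite_surj[OF finite_lists_length_le[OF finite_set_mset]])
  moreover have "{(G, H). G + H = F} \<subseteq> (\<lambda>G. (G, F - G)) ` {G. G \<subseteq># F}"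
    by auto
  ultimately show ?thesis by (rule finite_surj)
qed

instantiation series :: (type, comm_ring_1) comm_ring_1
begin

lift_definition zero_series :: "('a, 'b) series" is "\<lambda>_. 0" .
lift_definition one_series :: "('a, 'b) series" is "\<lambda>F. if F = {#} then 1 else 0" .
lift_definition plus_series :: "('a, 'b) series \<Rightarrow> ('a, 'b) series \<Rightarrow> ('a, 'b) series"
  is "\<lambda>f g F. f F + g F" .
lift_definition minus_series :: "('a, 'b) series \<Rightarrow> ('a, 'b) series \<Rightarrow> ('a, 'b) series"
  is "\<lambda>f g F. f F - g F" .
lift_definition uminus_series :: "('a, 'b) series \<Rightarrow> ('a, 'b) series"
  is "\<lambda>f F. - f F" .
lift_definition times_series :: "('a, 'b) series \<Rightarrow> ('a, 'b) series \<Rightarrow> ('a, 'b) series"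
  is "\<lambda>f g F. \<Sum>(G, H) | G + H = F. f G * g H" .

instance
proof
  fix f g h :: "('a, 'b) series"
  show "f + g + h = f + (g + h)" by transfer (simp add: add.assoc)
  show "f + g = g + f" by transfer (simp add: add.commute)
  show "0 + f = f" by transfer simp
  show "- f + f = 0" by transfer simp
  show "f - g = f + - g" by transfer simp
  show "(0 :: ('a, 'b) series) \<noteq> 1" by transfer (auto simp: fun_eq_iff)
  show "(f + g) * h = f * h + g * h"
    by transfer (simp add: distrib_right sum.distrib split_def)
  show "f * g = g * f"
  proof (transfer, rule ext)
    fix f g :: "'a multiset \<Rightarrow> 'b" and F
    show "(\<Sum>(G, H) | G + H = F. f G * g H) = (\<Sum>(G, H) | G + H = F. g G * f H)"
      by (rule sum.reindex_bij_witness[of _ prod.swap prod.swap]) (auto simp: ac_simps)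
  qed
  show "1 * f = f"
  proof (transfer, rule ext)
    fix f :: "'a multiset \<Rightarrow> 'b" and F
    have "(\<Sum>(G, H) | G + H = F. (if G = {#} then 1 else 0) * f H) =
        (\<Sum>p\<in>{(G, H). G + H = F}. if p = ({#}, F) then f F else 0)"
    proof (rule sum.cong)
      fix p assume "p \<in> {(G, H). G + H = F}"
      then show "(case p of (G, H) \<Rightarrow> (if G = {#} then 1 else 0) * f H) =
          (if p = ({#}, F) then f F else 0)"
        by (cases "fst p = {#}") auto
    qed simp
    also have "\<dots> = f F" by (subst sum.delta[OF finite_splits]) simp
    finally show "(\<Sum>(G, H) | G + H = F. (if G = {#} then 1 else 0) * f H) = f F" .
  qed
  show "f * g * h = f * (g * h)"
  proof (transfer, rule ext)
    fix f g h :: "'a multiset \<Rightarrow> 'b" and F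
    define S where "S F = {(G, H). G + H = (F :: 'a multiset)}" for F
    have fin: "finite (S F)" for F by (simp add: S_def finite_splits)
    have "(\<Sum>(P, L)\<in>S F. (\<Sum>(G, H)\<in>S P. f G * g H) * h L) =
        (\<Sum>(p, q)\<in>(SIGMA p:S F. S (fst p)). f (fst q) * g (snd q) * h (snd p))"
      by (subst sum.Sigma[symmetric]) (simp_all add: fin sum_distrib_right case_prod_beta')
    also have "\<dots> = (\<Sum>(p, q)\<in>(SIGMA p:S F. S (snd p)). f (fst p) * g (fst q) * h (snd q))"
      by (rule sum.reindex_bij_witness[of _
            "\<lambda>((G, P), (H, L)). ((G + H, L), (G, H))" "\<lambda>((P, L), (G, H)). ((G, H + L), (H, L))"])
        (auto simp: S_def ac_simps)
    also have "\<dots> = (\<Sum>(G, P)\<in>S F. f G * (\<Sum>(H, L)\<in>S P. g H * h L))"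
      by (subst sum.Sigma[symmetric])
        (simp_all add: fin sum_distrib_left case_prod_beta' mult.assoc)
    finally show "(\<Sum>(P, L) | P + L = F. (\<Sum>(G, H) | G + H = P. f G * g H) * h L) =
        (\<Sum>(G, P) | G + P = F. f G * (\<Sum>(H, L) | H + L = P. g H * h L))"
      by (simp only: S_def)
  qed
qed

end

definition series_const :: "'k::zero \<Rightarrow> ('a, 'k) series" where
  "series_const c = Series (\<lambda>F. if F = {#} then c else 0)"

definition series_graft :: "'d \<Rightarrow> ('d rtree, 'k::comm_monoid_add) series \<Rightarrow> ('d rtree, 'k) series" where
  "series_graft d f = Series (\<lambda>G. \<Sum>F | G = {#Node d F#}. coef f F)"

text \<open>Infinite sums of series are taken coefficientwise. The value of \<^const>\<open>Sum_any\<close> is the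
  expected one because only finitely many terms contribute to each coefficient: in
  \<open>series_F a b f\<close> this requires that \<open>f\<close> has no constant term.\<close>

definition series_sum :: "('i \<Rightarrow> ('a, 'k::comm_monoid_add) series) \<Rightarrow> ('a, 'k) series" where
  "series_sum f = Series (\<lambda>F. Sum_any (\<lambda>i. coef (f i) F))"

definition F_coeff :: "'k::field_char_0 \<Rightarrow> 'k \<Rightarrow> nat \<Rightarrow> 'k" where
  "F_coeff a b n = (\<Prod>i<n. a - b * of_nat i) / fact n"

definition series_F :: "'k::field_char_0 \<Rightarrow> 'k \<Rightarrow> ('a, 'k) series \<Rightarrow> ('a, 'k) series" where
  "series_F a b f = series_sum (\<lambda>n. series_const (F_coeff a b n) * f ^ n)"


section \<open>Decorations and degrees\<close>

typedef ('n::finite) posdeg = "{\<alpha> :: nat ^ 'n. \<alpha> \<noteq> 0}"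
  morphisms deg_vec Posdeg
proof
  show "(\<chi> i. 1) \<in> {\<alpha> :: nat ^ 'n. \<alpha> \<noteq> 0}" by (simp add: vec_eq_iff)
qed

setup_lifting type_definition_posdeg

instantiation posdeg :: (finite) ab_semigroup_add
begin

lift_definition plus_posdeg :: "'a posdeg \<Rightarrow> 'a posdeg \<Rightarrow> 'a posdeg" is "(+)"
  by (simp add: vec_eq_iff) blast

instance
  by standard (transfer; simp add: ac_simps)+

end

type_synonym ('m, 'n) deco = "'m \<times> 'n posdeg"

definition deco_degree :: "('m, 'n::finite) deco \<Rightarrow> nat ^ 'n" where
  "deco_degree d = deg_vec (snd d)"

primrec decorations :: "'d rtree \<Rightarrow> 'd multiset" where
  "decorations (Node d F) = {#d#} + \<Sum>\<^sub># (image_mset decorations F)"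

definition forest_degree :: "('m, 'n::finite) deco forest \<Rightarrow> nat ^ 'n" where
  "forest_degree F = (\<Sum>t\<in>#F. \<Sum>d\<in>#decorations t. deco_degree d)"

definition homogeneous :: "('a \<Rightarrow> 'g) \<Rightarrow> 'g \<Rightarrow> ('a \<Rightarrow>\<^sub>0 'k::zero) \<Rightarrow> bool" where
  "homogeneous deg \<gamma> x \<longleftrightarrow> (\<forall>a\<in>Poly_Mapping.keys x. deg a = \<gamma>)"

definition component :: "('a \<Rightarrow> 'g) \<Rightarrow> 'g \<Rightarrow> ('a \<Rightarrow>\<^sub>0 'k::comm_monoid_add) \<Rightarrow> ('a \<Rightarrow>\<^sub>0 'k)" where
  "component deg \<gamma> x =
     (\<Sum>a | a \<in> Poly_Mapping.keys x \<and> deg a = \<gamma>. Poly_Mapping.single a (Poly_Mapping.lookup x a))"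

definition graded_subspace :: "('a \<Rightarrow> 'g) \<Rightarrow> ('a \<Rightarrow>\<^sub>0 'k::comm_monoid_add) set \<Rightarrow> bool" where
  "graded_subspace deg V \<longleftrightarrow> (\<forall>x\<in>V. \<forall>\<gamma>. component deg \<gamma> x \<in> V)"

definition series_component ::
    "nat ^ 'n \<Rightarrow> (('m, 'n::finite) deco rtree, 'k::comm_monoid_add) series \<Rightarrow> (('m, 'n) deco, 'k) ck" where
  "series_component \<gamma> f = (\<Sum>F | forest_degree F = \<gamma>. Poly_Mapping.single F (coef f F))"

text \<open>The sum above is finite, hence meaningful.\<close>

lemma finite_forest_degree:
  fixes \<gamma> :: "nat ^ 'n"
  shows "finite {F :: ('m::finite, 'n) deco forest. forest_degree F = \<gamma>}"
proof -
  define nv :: "nat ^ 'n \<Rightarrow> nat" where "nv \<alpha> = (\<Sum>i\<in>UNIV. \<alpha> $ i)" for \<alpha>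
  define nt :: "('m, 'n) deco rtree \<Rightarrow> nat" where
    "nt t = nv (\<Sum>d\<in>#decorations t. deco_degree d)" for t
  have nv_add: "nv (\<alpha> + \<beta>) = nv \<alpha> + nv \<beta>" and nv_0: "nv 0 = 0" for \<alpha> \<beta>
    by (simp_all add: nv_def sum.distrib)
  have nv_sum: "nv (\<Sum>\<^sub># M) = \<Sum>\<^sub># (image_mset nv M)" for M
    by (induction M) (simp_all add: nv_add nv_0)
  have nv_pos: "nv (deco_degree d) > 0" for d :: "('m, 'n) deco"
  proof -
    have "deg_vec (snd d) \<noteq> 0" using deg_vec[of "snd d"] by simp
    then obtain i where "deg_vec (snd d) $ i \<noteq> 0" by (auto simp: vec_eq_iff)
    then have "(\<Sum>i\<in>UNIV. deg_vec (snd d) $ i) \<noteq> 0" by (metis UNIV_I finite sum_eq_0_iff)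
    then show ?thesis by (simp add: nv_def deco_degree_def del: sum_eq_0_iff)
  qed
  have nt_Node: "nt (Node d F) = nv (deco_degree d) + (\<Sum>t\<in>#F. nt t)" for d F
  proof -
    have "(\<Sum>d\<in>#\<Sum>\<^sub># (image_mset decorations F). deco_degree d) =
        (\<Sum>t\<in>#F. \<Sum>d\<in>#decorations t. deco_degree d)"
      by (induction F) simp_all
    then show ?thesis by (simp add: nt_def nv_add nv_sum image_mset.compositionality o_def)
  qed
  have nt_pos: "nt t > 0" for t
    by (cases t) (use nv_pos in \<open>simp add: nt_Node\<close>)
  have vec_fin: "finite {\<alpha> :: nat ^ 'n. nv \<alpha> \<le> n}" for n
  proof (rule finite_subset)
    show "{\<alpha> :: nat ^ 'n. nv \<alpha> \<le> n} \<subseteq> vec_lambda ` (UNIV \<rightarrow>\<^sub>E {..n})"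
    proof
      fix \<alpha> :: "nat ^ 'n" assume "\<alpha> \<in> {\<alpha>. nv \<alpha> \<le> n}"
      then have "(\<Sum>i\<in>UNIV. \<alpha> $ i) \<le> n" by (simp add: nv_def)
      then have "\<alpha> $ i \<le> n" for i
        using member_le_sum[of i UNIV "\<lambda>i. \<alpha> $ i"] by simp
      then have "vec_nth \<alpha> \<in> UNIV \<rightarrow>\<^sub>E {..n}" by auto
      then show "\<alpha> \<in> vec_lambda ` (UNIV \<rightarrow>\<^sub>E {..n})" by (metis imageI vec_nth_inverse)
    qed
  qed (auto intro!: finite_imageI finite_PiE)
  have deco_fin: "finite {d :: ('m, 'n) deco. nv (deco_degree d) \<le> n}" for n
  proof (rule finite_subset)
    show "{d :: ('m, 'n) deco. nv (deco_degree d) \<le> n} \<subseteq>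
        (\<lambda>(i, \<alpha>). (i, Posdeg \<alpha>)) ` (UNIV \<times> {\<alpha>. nv \<alpha> \<le> n})"
      by (force simp: deco_degree_def deg_vec_inverse)
  qed (use vec_fin in auto)
  have forest_fin: "finite {F. (\<Sum>t\<in>#F. nt t) \<le> n}" if "finite {t. nt t \<le> n}" for n
  proof (rule finite_subset)
    show "{F. (\<Sum>t\<in>#F. nt t) \<le> n} \<subseteq> mset ` {ts. set ts \<subseteq> {t. nt t \<le> n} \<and> length ts \<le> n}"
    proof
      fix F assume "F \<in> {F. (\<Sum>t\<in>#F. nt t) \<le> n}"
      then have F: "(\<Sum>t\<in>#F. nt t) \<le> n" by simp
      obtain ts where ts: "F = mset ts" by (metis ex_mset)
      have "length ts \<le> (\<Sum>t\<leftarrow>ts. nt t)" for ts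
      proof (induction ts)
        case (Cons t ts)
        then show ?case using nt_pos[of t] by simp
      qed simp
      moreover have "nt t \<le> (\<Sum>t\<leftarrow>ts. nt t)" if "t \<in> set ts" for t
        using that member_le_sum_list[of "nt t" "map nt ts"] by simp
      moreover have "(\<Sum>t\<leftarrow>ts. nt t) \<le> n"
        using F ts by (simp flip: sum_mset_sum_list)
      ultimately have "set ts \<subseteq> {t. nt t \<le> n} \<and> length ts \<le> n"
        by (auto intro: order_trans)
      then show "F \<in> mset ` {ts. set ts \<subseteq> {t. nt t \<le> n} \<and> length ts \<le> n}" using ts by auto
    qed
  qed (use that in \<open>auto intro: finite_lists_length_le\<close>)
  have tree_fin: "finite {t. nt t \<le> n}" for n
  proof (induction n)
    case 0
    have "{t. nt t \<le> 0} = {}" using nt_pos by (auto simp: not_le)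
    then show ?case by (simp del: le_zero_eq)
  next
    case (Suc n)
    have "{t. nt t \<le> Suc n} \<subseteq>
        (\<lambda>(d, F). Node d F) ` ({d. nv (deco_degree d) \<le> Suc n} \<times> {F. (\<Sum>t\<in>#F. nt t) \<le> n})"
    proof
      fix t assume "t \<in> {t. nt t \<le> Suc n}"
      moreover obtain d F where "t = Node d F" by (cases t)
      ultimately show "t \<in> (\<lambda>(d, F). Node d F) `
          ({d. nv (deco_degree d) \<le> Suc n} \<times> {F. (\<Sum>t\<in>#F. nt t) \<le> n})"
        using nv_pos[of d] by (intro image_eqI[of _ _ "(d, F)"]) (simp_all add: nt_Node)
    qed
    then show ?case
      using forest_fin[OF Suc] deco_fin[of "Suc n"]
      by (meson finite_SigmaI finite_imageI finite_subset)
  qed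
  have "{F :: ('m, 'n) deco forest. forest_degree F = \<gamma>} \<subseteq> {F. (\<Sum>t\<in>#F. nt t) \<le> nv \<gamma>}"
    by (auto simp: forest_degree_def nt_def nv_sum image_mset.compositionality o_def)
  then show ?thesis using forest_fin[OF tree_fin] finite_subset by blast
qed


section \<open>The system of Dyson-Schwinger equations\<close>

definition dot :: "'k::comm_ring_1 ^ 'n \<Rightarrow> ('n::finite) posdeg \<Rightarrow> 'k" where
  "dot a \<alpha> = scalar_product a (\<chi> i. of_nat (deg_vec \<alpha> $ i))"

definition sdse ::
    "nat \<Rightarrow> (nat \<Rightarrow> 'm::finite set) \<Rightarrow> (nat \<Rightarrow> 'k::field_char_0 ^ 'n) \<Rightarrow> (nat \<Rightarrow> 'k) \<Rightarrow> ('m \<Rightarrow> nat \<Rightarrow> 'k) \<Rightarrow>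
     ('m \<Rightarrow> (('m, 'n::finite) deco rtree, 'k) series) \<Rightarrow> bool" where
  "sdse k I A b b' X \<longleftrightarrow>
     (\<forall>i. coef (X i) {#} = 0) \<and>
     (\<forall>p\<in>{1..k}. \<forall>i\<in>I p.
        X i = series_sum (\<lambda>\<alpha>. series_graft (i, \<alpha>)
          ((\<Prod>q = 1..k. series_F (dot (A q) \<alpha>) (b q) (\<Sum>j\<in>I q. X j)) *
           (1 + series_const (b p) * (\<Sum>j\<in>I p. X j))))) \<and>
     (\<forall>i\<in>I 0.
        X i = series_sum (\<lambda>\<alpha>. series_graft (i, \<alpha>)
          ((\<Prod>q = 1..k. series_F (dot (A q) \<alpha>) (b q) (\<Sum>j\<in>I q. X j)) *
           (\<Prod>q = 1..k. series_F (b' i q) (b q) (\<Sum>j\<in>I q. X j)))))"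

definition sdse_subalgebra ::
    "('m \<Rightarrow> (('m, 'n::finite) deco rtree, 'k::field) series) \<Rightarrow> (('m, 'n) deco, 'k) ck set" where
  "sdse_subalgebra X = is_subalgebra hull {series_component \<alpha> (X i) |i \<alpha>. True}"


section \<open>The fundamental pre-Lie algebra\<close>

definition block :: "nat \<Rightarrow> (nat \<Rightarrow> 'm set) \<Rightarrow> 'm \<Rightarrow> nat" where
  "block k I i = (THE p. p \<le> k \<and> i \<in> I p)"

definition deg1_coeff ::
    "nat \<Rightarrow> (nat \<Rightarrow> 'm set) \<Rightarrow> (nat \<Rightarrow> 'k::comm_ring_1 ^ 'n) \<Rightarrow> (nat \<Rightarrow> 'k) \<Rightarrow> ('m \<Rightarrow> nat \<Rightarrow> 'k) \<Rightarrow>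
     'm \<Rightarrow> ('m, 'n::finite) deco \<Rightarrow> 'k" where
  "deg1_coeff k I A b b' j = (\<lambda>(i, \<alpha>).
     let p = block k I i; q = block k I j in
       if q = 0 then 0
       else if p = 0 then dot (A q) \<alpha> + b' i q
       else dot (A q) \<alpha> + (if p = q then b q else 0))"

definition deg1_prod ::
    "nat \<Rightarrow> (nat \<Rightarrow> 'm set) \<Rightarrow> (nat \<Rightarrow> 'k::field ^ 'n) \<Rightarrow> (nat \<Rightarrow> 'k) \<Rightarrow> ('m \<Rightarrow> nat \<Rightarrow> 'k) \<Rightarrow>
     (('m, 'n::finite) deco \<Rightarrow>\<^sub>0 'k) \<Rightarrow> (('m, 'n) deco \<Rightarrow>\<^sub>0 'k) \<Rightarrow> (('m, 'n) deco \<Rightarrow>\<^sub>0 'k)" where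
  "deg1_prod k I A b b' x y =
     lin_ext (\<lambda>(j, \<beta>). lin_ext (\<lambda>(i, \<alpha>).
       Poly_Mapping.single (i, \<alpha> + \<beta>) (deg1_coeff k I A b b' j (i, \<alpha>))) y) x"

definition left_pre_lie :: "('a::ab_group_add \<Rightarrow> 'a \<Rightarrow> 'a) \<Rightarrow> bool" where
  "left_pre_lie m \<longleftrightarrow>
     (\<forall>x y z. m (m x y) z - m x (m y z) = m (m y x) z - m y (m x z))"

definition lie_bracket :: "('a::ab_group_add \<Rightarrow> 'a \<Rightarrow> 'a) \<Rightarrow> 'a \<Rightarrow> 'a \<Rightarrow> 'a" where
  "lie_bracket m x y = m x y - m y x"

lemma dot_add: "dot a (\<alpha> + \<beta>) = dot a \<alpha> + dot a \<beta>"
  by (simp add: dot_def scalar_product_def plus_posdeg.rep_eq distrib_left sum.distrib)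

lemma left_pre_lie_deg1_prod: "left_pre_lie (deg1_prod k I A b b')"
proof -
  let ?m = "deg1_prod k I A b b'"
  have m_add: "?m (x + y) z = ?m x z + ?m y z" "?m x (y + z) = ?m x y + ?m x z" for x y z
    by (simp_all add: deg1_prod_def lin_ext_add split_def lin_ext_pointwise)
  have m_single: "?m (Poly_Mapping.single (j, \<beta>) c) (Poly_Mapping.single (i, \<alpha>) d) =
      Poly_Mapping.single (i, \<alpha> + \<beta>) (c * d * deg1_coeff k I A b b' j (i, \<alpha>))" for j \<beta> c i \<alpha> d
    by (simp add: deg1_prod_def smul_single mult.assoc)
  have *: "?m (?m x y) z + ?m y (?m x z) = ?m (?m y x) z + ?m x (?m y z)" for x y z
  proof (induction x rule: free_induct)
    case (single jb c)
    show ?case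
    proof (induction y rule: free_induct)
      case (single lc d)
      show ?case
      proof (induction z rule: free_induct)
        case (single ia e)
        obtain j \<beta> l \<gamma> i \<alpha> where [simp]: "jb = (j, \<beta>)" "lc = (l, \<gamma>)" "ia = (i, \<alpha>)"
          by (metis surj_pair)
        show ?case
          by (simp add: m_single ac_simps flip: single_add)
            (simp add: deg1_coeff_def Let_def dot_add algebra_simps)
      next
        case (add z z')
        then show ?case by (simp add: m_add algebra_simps)
      qed
    next
      case (add y y')
      then show ?case by (simp add: m_add algebra_simps)
    qed
  next
    case (add x x')
    then show ?case by (simp add: m_add algebra_simps)
  qed
  have "?m (?m x y) z - ?m x (?m y z) = ?m (?m y x) z - ?m y (?m x z)" for x y z
    using *[of x y z] by (simp add: algebra_simps)
  then show ?thesis unfolding left_pre_lie_def by blast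
qed


section \<open>Enveloping algebras\<close>

text \<open>The tensor algebra of the vector space with basis \<^typ>\<open>'b\<close> is the monoid algebra of
  the words in the basis elements.\<close>

datatype 'b mword = MWord (letters: "'b list")

instantiation mword :: (type) monoid_add
begin

definition "0 = MWord []"

definition "v + w = MWord (letters v @ letters w)"

instance
  by standard (simp_all add: zero_mword_def plus_mword_def)

end

definition letter :: "'b \<Rightarrow> 'b mword" where
  "letter x = MWord [x]"

definition tensor_ring :: "('b mword \<Rightarrow>\<^sub>0 'k::field) ring" where
  "tensor_ring = \<lparr>carrier = UNIV, monoid.mult = (*), one = 1, zero = 0, ring.add = (+)\<rparr>"

definition tensor_incl :: "('b \<Rightarrow>\<^sub>0 'k) \<Rightarrow> ('b mword \<Rightarrow>\<^sub>0 'k::field)" where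
  "tensor_incl = lin_ext (\<lambda>x. Poly_Mapping.single (letter x) 1)"

definition envelope_ideal :: "(('b \<Rightarrow>\<^sub>0 'k) \<Rightarrow> ('b \<Rightarrow>\<^sub>0 'k) \<Rightarrow> ('b \<Rightarrow>\<^sub>0 'k)) \<Rightarrow>
    ('b mword \<Rightarrow>\<^sub>0 'k::field) set" where
  "envelope_ideal br = Idl\<^bsub>tensor_ring\<^esub>
     {tensor_incl x * tensor_incl y - tensor_incl y * tensor_incl x - tensor_incl (br x y) |x y. True}"

definition envelope :: "(('b \<Rightarrow>\<^sub>0 'k) \<Rightarrow> ('b \<Rightarrow>\<^sub>0 'k) \<Rightarrow> ('b \<Rightarrow>\<^sub>0 'k)) \<Rightarrow>
    ('b mword \<Rightarrow>\<^sub>0 'k::field) set ring" where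
  "envelope br = tensor_ring Quot envelope_ideal br"

definition env_class :: "(('b \<Rightarrow>\<^sub>0 'k) \<Rightarrow> ('b \<Rightarrow>\<^sub>0 'k) \<Rightarrow> ('b \<Rightarrow>\<^sub>0 'k)) \<Rightarrow>
    ('b mword \<Rightarrow>\<^sub>0 'k::field) \<Rightarrow> ('b mword \<Rightarrow>\<^sub>0 'k) set" where
  "env_class br t = envelope_ideal br +>\<^bsub>tensor_ring\<^esub> t"

text \<open>The coproduct of the tensor algebra for which the letters are primitive; it induces that
  of the enveloping algebra.\<close>

definition tensor_coproduct ::
    "('b mword \<Rightarrow>\<^sub>0 'k::field) \<Rightarrow> ('b mword \<times> 'b mword \<Rightarrow>\<^sub>0 'k)" where
  "tensor_coproduct = lin_ext (\<lambda>w. \<Prod>x\<leftarrow>letters w.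
     Poly_Mapping.single (letter x, 0) 1 + Poly_Mapping.single (0, letter x) 1)"

definition word_degree :: "('m, 'n::finite) deco mword \<Rightarrow> nat ^ 'n" where
  "word_degree w = (\<Sum>d\<leftarrow>letters w. deco_degree d)"


section \<open>Graded duals\<close>

text \<open>Let \<open>V\<close> be a graded Hopf subalgebra. A linear form on \<open>V\<close> is represented by a function
  that vanishes outside \<open>V\<close>.\<close>

definition gdual :: "(('m, 'n::finite) deco, 'k::field) ck set \<Rightarrow> ((('m, 'n) deco, 'k) ck \<Rightarrow> 'k) set" where
  "gdual V = {f. (\<forall>x. x \<notin> V \<longrightarrow> f x = 0) \<and> (\<forall>x\<in>V. \<forall>y\<in>V. f (x + y) = f x + f y) \<and>
     (\<forall>c. \<forall>x\<in>V. f (smul c x) = c * f x) \<and>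
     finite {\<gamma>. \<exists>x\<in>V. homogeneous forest_degree \<gamma> x \<and> f x \<noteq> 0}}"

definition gdual_component ::
    "(('m, 'n::finite) deco, 'k::field) ck set \<Rightarrow> nat ^ 'n \<Rightarrow> ((('m, 'n) deco, 'k) ck \<Rightarrow> 'k) set" where
  "gdual_component V \<gamma> =
     {f \<in> gdual V. \<forall>\<delta>. \<forall>x\<in>V. homogeneous forest_degree \<delta> x \<and> \<delta> \<noteq> \<gamma> \<longrightarrow> f x = 0}"

text \<open>The value of \<open>f \<otimes> g\<close> on an element \<open>z\<close> of \<open>V \<otimes> V\<close>, which does not depend on the way \<open>z\<close>
  is written as a sum of pure tensors of elements of \<open>V\<close>.\<close>

definition tensor_form :: "('a \<Rightarrow>\<^sub>0 'k::field) set \<Rightarrow> (('a \<Rightarrow>\<^sub>0 'k) \<Rightarrow> 'k) \<Rightarrow> (('a \<Rightarrow>\<^sub>0 'k) \<Rightarrow> 'k) \<Rightarrow>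
    ('a \<times> 'a \<Rightarrow>\<^sub>0 'k) \<Rightarrow> 'k" where
  "tensor_form V f g z = (THE c. \<exists>ps. set ps \<subseteq> V \<times> V \<and> z = (\<Sum>(x, y)\<leftarrow>ps. tens x y) \<and>
     c = (\<Sum>(x, y)\<leftarrow>ps. f x * g y))"

definition gdual_ring ::
    "(('m, 'n::finite) deco, 'k::field) ck set \<Rightarrow> ((('m, 'n) deco, 'k) ck \<Rightarrow> 'k) ring" where
  "gdual_ring V = \<lparr>carrier = gdual V,
     monoid.mult = (\<lambda>f g x. if x \<in> V then tensor_form V f g (coproduct x) else 0),
     one = (\<lambda>x. if x \<in> V then counit x else 0),
     zero = (\<lambda>_. 0), ring.add = (\<lambda>f g x. f x + g x)\<rparr>"

text \<open>The coproduct of the graded dual is the transpose of the multiplication of \<open>V\<close>, where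
  \<open>f \<otimes> g\<close> is identified with the bilinear form \<open>(x, y) \<mapsto> f x g y\<close>.\<close>

definition gdual_coproduct :: "('a::monoid_add \<Rightarrow>\<^sub>0 'k::field) set \<Rightarrow> (('a \<Rightarrow>\<^sub>0 'k) \<Rightarrow> 'k) \<Rightarrow>
    ('a \<Rightarrow>\<^sub>0 'k) \<Rightarrow> ('a \<Rightarrow>\<^sub>0 'k) \<Rightarrow> 'k" where
  "gdual_coproduct V f = (\<lambda>x y. if x \<in> V \<and> y \<in> V then f (x * y) else 0)"

text \<open>Isomorphisms of graded Hopf algebras from the enveloping algebra, whose elements are the
  classes \<open>env_class br t\<close>, to the graded dual: bijective, multiplicative and unital (by
  \<^const>\<open>ring_iso\<close>), linear, compatible with the counits and the coproducts, homogeneous.\<close>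

definition envelope_gdual_iso ::
    "((('m, 'n) deco \<Rightarrow>\<^sub>0 'k) \<Rightarrow> (('m, 'n) deco \<Rightarrow>\<^sub>0 'k) \<Rightarrow> (('m, 'n) deco \<Rightarrow>\<^sub>0 'k)) \<Rightarrow>
     (('m, 'n::finite) deco, 'k::field) ck set \<Rightarrow>
     ((('m, 'n) deco mword \<Rightarrow>\<^sub>0 'k) set \<Rightarrow> (('m, 'n) deco, 'k) ck \<Rightarrow> 'k) \<Rightarrow> bool" where
  "envelope_gdual_iso br V \<phi> \<longleftrightarrow>
     \<phi> \<in> ring_iso (envelope br) (gdual_ring V) \<and>
     (\<forall>c t. \<phi> (env_class br (smul c t)) = (\<lambda>x. c * \<phi> (env_class br t) x)) \<and>
     (\<forall>t. \<phi> (env_class br t) 1 = counit t) \<and>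
     (\<forall>t. gdual_coproduct V (\<phi> (env_class br t)) =
        (\<lambda>x y. \<Sum>(v, w)\<in>Poly_Mapping.keys (tensor_coproduct t).
           Poly_Mapping.lookup (tensor_coproduct t) (v, w) *
           (\<phi> (env_class br (Poly_Mapping.single v 1)) x *
            \<phi> (env_class br (Poly_Mapping.single w 1)) y))) \<and>
     (\<forall>\<gamma>. \<phi> ` env_class br ` {t. homogeneous word_degree \<gamma> t} = gdual_component V \<gamma>)"

end

theory Submission
  imports Defs
begin

text \<open>Let \<open>Y\<^sub>q\<close> be the sum of the \<open>X\<^sub>j\<close> with \<open>j \<in> I\<^sub>q\<close>. Since \<open>1 + b Y = F\<^bsub>b,b\<^esub>(Y)\<close>, the
  argument of \<open>B\<^bsub>(i,\<alpha>)\<^esub>\<close> is in all cases \<open>Q\<^sub>\<alpha> R\<^sub>i\<close>, where \<open>Q\<^sub>\<alpha>\<close> is the product of the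
  \<open>F\<^bsub>A\<^sub>q \<cdot> \<alpha>, b\<^sub>q\<^esub>(Y\<^sub>q)\<close> and \<open>R\<^sub>i\<close> a product of the same kind that does not depend on \<open>\<alpha>\<close>.
  The coproduct of the solution is
  \<open>\<Delta> X\<^sub>i = X\<^sub>i \<otimes> 1 + (R\<^sub>i \<otimes> 1) (\<Sum>\<gamma>. Q\<^sub>\<gamma> \<otimes> X\<^sub>i(\<gamma>))\<close>. This follows by induction on the number of
  vertices from the cocycle property of the grafting operators, because \<open>x \<mapsto> Q\<^sub>\<gamma> \<otimes> x\<close> (for \<open>x\<close>
  of degree \<open>\<gamma>\<close>) is an algebra morphism and \<open>F\<^bsub>a,b\<^esub>(x + y + b x y) = F\<^bsub>a,b\<^esub>(x) F\<^bsub>a,b\<^esub>(y)\<close>. The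
  identities for \<open>F\<close> are read off the equation \<open>(1 + b Y) D(F\<^bsub>a,b\<^esub>(Y)) = a F\<^bsub>a,b\<^esub>(Y) D(Y)\<close>, where
  \<open>D\<close> is the derivation that multiplies a forest by its number of trees; it characterises
  \<open>F\<^bsub>a,b\<^esub>(Y)\<close> among the series with constant term 1.

  For the graded dual, let \<open>f\<^sub>d\<close> be the linear form that selects the tree with one vertex decorated
  by \<open>d\<close>. Contracting the left factor of the coproduct with \<open>f\<^sub>d\<close> gives a derivation of the
  Connes-Kreimer algebra, which maps \<open>X\<^sub>i(\<alpha> + \<beta>)\<close> to a multiple of \<open>X\<^sub>i(\<alpha>)\<close> if \<open>d = (j, \<beta>)\<close>; the
  factor is the structure constant of the fundamental pre-Lie algebra. Hence, on the subalgebra,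
  the \<open>f\<^sub>d\<close> satisfy the relations of the enveloping algebra. A convolution product of \<open>n\<close> of them
  vanishes on the monomials of degree more than \<open>n\<close> in the \<open>X\<^sub>i(\<alpha>)\<close>, and on a monomial of degree
  \<open>n\<close> it is nonzero exactly if the indices agree up to order. As words with the same letters
  are congruent modulo shorter words, this triangularity yields the bijectivity (and the
  Poincare-Birkhoff-Witt theorem is not needed).\<close>


section \<open>Linear algebra on free vector spaces\<close>

abbreviation "lookup \<equiv> Poly_Mapping.lookup"
abbreviation "keys \<equiv> Poly_Mapping.keys"
abbreviation "single \<equiv> Poly_Mapping.single"

text \<open>A linear form is given by its values on the basis, and \<open>ev f\<close> is its linear
  extension. The duality arguments below work with such functions on forests.\<close>

definition ev :: "('a \<Rightarrow> 'k) \<Rightarrow> ('a \<Rightarrow>\<^sub>0 'k::field) \<Rightarrow> 'k" where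
  "ev f x = (\<Sum>a\<in>keys x. lookup x a * f a)"

lemma ev_superset:
  assumes "finite S" "keys x \<subseteq> S"
  shows "ev f x = (\<Sum>a\<in>S. lookup x a * f a)"
  unfolding ev_def by (rule sum.mono_neutral_left) (use assms in \<open>auto simp: in_keys_iff\<close>)

lemma ev_add: "ev f (x + y) = ev f x + ev f y"
proof -
  have "keys (x + y) \<subseteq> keys x \<union> keys y" by (rule Poly_Mapping.keys_add)
  then show ?thesis
    by (simp add: ev_superset[of "keys x \<union> keys y"] lookup_add distrib_right sum.distrib)
qed

lemma ev_smul: "ev f (smul c x) = c * ev f x"
proof -
  have "keys (smul c x) \<subseteq> keys x" by (auto simp: in_keys_iff)
  then show ?thesis
    by (simp add: ev_superset[of "keys x"] sum_distrib_left mult.assoc)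
qed

lemma ev_zero [simp]: "ev f 0 = 0"
  by (simp add: ev_def)

lemma ev_single [simp]: "ev f (single a c) = c * f a"
  by (simp add: ev_superset[of "{a}"])

lemma smul_minus_one: "smul (- 1) x = - x"
  by (rule poly_mapping_eqI) simp

lemma ev_uminus: "ev f (- x) = - ev f x"
  using ev_smul[of f "- 1" x] by (simp add: smul_minus_one)

lemma ev_diff: "ev f (x - y) = ev f x - ev f y"
  using ev_add[of f x "- y"] by (simp add: ev_uminus)

lemma ev_lin_ext: "ev f (lin_ext g x) = ev (\<lambda>a. ev f (g a)) x"
  by (induction x rule: free_induct) (simp_all add: ev_add ev_smul lin_ext_add)

lemma ev_cong: "(\<And>a. a \<in> keys x \<Longrightarrow> f a = g a) \<Longrightarrow> ev f x = ev g x"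
  by (simp add: ev_def)

lemma ev_pointwise: "ev (\<lambda>a. f a + g a) x = ev f x + ev g x"
  by (simp add: ev_def distrib_left sum.distrib)

lemma ev_pointwise_mult: "ev (\<lambda>a. c * f a) x = c * ev f x" "ev (\<lambda>a. f a * c) x = ev f x * c"
  by (simp_all add: ev_def sum_distrib_left sum_distrib_right ac_simps)

lemma ev_pointwise_zero [simp]: "ev (\<lambda>a. 0) x = 0"
  by (simp add: ev_def)

lemma ev_swap: "ev (\<lambda>a. ev (\<lambda>b. f a b) y) x = ev (\<lambda>b. ev (\<lambda>a. f a b) x) y"
  by (induction x rule: free_induct) (simp_all add: ev_add ev_pointwise ev_pointwise_mult)

lemma ev_lookup_delta: "ev (\<lambda>a. if a = b then c else 0) x = lookup x b * c"
proof (cases "b \<in> keys x")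
  case True
  have "ev (\<lambda>a. if a = b then c else 0) x = (\<Sum>a\<in>keys x. if a = b then lookup x a * c else 0)"
    unfolding ev_def by (rule sum.cong) auto
  also have "\<dots> = lookup x b * c" using True by (subst sum.delta) auto
  finally show ?thesis .
next
  case False
  have "ev (\<lambda>a. if a = b then c else 0) x = ev (\<lambda>a. 0) x"
    by (rule ev_cong) (use False in auto)
  with False show ?thesis by (simp add: in_keys_iff)
qed

lemma lookup_lin_ext: "lookup (lin_ext g x) b = ev (\<lambda>a. lookup (g a) b) x"
  by (simp add: lin_ext_def ev_def lookup_sum)

lemma lin_ext_lin_ext: "lin_ext f (lin_ext g x) = lin_ext (\<lambda>a. lin_ext f (g a)) x"
  by (induction x rule: free_induct) (simp_all add: lin_ext_add lin_ext_smul)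

lemma lin_ext_cong: "(\<And>a. a \<in> keys x \<Longrightarrow> f a = g a) \<Longrightarrow> lin_ext f x = lin_ext g x"
  by (simp add: lin_ext_def)

lemma lin_ext_uminus: "lin_ext g (- x) = - lin_ext g x"
  using lin_ext_smul[of g "- 1" x] by (simp add: smul_minus_one)

lemma lin_ext_diff: "lin_ext g (x - y) = lin_ext g x - lin_ext g y"
  using lin_ext_add[of g x "- y"] by (simp add: lin_ext_uminus)

lemma lin_ext_pointwise_zero [simp]: "lin_ext (\<lambda>a. 0) x = 0"
  by (simp add: lin_ext_def)

lemma lin_ext_pointwise_smul: "lin_ext (\<lambda>a. smul c (g a)) x = smul c (lin_ext g x)"
  by (simp add: lin_ext_def smul_sum smul_smul mult.commute)

lemma lin_ext_pointwise_uminus: "lin_ext (\<lambda>a. - g a) x = - lin_ext g x"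
  using lin_ext_pointwise_smul[of "- 1" g x] by (simp add: smul_minus_one)

lemma lin_ext_single_one [simp]: "lin_ext (\<lambda>a. single a 1) x = x"
  by (induction x rule: free_induct) (simp_all add: lin_ext_add smul_single)

lemma smul_eq_mult: "smul c z = single 0 c * z" "smul c z = z * single 0 c"
  for z :: "'a::monoid_add \<Rightarrow>\<^sub>0 'k::field"
  by (induction z rule: free_induct)
    (simp_all add: smul_single mult_single smul_add distrib_left distrib_right mult.commute)

text \<open>The counterpart of \<open>smul_mult\<close> for noncommutative monoids, needed for
  words. Scalars act as multiples of the unit, which are central by
  \<open>smul_eq_mult\<close>.\<close>

lemma smul_mult_monoid: "smul c x * y = smul c (x * y)" "x * smul c y = smul c (x * y)"
  for x y :: "'a::monoid_add \<Rightarrow>\<^sub>0 'k::field"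
  by (simp_all add: smul_eq_mult(1)[of c x] smul_eq_mult(1)[of c "x * y"] mult.assoc)
     (simp add: smul_eq_mult mult.assoc flip: smul_eq_mult(1))

lemma single_add_one: "single (a + b) 1 = single a 1 * (single b 1 :: _ \<Rightarrow>\<^sub>0 'k::field)"
  by (simp add: mult_single)

lemma lin_ext_mult:
  fixes f g h :: "_ \<Rightarrow> ('b::monoid_add \<Rightarrow>\<^sub>0 'k::field)" and x y :: "'a::monoid_add \<Rightarrow>\<^sub>0 'k"
  assumes "\<And>a b. f (a + b) = g a * h b"
  shows "lin_ext f (x * y) = lin_ext g x * lin_ext h y"
proof (induction x rule: free_induct)
  case (single a c)
  show ?case
  proof (induction y rule: free_induct)
    case (single b d)
    show ?case by (simp add: mult_single assms smul_mult_monoid smul_smul mult.commute[of d c])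
  qed (simp add: distrib_left lin_ext_add)
qed (simp add: distrib_right lin_ext_add)

text \<open>In the application \<open>e\<close> applies the counit to the left tensor factor and
  \<open>h\<close> selects a leaf there.\<close>

lemma lin_ext_derivation:
  fixes h e :: "_ \<Rightarrow> ('b::monoid_add \<Rightarrow>\<^sub>0 'k::field)" and x y :: "'a::monoid_add \<Rightarrow>\<^sub>0 'k"
  assumes "\<And>a b. h (a + b) = h a * e b + e a * h b"
  shows "lin_ext h (x * y) = lin_ext h x * lin_ext e y + lin_ext e x * lin_ext h y"
proof (induction x rule: free_induct)
  case (single a c)
  show ?case
  proof (induction y rule: free_induct)
    case (single b d)
    show ?case by (simp add: mult_single assms smul_mult_monoid smul_smul smul_add mult.commute[of d c])
  qed (simp add: distrib_left lin_ext_add algebra_simps)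
qed (simp add: distrib_right lin_ext_add algebra_simps)

lemma lin_ext_mult_right:
  "lin_ext (\<lambda>a. g a * y) x = lin_ext g x * y"
  for g :: "'c \<Rightarrow> ('a::monoid_add \<Rightarrow>\<^sub>0 'k::field)"
  by (induction x rule: free_induct) (simp_all add: lin_ext_add distrib_right smul_mult_monoid)

lemma lin_ext_mult_left:
  "lin_ext (\<lambda>a. y * g a) x = y * lin_ext g x"
  for g :: "'c \<Rightarrow> ('a::monoid_add \<Rightarrow>\<^sub>0 'k::field)"
  by (induction x rule: free_induct) (simp_all add: lin_ext_add distrib_left smul_mult_monoid)

lemma ev_mult_bilinear:
  fixes x y :: "'a::monoid_add \<Rightarrow>\<^sub>0 'k::field"
  shows "ev f (x * y) = ev (\<lambda>a. ev (\<lambda>b. f (a + b)) y) x"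
proof (induction x rule: free_induct)
  case (single a c)
  show ?case
    by (induction y rule: free_induct) (simp_all add: mult_single distrib_left ev_add)
qed (simp add: distrib_right ev_add)

section \<open>Tensor products of free vector spaces\<close>

lemma tens_add_right: "tens x (y + y') = tens x y + tens x y'"
  by (simp add: tens_eq_lin_ext lin_ext_add lin_ext_pointwise)

lemma tens_smul: "tens (smul c x) y = smul c (tens x y)" "tens x (smul c y) = smul c (tens x y)"
  by (simp_all add: tens_eq_lin_ext lin_ext_smul lin_ext_pointwise_smul)

lemma tens_zero [simp]: "tens 0 y = 0" "tens x 0 = 0"
  by (simp_all add: tens_eq_lin_ext)

lemma lookup_tens: "lookup (tens x y) (a, b) = lookup x a * lookup y b"
proof (induction x rule: free_induct)
  case (single a' c)
  show ?case
    by (induction y rule: free_induct)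
      (auto simp: tens_single tens_add_right lookup_add distrib_left lookup_single when_def)
qed (simp add: tens_add_left lookup_add distrib_right)

lemma tens_mult: "tens x y * tens x' y' = tens (x * x') (y * y')"
  for x x' :: "'a::monoid_add \<Rightarrow>\<^sub>0 'k::field" and y y' :: "'b::monoid_add \<Rightarrow>\<^sub>0 'k"
proof (induction x rule: free_induct)
  case (single a c)
  show ?case
  proof (induction y rule: free_induct)
    case (single b d)
    show ?case
    proof (induction x' rule: free_induct)
      case (single a' c')
      show ?case
        by (induction y' rule: free_induct)
          (simp_all add: tens_single mult_single tens_add_right distrib_left ac_simps)
    qed (simp add: tens_add_left distrib_left)
  qed (simp add: tens_add_right distrib_right)
qed (simp add: tens_add_left distrib_right)

lemma ev_tens: "ev (\<lambda>(a, b). f a * g b) (tens x y) = ev f x * ev g y"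
proof (induction x rule: free_induct)
  case (single a c)
  show ?case
    by (induction y rule: free_induct)
      (auto simp: tens_single tens_add_right ev_add distrib_left ac_simps)
qed (simp add: tens_add_left ev_add distrib_right)

lemma lookup_mult_splits:
  fixes x y :: "'a::monoid_add \<Rightarrow>\<^sub>0 'k::field"
  assumes fin: "finite {(u, v). u + v = w}"
  shows "lookup (x * y) w = (\<Sum>(u, v) | u + v = w. lookup x u * lookup y v)"
proof (induction x rule: free_induct)
  case (single a c)
  show ?case
  proof (induction y rule: free_induct)
    case (single b d)
    have "(\<Sum>(u, v) | u + v = w. lookup (single a c) u * lookup (single b d) v) =
        (\<Sum>p\<in>{(u, v). u + v = w}. if p = (a, b) then c * d else 0)"
      by (intro sum.cong refl) (auto simp: lookup_single when_def split: if_splits)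
    then show ?case using fin by (simp add: mult_single lookup_single when_def sum.delta)
  qed (simp add: distrib_left lookup_add sum.distrib case_prod_unfold)
qed (simp add: distrib_right lookup_add sum.distrib case_prod_unfold)


section \<open>The coproduct on forests\<close>

definition cop :: "'d forest \<Rightarrow> ('d forest \<times> 'd forest \<Rightarrow>\<^sub>0 'k::field)" where
  "cop F = \<Prod>\<^sub># (image_mset tree_coproduct F)"

text \<open>This grading by multisets refines those by degree and by number of vertices. The
  coproduct preserves it, and each multiset belongs to only finitely many forests, whatever the type
  of decorations.\<close>

definition forest_decos :: "'d forest \<Rightarrow> 'd multiset" where
  "forest_decos F = \<Sum>\<^sub># (image_mset decorations F)"

lemma forest_decos_simps [simp]:
  "forest_decos {#} = {#}" "forest_decos (F + G) = forest_decos F + forest_decos G"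
  "forest_decos {#Node d F#} = add_mset d (forest_decos F)"
  by (simp_all add: forest_decos_def)

lemma forest_decos_add_mset: "forest_decos (add_mset t F) = decorations t + forest_decos F"
  by (simp add: forest_decos_def)

lemma size_decorations_pos: "size (decorations t) > 0"
  by (cases t) simp

lemma size_le_forest_decos: "size F \<le> size (forest_decos F)"
proof (induction F)
  case (add t F)
  then show ?case using size_decorations_pos[of t] by (simp add: forest_decos_add_mset)
qed simp

lemma forest_decos_eq_empty [simp]: "forest_decos F = {#} \<longleftrightarrow> F = {#}"
  using size_le_forest_decos[of F] by auto

text \<open>The cases match the characterisation of the coproduct: unit, cocycle property and
  multiplicativity.\<close>

lemma forest_induct [case_names empty graft union]:
  assumes empty: "P {#}" and graft: "\<And>d F. P F \<Longrightarrow> P {#Node d F#}"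
    and union: "\<And>F G. P F \<Longrightarrow> P G \<Longrightarrow> P (F + G)"
  shows "P F"
proof -
  have *: "P F" if "\<And>t. t \<in># F \<Longrightarrow> P {#t#}" for F
    using that
  proof (induction F)
    case (add t F)
    then show ?case using union[of "{#t#}" F] by simp
  qed (simp add: empty)
  have "P {#t#}" for t
    by (induction t) (simp add: graft *)
  then show ?thesis using * by blast
qed

lemma coproduct_eq: "coproduct = lin_ext cop"
  by (simp add: coproduct_def cop_def[abs_def])

lemma coproduct_single [simp]: "coproduct (single F c) = smul c (cop F)"
  by (simp add: coproduct_eq)

lemma coproduct_mult: "coproduct (x * y) = coproduct x * coproduct y"
  using is_coproduct_coproduct unfolding is_coproduct_def by blast

lemma cop_empty [simp]: "cop {#} = 1"
  by (simp add: cop_def)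

lemma cop_add: "cop (F + G) = cop F * cop G"
  by (simp add: cop_def)

lemma cop_graft: "cop {#Node d F#} = single ({#Node d F#}, {#}) 1 + graft_right d (cop F)"
  by (simp add: cop_def)

lemma one_pair: "(1 :: 'a::zero \<times> 'b::zero \<Rightarrow>\<^sub>0 'k::zero_neq_one) = single (0, 0) 1"
  by (simp flip: single_one add: zero_prod_def)

lemma keys_graft_right:
  "p \<in> keys (graft_right d x) \<Longrightarrow> \<exists>F G. p = (F, {#Node d G#}) \<and> (F, G) \<in> keys x"
proof -
  assume p: "p \<in> keys (graft_right d x)"
  have "keys (graft_right d x) \<subseteq> (\<Union>a\<in>keys x. keys (smul (lookup x a) (case a of (F, G) \<Rightarrow> single (F, {#Node d G#}) 1)))"
    unfolding graft_right_def lin_ext_def by (rule keys_sum)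
  with p obtain a where "a \<in> keys x"
    "p \<in> keys (smul (lookup x a) (case a of (F, G) \<Rightarrow> single (F, {#Node d G#}) 1))" by blast
  then show ?thesis by (cases a) (auto simp: smul_single split: if_splits)
qed

text \<open>Right grafting adds the root to the right factor only, and products add up in both
  factors.\<close>

lemma cop_keys: "(G, H) \<in> keys (cop F :: _ \<Rightarrow>\<^sub>0 'k::field) \<Longrightarrow> forest_decos G + forest_decos H = forest_decos F"
proof (induction F arbitrary: G H rule: forest_induct)
  case empty
  then show ?case by (simp add: one_pair)
next
  case (graft d F)
  from graft.prems consider "(G, H) = ({#Node d F#}, {#})" | "(G, H) \<in> keys (graft_right d (cop F :: _ \<Rightarrow>\<^sub>0 'k))"
    unfolding cop_graft using Poly_Mapping.keys_add by (fastforce split: if_splits)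
  then show ?case
    by cases (use graft.IH keys_graft_right in \<open>fastforce+\<close>)
next
  case (union F1 F2)
  from union.prems obtain G1 H1 G2 H2 where "G = G1 + G2" "H = H1 + H2"
    "(G1, H1) \<in> keys (cop F1 :: _ \<Rightarrow>\<^sub>0 'k)" "(G2, H2) \<in> keys (cop F2 :: _ \<Rightarrow>\<^sub>0 'k)"
    unfolding cop_add using keys_mult by fastforce
  with union.IH show ?case by (metis (no_types) forest_decos_simps(2) add.assoc add.left_commute)
qed

section \<open>Counit axioms and coassociativity\<close>

lemma lin_ext_graft_right:
  "lin_ext h (graft_right d x) = lin_ext (\<lambda>(G, H). h (G, {#Node d H#})) x"
  by (simp add: graft_right_def lin_ext_lin_ext case_prod_unfold)

text \<open>The contraction is multiplicative. On a tree it kills the term with empty right factor,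
  and the grafted terms reduce to the forest below the root.\<close>

lemma counit_left: "lin_ext (\<lambda>(G, H). if G = {#} then single H 1 else 0) (cop F) = (single F 1 :: _ \<Rightarrow>\<^sub>0 'k::field)"
proof (induction F rule: forest_induct)
  case (graft d F)
  have "lin_ext (\<lambda>(G, H). if G = {#} then single {#Node d H#} 1 else 0) (cop F) =
     graft d (lin_ext (\<lambda>(G, H). if G = {#} then single H 1 else 0) (cop F) :: _ \<Rightarrow>\<^sub>0 'k)"
    by (auto simp: graft_def lin_ext_lin_ext intro!: lin_ext_cong)
  then show ?case
    by (simp add: cop_graft lin_ext_add lin_ext_graft_right graft) (simp add: graft_def)
next
  case (union F G)
  have "lin_ext (\<lambda>(G, H). if G = {#} then single H 1 else 0) (cop F * cop G) =
    lin_ext (\<lambda>(G, H). if G = {#} then single H 1 else 0) (cop F) *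
    (lin_ext (\<lambda>(G, H). if G = {#} then single H 1 else 0) (cop G) :: _ \<Rightarrow>\<^sub>0 'k)"
    by (rule lin_ext_mult) (auto simp: mult_single)
  then show ?case by (simp add: cop_add union mult_single)
qed (simp add: one_pair)

lemma counit_right: "lin_ext (\<lambda>(G, H). if H = {#} then single G 1 else 0) (cop F) = (single F 1 :: _ \<Rightarrow>\<^sub>0 'k::field)"
proof (induction F rule: forest_induct)
  case (graft d F)
  show ?case
    by (simp add: cop_graft lin_ext_add lin_ext_graft_right case_prod_unfold)
next
  case (union F G)
  have "lin_ext (\<lambda>(G, H). if H = {#} then single G 1 else 0) (cop F * cop G) =
    lin_ext (\<lambda>(G, H). if H = {#} then single G 1 else 0) (cop F) *
    (lin_ext (\<lambda>(G, H). if H = {#} then single G 1 else 0) (cop G) :: _ \<Rightarrow>\<^sub>0 'k)"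
    by (rule lin_ext_mult) (auto simp: mult_single)
  then show ?case by (simp add: cop_add union mult_single)
qed (simp add: one_pair)

text \<open>Both sides are multiplicative with values in the threefold tensor product, so only trees
  matter. There both satisfy the same recursion, in which \<open>gr\<close> grafts the third
  factor.\<close>

lemma coassoc_single:
  "lin_ext (\<lambda>(G, H). lin_ext (\<lambda>(G1, G2). single (G1, G2, H) 1) (cop G)) (cop F) =
   (lin_ext (\<lambda>(G, H). lin_ext (\<lambda>(H1, H2). single (G, H1, H2) 1) (cop H)) (cop F) :: _ \<Rightarrow>\<^sub>0 'k::field)"
  (is "lin_ext ?l (cop F) = lin_ext ?r (cop F)")
proof (induction F rule: forest_induct)
  case empty
  show ?case by (simp add: one_pair)
next
  case (graft d F)
  define gr :: "('a forest \<times> 'a forest \<times> 'a forest \<Rightarrow>\<^sub>0 'k) \<Rightarrow> _" where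
    "gr = lin_ext (\<lambda>(a, b, c). single (a, b, {#Node d c#}) 1)"
  have l: "?l (G, {#Node d H#}) = gr (?l (G, H))" for G H
    by (simp add: gr_def lin_ext_lin_ext case_prod_unfold)
  have r: "?r (G, {#Node d H#}) = single (G, {#Node d H#}, {#}) 1 + gr (?r (G, H))" for G H
    by (simp add: gr_def lin_ext_lin_ext case_prod_unfold cop_graft lin_ext_add lin_ext_graft_right)
  have gr_lin: "lin_ext (\<lambda>(G, H). gr (h (G, H))) x = gr (lin_ext h x)" for h and x :: "'a forest \<times> 'a forest \<Rightarrow>\<^sub>0 'k"
    by (simp add: gr_def lin_ext_lin_ext case_prod_unfold)
  have "lin_ext ?l (cop {#Node d F#}) = single ({#Node d F#}, {#}, {#}) 1 +
      lin_ext (\<lambda>(G1, G2). single (G1, {#Node d G2#}, {#}) 1) (cop F) + gr (lin_ext ?l (cop F))"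
    unfolding cop_graft lin_ext_add lin_ext_graft_right l gr_lin
    by (simp add: cop_graft lin_ext_add lin_ext_graft_right)
  moreover have "lin_ext ?r (cop {#Node d F#}) = single ({#Node d F#}, {#}, {#}) 1 +
      (lin_ext (\<lambda>(G1, G2). single (G1, {#Node d G2#}, {#}) 1) (cop F) + gr (lin_ext ?r (cop F)))"
    unfolding cop_graft[of d F] lin_ext_add lin_ext_graft_right r
    using gr_lin[of ?r] by (simp add: case_prod_unfold lin_ext_pointwise one_pair)
  ultimately show ?case using graft by (simp only: add.assoc)
next
  case (union F1 F2)
  have "?l (a + b) = ?l a * ?l b" for a b
    by (cases a; cases b) (auto simp: cop_add mult_single intro!: lin_ext_mult)
  moreover have "?r (a + b) = ?r a * ?r b" for a b
    by (cases a; cases b) (auto simp: cop_add mult_single intro!: lin_ext_mult)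
  ultimately show ?case
    by (simp only: cop_add lin_ext_mult[of ?l ?l ?l] lin_ext_mult[of ?r ?r ?r] union)
qed

lemma coassoc:
  "lin_ext (\<lambda>(G, H). lin_ext (\<lambda>(G1, G2). h G1 G2 H) (cop G)) (cop F) =
   lin_ext (\<lambda>(G, H). lin_ext (\<lambda>(H1, H2). h G H1 H2) (cop H)) (cop F)"
  for h :: "_ \<Rightarrow> _ \<Rightarrow> _ \<Rightarrow> ('c \<Rightarrow>\<^sub>0 'k::field)"
  using arg_cong[OF coassoc_single[of F], of "lin_ext (\<lambda>(a, b, c). h a b c)"]
  by (simp add: lin_ext_lin_ext case_prod_unfold)

lemma coassoc_ev:
  "ev (\<lambda>(G, H). ev (\<lambda>(G1, G2). h G1 G2 H) (cop G)) (cop F) =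
   ev (\<lambda>(G, H). ev (\<lambda>(H1, H2). h G H1 H2) (cop H)) (cop F)"
  for h :: "_ \<Rightarrow> _ \<Rightarrow> _ \<Rightarrow> 'k::field"
  using arg_cong[OF coassoc_single[of F], of "ev (\<lambda>(a, b, c). h a b c)"]
  by (simp add: ev_lin_ext case_prod_unfold)


section \<open>The antipode\<close>

text \<open>The condition on the sizes always holds for the terms of the coproduct, by \<open>cop_keys\<close>; it
  is only there to make the recursion well-founded.\<close>

function antipode_tree :: "'d rtree \<Rightarrow> ('d, 'k::field) ck" where
  "antipode_tree (Node d F) = - (\<Sum>(G, H)\<in>keys (cop F :: _ \<Rightarrow>\<^sub>0 'k). smul (lookup (cop F) (G, H))
     ((if size (forest_decos G) \<le> size (forest_decos F) then \<Prod>\<^sub># (image_mset antipode_tree G) else 0) *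
       single {#Node d H#} 1))"
  by pat_completeness auto
termination
proof (relation "measure (size \<circ> decorations)", simp, goal_cases)
  case (1 d F p G H t)
  then have "t \<in># G" by (simp split: if_splits)
  then have "size (decorations t) \<le> size (forest_decos G)"
    by (auto dest!: multi_member_split simp: forest_decos_add_mset)
  with 1 show ?case by (simp add: forest_decos_def split: if_splits)
qed

definition antipode :: "('d, 'k::field) ck \<Rightarrow> ('d, 'k) ck" where
  "antipode = lin_ext (\<lambda>F. \<Prod>\<^sub># (image_mset antipode_tree F))"

lemma antipode_mult: "antipode (x * y) = antipode x * antipode y"
  unfolding antipode_def by (rule lin_ext_mult) simp

text \<open>By \<open>cop_keys\<close> the size guard of the recursion always holds. What remains is
  the left antipode axiom at a tree, solved for the value at that tree.\<close>

lemma antipode_graft: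
  "antipode (single {#Node d F#} 1) =
     - lin_ext (\<lambda>(G, H). antipode (single G 1) * single {#Node d H#} 1) (cop F :: _ \<Rightarrow>\<^sub>0 'k::field)"
proof -
  have "size (forest_decos G) \<le> size (forest_decos F)" if "(G, H) \<in> keys (cop F :: _ \<Rightarrow>\<^sub>0 'k)" for G H
    using arg_cong[OF cop_keys[OF that], of size] by simp
  note le = this
  have "(antipode_tree (Node d F) :: (_, 'k) ck) = - (\<Sum>(G, H)\<in>keys (cop F :: _ \<Rightarrow>\<^sub>0 'k).
      smul (lookup (cop F) (G, H)) (\<Prod>\<^sub># (image_mset antipode_tree G) * single {#Node d H#} 1))"
    unfolding antipode_tree.simps
  proof (rule arg_cong[where f = uminus], rule sum.cong[OF refl], clarify)
    fix G H assume "(G, H) \<in> keys (cop F :: _ \<Rightarrow>\<^sub>0 'k)"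
    from le[OF this] show "smul (lookup (cop F) (G, H))
      ((if size (forest_decos G) \<le> size (forest_decos F) then \<Prod>\<^sub># (image_mset antipode_tree G) else 0) *
       single {#Node d H#} 1) =
      smul (lookup (cop F) (G, H)) (\<Prod>\<^sub># (image_mset antipode_tree G) * single {#Node d H#} (1 :: 'k))" by simp
  qed
  then show ?thesis
    by (simp add: antipode_def lin_ext_def[of _ "cop F"] case_prod_unfold del: antipode_tree.simps)
qed

lemma antipode_left:
  "lin_ext (\<lambda>(F, G). antipode (single F 1) * single G 1) (cop F) =
    (if F = {#} then 1 else (0 :: ('d, 'k::field) ck))" (is "lin_ext ?h _ = _")
proof (induction F rule: forest_induct)
  case empty
  show ?case by (simp add: one_pair antipode_def)
next
  case (graft d F)
  show ?case
    by (simp add: cop_graft lin_ext_add lin_ext_graft_right antipode_graft)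
next
  case (union F G)
  have "?h (a + b) = ?h a * ?h b" for a b
    by (cases a; cases b) (simp add: antipode_mult single_add_one ac_simps)
  then show ?case by (simp add: cop_add lin_ext_mult[of ?h ?h ?h] union)
qed

text \<open>The recursion only builds in the left axiom. For a tree, coassociativity moves the inner
  sum to the left factor, where the induction hypothesis leaves only the empty forest;
  \<open>counit_left\<close> then gives the tree itself, which cancels.\<close>

lemma antipode_right:
  "lin_ext (\<lambda>(F, G). single F 1 * antipode (single G 1)) (cop F) =
    (if F = {#} then 1 else (0 :: ('d, 'k::field) ck))" (is "lin_ext ?h _ = _")
proof (induction "size (forest_decos F)" arbitrary: F rule: less_induct)
  case less
  have mult: "?h (a + b) = ?h a * ?h b" for a b
    by (cases a; cases b) (simp add: antipode_mult single_add_one ac_simps)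
  consider "F = {#}" | d K where "F = {#Node d K#}" | t G where "F = add_mset t G" "G \<noteq> {#}"
    by (metis multiset_cases rtree.exhaust)
  then show ?case
  proof cases
    case 1
    then show ?thesis by (simp add: one_pair antipode_def)
  next
    case (2 d K)
    have "lin_ext (\<lambda>(G, H). single G 1 * antipode (single {#Node d H#} 1)) (cop K) =
      - lin_ext (\<lambda>(G, H). lin_ext (\<lambda>(H1, H2). single G 1 * (antipode (single H1 1) * single {#Node d H2#} 1)) (cop H))
           (cop K :: _ \<Rightarrow>\<^sub>0 'k)"
      by (simp only: antipode_graft lin_ext_pointwise_uminus lin_ext_mult_left[symmetric] case_prod_unfold
          mult_minus_right)
    also have "\<dots> = - lin_ext (\<lambda>(G, H). lin_ext (\<lambda>(G1, G2). single G1 1 * (antipode (single G2 1) * single {#Node d H#} 1)) (cop G))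
           (cop K :: _ \<Rightarrow>\<^sub>0 'k)"
      by (rule arg_cong[of _ _ uminus], rule sym,
          rule coassoc[where h = "\<lambda>a b c. single a 1 * (antipode (single b 1) * single {#Node d c#} 1)"])
    also have "\<dots> = - lin_ext (\<lambda>(G, H). lin_ext ?h (cop G) * single {#Node d H#} 1) (cop K :: _ \<Rightarrow>\<^sub>0 'k)"
      by (simp only: case_prod_unfold lin_ext_mult_right[symmetric] mult.assoc)
    also have "lin_ext (\<lambda>(G, H). lin_ext ?h (cop G) * single {#Node d H#} 1) (cop K) =
        lin_ext (\<lambda>(G, H). if G = {#} then single {#Node d H#} 1 else 0) (cop K :: _ \<Rightarrow>\<^sub>0 'k)"
    proof (rule lin_ext_cong, clarify)
      fix G H assume "(G, H) \<in> keys (cop K :: _ \<Rightarrow>\<^sub>0 'k)"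
      from arg_cong[OF cop_keys[OF this], of size] have "size (forest_decos G) < size (forest_decos F)"
        using 2 by simp
      from less[OF this]
      show "lin_ext ?h (cop G) * single {#Node d H#} 1 = (if G = {#} then single {#Node d H#} 1 else 0)" by simp
    qed
    also have "\<dots> = lin_ext (\<lambda>F. single {#Node d F#} 1) (lin_ext (\<lambda>(G, H). if G = {#} then single H 1 else 0) (cop K :: _ \<Rightarrow>\<^sub>0 'k))"
      by (auto simp: lin_ext_lin_ext intro!: lin_ext_cong)
    also have "\<dots> = single {#Node d K#} 1"
      by (simp add: counit_left)
    finally show ?thesis using 2
      by (simp add: cop_graft lin_ext_add lin_ext_graft_right antipode_def case_prod_unfold)
  next
    case (3 t G)
    have "size (forest_decos {#t#}) < size (forest_decos F)" "size (forest_decos G) < size (forest_decos F)"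
      using 3 size_decorations_pos[of t] size_le_forest_decos[of G] by (auto simp: nonempty_has_size forest_decos_def)
    moreover have "cop F = cop {#t#} * (cop G :: _ \<Rightarrow>\<^sub>0 'k)"
      using cop_add[of "{#t#}" G] 3 by simp
    ultimately show ?thesis
      using 3 less by (simp add: lin_ext_mult[of ?h ?h ?h, OF mult])
  qed
qed

lemma is_antipode_antipode: "is_antipode (antipode :: ('d, 'k::field) ck \<Rightarrow> _)"
  unfolding is_antipode_def
proof (intro conjI allI)
  show "Vector_Spaces.linear smul smul (antipode :: ('d, 'k) ck \<Rightarrow> _)"
    by (simp add: antipode_def linear_lin_ext)
  have *: "lin_ext (\<lambda>F. if F = {#} then 1 else 0) x = smul (counit x) (1 :: ('d, 'k) ck)" for x
    by (rule poly_mapping_eqI)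
      (simp add: lookup_lin_ext counit_def ev_lookup_delta if_distrib[of "\<lambda>z. lookup z _"] cong: if_cong)
  fix x :: "('d, 'k) ck"
  show "lin_ext (\<lambda>(F, G). antipode (single F 1) * single G 1) (coproduct x) = smul (counit x) 1"
    by (simp add: coproduct_eq lin_ext_lin_ext antipode_left *)
  show "lin_ext (\<lambda>(F, G). single F 1 * antipode (single G 1)) (coproduct x) = smul (counit x) 1"
    by (simp add: coproduct_eq lin_ext_lin_ext antipode_right *)
qed


section \<open>Formal series\<close>

lemma coef_Series [simp]: "coef (Series f) F = f F"
  by (simp add: Series_inverse)

lemma coef_ring [simp]:
  "coef 0 F = 0" "coef 1 F = (if F = {#} then 1 else 0)" "coef (f + g) F = coef f F + coef g F"
  "coef (f - g) F = coef f F - coef g F"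
  by (transfer, simp)+

lemma coef_mult: "coef (f * g) F = (\<Sum>(G, H) | G + H = F. coef f G * coef g H)"
  by transfer simp

lemma coef_sum: "coef (sum f S) F = (\<Sum>i\<in>S. coef (f i) F)"
  by (induction S rule: infinite_finite_induct) simp_all

lemma coef_series_const [simp]: "coef (series_const c) F = (if F = {#} then c else 0)"
  by (simp add: series_const_def)

lemma splits_empty: "{(G, H). G + H = {#}} = {({#}, {#})}"
  by auto

lemma coef_mult_empty: "coef (f * g) {#} = coef f {#} * coef g {#}"
  by (simp add: coef_mult splits_empty)

lemma coef_const_mult [simp]: "coef (series_const c * f) F = c * coef f F"
proof -
  have "coef (series_const c * f) F = (\<Sum>p\<in>{(G, H). G + H = F}. if p = ({#}, F) then c * coef f F else 0)"
    unfolding coef_mult by (rule sum.cong) (auto split: if_splits)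
  then show ?thesis by (simp add: finite_splits)
qed

lemma series_const_add: "series_const (c + d) = series_const c + series_const d"
  and series_const_mult: "series_const (c * d) = series_const c * series_const d"
  and series_const_1 [simp]: "series_const 1 = 1"
  and series_const_0 [simp]: "series_const 0 = 0"
  by (rule series_eqI; simp)+

lemma series_const_of_nat: "series_const (of_nat n) = of_nat n"
  by (induction n) (simp_all add: series_const_add)

lemma coef_prod_empty: "coef (prod f S) {#} = (\<Prod>i\<in>S. coef (f i) {#})"
  by (induction S rule: infinite_finite_induct) (simp_all add: coef_mult_empty)

lemma finite_splits_proj [simp]: "finite {(G, H). G + H = (F :: 'a multiset)}"
  by (rule finite_splits)

section \<open>Truncations of the series F and equality up to a given order\<close>

lemma coef_power_eq_0:
  assumes "coef f {#} = 0" "size F < n"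
  shows "coef (f ^ n) F = 0"
  using assms(2)
proof (induction n arbitrary: F)
  case (Suc n)
  have "coef f G * coef (f ^ n) H = 0" if "G + H = F" for G H
  proof (cases "G = {#}")
    case False
    then have "size H < n" using Suc.prems that by (auto simp: nonempty_has_size)
    then show ?thesis using Suc.IH by simp
  qed (simp add: assms)
  then show ?case by (auto simp: coef_mult intro!: sum.neutral)
qed simp

lemma coef_series_F:
  assumes "coef f {#} = 0" "size F \<le> N"
  shows "coef (series_F a b f) F = (\<Sum>n\<le>N. F_coeff a b n * coef (f ^ n) F)"
proof -
  have "{n. F_coeff a b n * coef (f ^ n) F \<noteq> 0} \<subseteq> {..N}"
  proof
    fix n assume "n \<in> {n. F_coeff a b n * coef (f ^ n) F \<noteq> 0}"
    then have "\<not> size F < n" using coef_power_eq_0[OF assms(1), of F n] by auto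
    then show "n \<in> {..N}" using assms(2) by simp
  qed
  then show ?thesis
    unfolding series_F_def series_sum_def by (simp add: Sum_any.expand_superset)
qed

definition partial_F :: "'k::field_char_0 \<Rightarrow> 'k \<Rightarrow> nat \<Rightarrow> ('a, 'k) series \<Rightarrow> ('a, 'k) series" where
  "partial_F a b N f = (\<Sum>n\<le>N. series_const (F_coeff a b n) * f ^ n)"

lemma coef_partial_F:
  "coef f {#} = 0 \<Longrightarrow> size F \<le> N \<Longrightarrow> coef (partial_F a b N f) F = coef (series_F a b f) F"
  by (simp add: coef_series_F[of f F N] partial_F_def coef_sum)

text \<open>Equality of series below order \<open>n\<close>. The weight \<mu> will be the number of
  trees, the number of vertices, or the number of vertices of a pair of forests.\<close>

definition agree :: "('a multiset \<Rightarrow> nat) \<Rightarrow> nat \<Rightarrow> ('a, 'k::comm_ring_1) series \<Rightarrow> ('a, 'k) series \<Rightarrow> bool" where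
  "agree \<mu> n f g \<longleftrightarrow> (\<forall>F. \<mu> F < n \<longrightarrow> coef f F = coef g F)"

lemma agree_refl [simp]: "agree \<mu> n f f"
  and agree_sym: "agree \<mu> n f g \<Longrightarrow> agree \<mu> n g f"
  and agree_trans: "agree \<mu> n f g \<Longrightarrow> agree \<mu> n g h \<Longrightarrow> agree \<mu> n f h"
  and agree_add: "agree \<mu> n f g \<Longrightarrow> agree \<mu> n f' g' \<Longrightarrow> agree \<mu> n (f + f') (g + g')"
  by (auto simp: agree_def)

lemma agree_sum: "(\<And>i. i \<in> S \<Longrightarrow> agree \<mu> n (f i) (g i)) \<Longrightarrow> agree \<mu> n (sum f S) (sum g S)"
  by (induction S rule: infinite_finite_induct) (auto intro!: agree_add)

context
  fixes \<mu> :: "'a multiset \<Rightarrow> nat"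
  assumes \<mu>_add: "\<And>F G. \<mu> (F + G) = \<mu> F + \<mu> G"
begin

lemma agree_mult: "agree \<mu> n f g \<Longrightarrow> agree \<mu> n f' g' \<Longrightarrow> agree \<mu> n (f * f') (g * g')"
  unfolding agree_def coef_mult
  by (intro allI impI sum.cong refl) (auto simp: \<mu>_add)

lemma agree_power: "agree \<mu> n f g \<Longrightarrow> agree \<mu> n (f ^ m) (g ^ m)"
  by (induction m) (auto intro: agree_mult)

lemma agree_prod: "(\<And>i. i \<in> S \<Longrightarrow> agree \<mu> n (f i) (g i)) \<Longrightarrow> agree \<mu> n (prod f S) (prod g S)"
  by (induction S rule: infinite_finite_induct) (auto intro!: agree_mult)

lemma agree_series_F: "agree \<mu> n f g \<Longrightarrow> agree \<mu> n (series_F a b f) (series_F a b g)"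
  using agree_power[of n f g]
  by (simp add: agree_def series_F_def series_sum_def)

end


subsection \<open>The differential equation of the series F\<close>

definition number_op :: "('a, 'k::comm_ring_1) series \<Rightarrow> ('a, 'k) series" where
  "number_op f = Series (\<lambda>F. of_nat (size F) * coef f F)"

lemma coef_number_op [simp]: "coef (number_op f) F = of_nat (size F) * coef f F"
  by (simp add: number_op_def)

lemma number_op_add: "number_op (f + g) = number_op f + number_op g"
  by (rule series_eqI) (simp add: algebra_simps)

lemma number_op_mult: "number_op (f * g) = number_op f * g + f * number_op g"
proof (rule series_eqI)
  fix F
  have "coef (number_op (f * g)) F = (\<Sum>(G, H) | G + H = F. of_nat (size F) * (coef f G * coef g H))"
    by (simp add: coef_mult sum_distrib_left case_prod_unfold)
  also have "\<dots> = (\<Sum>(G, H) | G + H = F. of_nat (size G) * coef f G * coef g H + coef f G * (of_nat (size H) * coef g H))"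
    by (rule sum.cong) (auto simp: algebra_simps)
  finally show "coef (number_op (f * g)) F = coef (number_op f * g + f * number_op g) F"
    by (simp add: coef_mult sum.distrib case_prod_unfold)
qed

lemma number_op_const [simp]: "number_op (series_const c) = 0" "number_op 1 = 0"
  by (rule series_eqI, simp)+

lemma number_op_const_mult:
  "number_op (series_const c * f) = series_const c * number_op f"
  "number_op (f * series_const c) = series_const c * number_op f"
  by (simp_all add: number_op_mult)

lemma number_op_power: "number_op (f ^ Suc n) = of_nat (Suc n) * f ^ n * number_op f"
  by (induction n) (simp_all add: number_op_mult algebra_simps)

lemma F_coeff_Suc: "of_nat (Suc n) * F_coeff a b (Suc n) = (a - b * of_nat n) * F_coeff a b n"
  by (simp add: F_coeff_def field_simps del: of_nat_Suc)

text \<open>The truncation satisfies the differential equation up to an error of order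
  \<open>Suc N\<close> in \<open>f\<close>. The induction telescopes by means of
  \<open>F_coeff_Suc\<close>.\<close>

lemma partial_F_ode:
  fixes f :: "('a, 'k::field_char_0) series"
  shows "(1 + series_const b * f) * number_op (partial_F a b (Suc N) f) =
     series_const a * partial_F a b N f * number_op f +
     series_const (b * of_nat (Suc N) * F_coeff a b (Suc N)) * f ^ Suc N * number_op f"
proof (induction N)
  case 0
  show ?case
    using F_coeff_Suc[of 0 a b]
    by (simp add: partial_F_def number_op_add number_op_const_mult series_const_mult algebra_simps F_coeff_def)
next
  case (Suc N)
  let ?c = "F_coeff a b" and ?D = "number_op f" and ?k = "\<lambda>c. series_const c :: ('a, 'k) series"
  have "number_op (partial_F a b (Suc (Suc N)) f) = number_op (partial_F a b (Suc N) f) +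
      ?k (of_nat (Suc (Suc N)) * ?c (Suc (Suc N))) * f ^ Suc N * ?D"
    unfolding partial_F_def sum.atMost_Suc[of _ "Suc N"] number_op_add number_op_const_mult number_op_power
      series_const_mult series_const_of_nat by (simp only: ac_simps)
  then have "(1 + ?k b * f) * number_op (partial_F a b (Suc (Suc N)) f) =
      ?k a * partial_F a b N f * ?D + ?k (b * of_nat (Suc N) * ?c (Suc N)) * f ^ Suc N * ?D +
      (1 + ?k b * f) * (?k (of_nat (Suc (Suc N)) * ?c (Suc (Suc N))) * f ^ Suc N * ?D)"
    by (simp only: distrib_left Suc)
  also have "\<dots> = ?k a * partial_F a b N f * ?D +
      (?k (b * of_nat (Suc N) * ?c (Suc N) + of_nat (Suc (Suc N)) * ?c (Suc (Suc N)))) * f ^ Suc N * ?D +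
      ?k (b * of_nat (Suc (Suc N)) * ?c (Suc (Suc N))) * f ^ Suc (Suc N) * ?D"
    unfolding series_const_add by (simp add: algebra_simps series_const_mult del: of_nat_Suc)
  also have "b * of_nat (Suc N) * ?c (Suc N) + of_nat (Suc (Suc N)) * ?c (Suc (Suc N)) = a * ?c (Suc N)"
    unfolding F_coeff_Suc by (simp add: algebra_simps)
  also have "?k a * partial_F a b N f * ?D + ?k (a * ?c (Suc N)) * f ^ Suc N * ?D =
      ?k a * partial_F a b (Suc N) f * ?D"
    by (simp add: partial_F_def series_const_mult algebra_simps)
  finally show ?case .
qed

lemma agree_number_op: "agree size n f g \<Longrightarrow> agree size n (number_op f) (number_op g)"
  by (simp add: agree_def)

lemma series_F_ode:
  fixes f :: "('a, 'k::field_char_0) series"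
  assumes "coef f {#} = 0"
  shows "(1 + series_const b * f) * number_op (series_F a b f) = series_const a * series_F a b f * number_op f"
proof (rule series_eqI)
  fix F :: "'a multiset"
  define N where "N = size F"
  note ag = agree_mult[where \<mu> = size] agree_number_op
  have 1: "agree size (Suc N) (series_F a b f) (partial_F a b M f)" if "M \<ge> N" for M
    using that assms by (auto simp: agree_def coef_partial_F)
  have "agree size (Suc N) ((1 + series_const b * f) * number_op (series_F a b f))
      ((1 + series_const b * f) * number_op (partial_F a b (Suc N) f))"
    by (intro ag 1) auto
  moreover have "agree size (Suc N) (series_const a * series_F a b f * number_op f)
      (series_const a * partial_F a b N f * number_op f)"
    by (intro ag 1) auto
  \<comment> \<open>The power \<open>f ^ Suc N\<close> contains no forest with at most
    \<open>N\<close> trees, so the error term drops out in the sizes under consideration.\<close>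
  moreover have "agree size (Suc N) (series_const (b * of_nat (Suc N) * F_coeff a b (Suc N)) * f ^ Suc N * number_op f)
     (series_const (b * of_nat (Suc N) * F_coeff a b (Suc N)) * 0 * number_op f)"
    by (intro ag) (auto simp: agree_def coef_power_eq_0 assms simp del: power_Suc)
  ultimately show "coef ((1 + series_const b * f) * number_op (series_F a b f)) F =
      coef (series_const a * series_F a b f * number_op f) F"
    unfolding partial_F_ode by (simp add: agree_def N_def del: power_Suc)
qed

text \<open>At a nonempty forest with \<open>n\<close> trees the equation expresses \<open>n\<close>
  times the coefficient of \<open>g\<close> through coefficients at smaller forests, which vanish by
  induction; in characteristic zero the factor \<open>n\<close> can be cancelled.\<close>

lemma ode_zero:
  fixes f :: "('a, 'k::field_char_0) series"
  assumes f: "coef f {#} = 0" and g: "coef g {#} = 0"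
    and ode: "(1 + series_const b * f) * number_op g = series_const a * g * number_op f"
  shows "g = 0"
proof (rule series_eqI)
  show "coef g F = coef 0 F" for F
  proof (induction "size F" arbitrary: F rule: less_induct)
    case less
    have sm: "coef g H = 0" if "G + H = F" "G \<noteq> {#}" for G H
      using less[of H] that by (auto simp: nonempty_has_size)
    have "coef (f * number_op g) F = 0"
      unfolding coef_mult using sm f by (auto intro!: sum.neutral) metis
    moreover have "coef (g * number_op f) F = 0"
    proof -
      have "coef g G * coef (number_op f) H = 0" if "G + H = F" for G H
        using sm[of H G] that by (cases "H = {#}") (auto simp: add.commute)
      then show ?thesis unfolding coef_mult by (auto intro!: sum.neutral)
    qed
    moreover have "coef (number_op g) F + b * coef (f * number_op g) F = a * coef (g * number_op f) F"
      using arg_cong[OF ode, of "\<lambda>s. coef s F"] by (simp add: distrib_right mult.assoc del: coef_number_op)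
    ultimately show ?case using g by (cases "F = {#}") auto
  qed
qed

lemma coef_series_F_empty [simp]:
  assumes "coef f {#} = 0"
  shows "coef (series_F a b f) {#} = 1"
  using assms by (simp add: coef_series_F[of f _ 0] F_coeff_def)

lemma series_F_unique:
  assumes f: "coef f {#} = 0" and g: "coef g {#} = 1"
    and ode: "(1 + series_const b * f) * number_op g = series_const a * g * number_op f"
  shows "g = series_F a b f"
proof -
  have "number_op (g - series_F a b f) = number_op g - number_op (series_F a b f)"
    by (rule series_eqI) (simp add: algebra_simps)
  then have "(1 + series_const b * f) * number_op (g - series_F a b f) =
      series_const a * (g - series_F a b f) * number_op f"
    using ode series_F_ode[OF f, of b a] by (simp add: right_diff_distrib left_diff_distrib)
  from ode_zero[OF f _ this] show ?thesis using f g by simp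
qed

section \<open>Functional equations of the series F, from the differential equation\<close>

lemma series_F_add:
  assumes "coef f {#} = 0"
  shows "series_F (a + a') b f = series_F a b f * series_F a' b f"
proof (rule series_F_unique[symmetric])
  let ?u = "1 + series_const b * f" and ?G = "series_F a b f" and ?H = "series_F a' b f"
  have "?u * number_op (?G * ?H) = (?u * number_op ?G) * ?H + ?G * (?u * number_op ?H)"
    by (simp add: number_op_mult algebra_simps)
  also have "\<dots> = series_const (a + a') * (?G * ?H) * number_op f"
    unfolding series_F_ode[OF assms] series_const_add by (simp add: algebra_simps)
  finally show "?u * number_op (?G * ?H) = series_const (a + a') * (?G * ?H) * number_op f" .
qed (use assms in \<open>simp_all add: coef_mult_empty\<close>)

lemma series_F_0: "coef f {#} = 0 \<Longrightarrow> series_F 0 b f = 1"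
  by (rule series_F_unique[symmetric]) simp_all

lemma series_F_self:
  assumes "coef f {#} = 0"
  shows "series_F b b f = 1 + series_const b * f"
  by (rule series_F_unique[symmetric])
    (use assms in \<open>simp_all add: coef_mult_empty number_op_add number_op_const_mult algebra_simps\<close>)

lemma series_F_formal_group:
  assumes x: "coef x {#} = 0" and y: "coef y {#} = 0"
  shows "series_F a b (x + (1 + series_const b * x) * y) = series_F a b x * series_F a b y"
proof (rule series_F_unique[symmetric])
  let ?G = "series_F a b x" and ?H = "series_F a b y"
    and ?u = "1 + series_const b * x" and ?v = "1 + series_const b * y"
  \<comment> \<open>The first factor equals \<open>?u * ?v\<close>.\<close>
  have "(1 + series_const b * (x + ?u * y)) * number_op (?G * ?H) =
      ?v * (?u * number_op ?G) * ?H + ?u * ?G * (?v * number_op ?H)"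
    by (simp add: number_op_mult algebra_simps)
  also have "\<dots> = series_const a * (?G * ?H) * number_op (x + ?u * y)"
    unfolding series_F_ode[OF x] series_F_ode[OF y]
    by (simp add: number_op_add number_op_mult number_op_const_mult algebra_simps)
  finally show "(1 + series_const b * (x + ?u * y)) * number_op (?G * ?H) =
     series_const a * (?G * ?H) * number_op (x + ?u * y)" .
qed (use assms in \<open>simp_all add: coef_mult_empty\<close>)

text \<open>An algebra morphism need not respect infinite sums. The hypothesis \<open>local\<close>
  is a continuity condition: each coefficient of the image depends only on the forests of bounded
  size, so \<open>series_F\<close> can be replaced by a truncation.\<close>

lemma series_F_hom:
  fixes \<phi> :: "('a, 'k::field_char_0) series \<Rightarrow> ('c, 'k) series"
  assumes add: "\<And>f g. \<phi> (f + g) = \<phi> f + \<phi> g" and mult: "\<And>f g. \<phi> (f * g) = \<phi> f * \<phi> g"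
    and const: "\<And>c. \<phi> (series_const c) = series_const c"
    and local: "\<And>M. \<exists>N. \<forall>f g. agree size N f g \<longrightarrow> coef (\<phi> f) M = coef (\<phi> g) M"
    and f: "coef f {#} = 0" "coef (\<phi> f) {#} = 0"
  shows "\<phi> (series_F a b f) = series_F a b (\<phi> f)"
proof (rule series_eqI)
  fix M
  have zero: "\<phi> 0 = 0" and one: "\<phi> 1 = 1" using const[of 0] const[of 1] by simp_all
  have power: "\<phi> (f ^ n) = \<phi> f ^ n" for n by (induction n) (simp_all add: one mult)
  have sum: "\<phi> (sum h S) = (\<Sum>i\<in>S. \<phi> (h i))" for h and S :: "nat set"
    by (induction S rule: infinite_finite_induct) (simp_all add: zero add)
  obtain N where N: "\<And>f g. agree size N f g \<Longrightarrow> coef (\<phi> f) M = coef (\<phi> g) M" using local by blast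
  have "agree size N (series_F a b f) (partial_F a b (N + size M) f)"
    by (auto simp: agree_def coef_partial_F f)
  then have "coef (\<phi> (series_F a b f)) M = coef (\<phi> (partial_F a b (N + size M) f)) M" by (rule N)
  also have "\<phi> (partial_F a b (N + size M) f) = partial_F a b (N + size M) (\<phi> f)"
    by (simp add: partial_F_def sum mult const power)
  also have "coef \<dots> M = coef (series_F a b (\<phi> f)) M"
    by (simp add: coef_partial_F f)
  finally show "coef (\<phi> (series_F a b f)) M = coef (series_F a b (\<phi> f)) M" .
qed

lemma coef_series_F_single:
  assumes "coef f {#} = 0"
  shows "coef (series_F a b f) {#t#} = a * coef f {#t#}"
  using assms by (simp add: coef_series_F[of f _ 1] F_coeff_def)

lemma splits_single: "{(G, H). G + H = {#t#}} = {({#}, {#t#}), ({#t#}, {#})}"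
  by (auto simp: union_is_single)

lemma coef_mult_single:
  "coef (f * g) {#t#} = coef f {#} * coef g {#t#} + coef f {#t#} * coef g {#}"
  by (simp add: coef_mult splits_single)

lemma coef_prod_single:
  assumes "\<And>i. i \<in> S \<Longrightarrow> coef (f i) {#} = 1"
  shows "coef (prod f S) {#t#} = (\<Sum>i\<in>S. coef (f i) {#t#})"
  using assms by (induction S rule: infinite_finite_induct) (simp_all add: coef_mult_single coef_prod_empty)


section \<open>Existence and uniqueness of the solution\<close>

text \<open>This extends \<open>dot\<close> to the degree zero, which occurs because a tensor factor
  of the coproduct may be the empty forest.\<close>

definition vdot :: "'k::comm_ring_1 ^ 'n \<Rightarrow> nat ^ 'n::finite \<Rightarrow> 'k" where
  "vdot a \<gamma> = scalar_product a (\<chi> i. of_nat (\<gamma> $ i))"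

lemma dot_eq_vdot: "dot a \<alpha> = vdot a (deg_vec \<alpha>)"
  by (simp add: dot_def vdot_def)

lemma vdot_add: "vdot a (\<gamma> + \<delta>) = vdot a \<gamma> + vdot a \<delta>"
  by (simp add: vdot_def scalar_product_def distrib_left sum.distrib)

lemma vdot_0 [simp]: "vdot a 0 = 0"
  by (simp add: vdot_def scalar_product_def)

lemma forest_degree_eq: "forest_degree F = (\<Sum>d\<in>#forest_decos F. deco_degree d)"
  unfolding forest_degree_def forest_decos_def by (induction F) simp_all

lemma forest_degree_simps [simp]:
  "forest_degree {#} = 0" "forest_degree (F + G) = forest_degree F + forest_degree G"
  "forest_degree {#Node d F#} = deco_degree d + forest_degree F"
  by (simp_all add: forest_degree_eq)

abbreviation nvert :: "'d forest \<Rightarrow> nat" where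
  "nvert F \<equiv> size (forest_decos F)"

lemma nvert_add: "nvert (F + G) = nvert F + nvert G"
  by simp

definition tree_sum :: "'m \<Rightarrow> (('m, 'n::finite) deco \<Rightarrow> (('m, 'n) deco rtree, 'k::comm_monoid_add) series) \<Rightarrow>
    (('m, 'n) deco rtree, 'k) series" where
  "tree_sum i f = series_sum (\<lambda>\<alpha>. series_graft (i, \<alpha>) (f (i, \<alpha>)))"

lemma coef_series_graft:
  "coef (series_graft d f) {#Node e F#} = (if d = e then coef f F else 0)"
  by (simp add: series_graft_def)

lemma coef_series_graft_0: "size G \<noteq> 1 \<Longrightarrow> coef (series_graft d f) G = 0"
proof -
  assume "size G \<noteq> 1"
  then have "{F. G = {#Node d F#}} = {}" by auto
  then show ?thesis by (simp add: series_graft_def)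
qed

lemma coef_tree_sum:
  "coef (tree_sum i f) {#Node d F#} = (if fst d = i then coef (f d) F else 0)"
proof -
  have "Sum_any (\<lambda>\<alpha>. coef (series_graft (i, \<alpha>) (f (i, \<alpha>))) {#Node d F#}) =
      Sum_any (\<lambda>\<alpha>. (if fst d = i then coef (f d) F else 0) when snd d = \<alpha>)"
    by (rule Sum_any.cong) (auto simp: coef_series_graft when_def prod_eq_iff)
  then show ?thesis by (simp add: tree_sum_def series_sum_def)
qed

lemma coef_tree_sum_0: "size G \<noteq> 1 \<Longrightarrow> coef (tree_sum i f) G = 0"
  by (simp add: tree_sum_def series_sum_def coef_series_graft_0)

lemma single_tree_cases:
  obtains "size F \<noteq> 1" | d K where "F = {#Node d K#}"
proof (cases "size F = 1")
  case True
  then obtain t where "F = {#t#}" by (metis size_1_singleton_mset)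
  then show thesis using that(2) by (cases t) auto
qed (use that(1) in auto)

locale dse =
  fixes k :: nat
    and I :: "nat \<Rightarrow> 'm::finite set"
    and A :: "nat \<Rightarrow> 'k::field_char_0 ^ 'n::finite"
    and b :: "nat \<Rightarrow> 'k"
    and b' :: "'m \<Rightarrow> nat \<Rightarrow> 'k"
  assumes disjoint: "disjoint_family_on I {0..k}" and cover: "(\<Union>p\<in>{0..k}. I p) = UNIV"
begin

lemma block_eqI: "p \<le> k \<Longrightarrow> i \<in> I p \<Longrightarrow> block k I i = p"
  unfolding block_def using disjoint_family_onD[OF disjoint] by (intro the_equality) fastforce+

lemma block: "block k I i \<le> k" "i \<in> I (block k I i)"
proof -
  obtain p where "p \<in> {0..k}" "i \<in> I p" using cover by blast
  then show "block k I i \<le> k" "i \<in> I (block k I i)" by (simp_all add: block_eqI)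
qed

text \<open>These exponents treat both kinds of equations uniformly: for an index in a block
  \<open>p \<ge> 1\<close> the only nontrivial factor is the one with exponent \<open>b p\<close>,
  that is, \<open>1 + b p Y\<close>. The same numbers enter the structure constants in
  \<open>deg1_coeff_eq\<close>.\<close>

definition expo :: "'m \<Rightarrow> nat \<Rightarrow> 'k" where
  "expo i q = (if block k I i = 0 then b' i q else if block k I i = q then b q else 0)"

lemma deg1_coeff_eq:
  "deg1_coeff k I A b b' j (i, \<alpha>) =
     (if block k I j = 0 then 0 else vdot (A (block k I j)) (deg_vec \<alpha>) + expo i (block k I j))"
  by (auto simp: deg1_coeff_def Let_def expo_def dot_eq_vdot)

definition block_sum :: "('m \<Rightarrow> (('m, 'n) deco rtree, 'k) series) \<Rightarrow> nat \<Rightarrow> (('m, 'n) deco rtree, 'k) series" where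
  "block_sum X q = (\<Sum>j\<in>I q. X j)"

definition degree_factor :: "('m \<Rightarrow> (('m, 'n) deco rtree, 'k) series) \<Rightarrow> nat ^ 'n \<Rightarrow> (('m, 'n) deco rtree, 'k) series" where
  "degree_factor X \<gamma> = (\<Prod>q = 1..k. series_F (vdot (A q) \<gamma>) (b q) (block_sum X q))"

definition index_factor :: "('m \<Rightarrow> (('m, 'n) deco rtree, 'k) series) \<Rightarrow> 'm \<Rightarrow> (('m, 'n) deco rtree, 'k) series" where
  "index_factor X i = (\<Prod>q = 1..k. series_F (expo i q) (b q) (block_sum X q))"

definition factor :: "('m \<Rightarrow> (('m, 'n) deco rtree, 'k) series) \<Rightarrow> ('m, 'n) deco \<Rightarrow> (('m, 'n) deco rtree, 'k) series" where
  "factor X d = degree_factor X (deco_degree d) * index_factor X (fst d)"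

lemma block_sum_empty: "(\<And>i. coef (X i) {#} = 0) \<Longrightarrow> coef (block_sum X q) {#} = 0"
  by (simp add: block_sum_def coef_sum)

lemma index_factor_block:
  assumes "p \<in> {1..k}" "i \<in> I p" "\<And>i. coef (X i) {#} = 0"
  shows "index_factor X i = 1 + series_const (b p) * block_sum X p"
proof -
  have "block k I i = p" using assms block_eqI by simp
  then have "index_factor X i = (\<Prod>q = 1..k. if q = p then 1 + series_const (b p) * block_sum X p else 1)"
    unfolding index_factor_def
    by (intro prod.cong refl) (use assms in \<open>auto simp: expo_def series_F_self series_F_0 block_sum_empty\<close>)
  then show ?thesis using assms by simp
qed

lemma tree_sum_factor_0:
  assumes "i \<in> I 0"
  shows "tree_sum i (factor X) = series_sum (\<lambda>\<alpha>. series_graft (i, \<alpha>)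
          ((\<Prod>q = 1..k. series_F (dot (A q) \<alpha>) (b q) (\<Sum>j\<in>I q. X j)) *
           (\<Prod>q = 1..k. series_F (b' i q) (b q) (\<Sum>j\<in>I q. X j))))"
  using block_eqI[OF _ assms]
  by (simp add: tree_sum_def factor_def degree_factor_def index_factor_def block_sum_def
      deco_degree_def dot_eq_vdot expo_def)

lemma tree_sum_factor:
  assumes "p \<in> {1..k}" "i \<in> I p" "\<And>i. coef (X i) {#} = 0"
  shows "tree_sum i (factor X) = series_sum (\<lambda>\<alpha>. series_graft (i, \<alpha>)
          ((\<Prod>q = 1..k. series_F (dot (A q) \<alpha>) (b q) (\<Sum>j\<in>I q. X j)) *
           (1 + series_const (b p) * (\<Sum>j\<in>I p. X j))))"
  using index_factor_block[OF assms]
  by (simp add: tree_sum_def factor_def degree_factor_def block_sum_def deco_degree_def dot_eq_vdot)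

lemma sdse_iff:
  "sdse k I A b b' X \<longleftrightarrow> (\<forall>i. X i = tree_sum i (factor X))"
proof
  assume sd: "sdse k I A b b' X"
  then have X0: "coef (X i) {#} = 0" for i unfolding sdse_def by blast
  show "\<forall>i. X i = tree_sum i (factor X)"
  proof
    fix i
    show "X i = tree_sum i (factor X)"
    proof (cases "block k I i = 0")
      case True
      then have "i \<in> I 0" using block(2)[of i] by simp
      then show ?thesis using sd unfolding sdse_def by (simp only: tree_sum_factor_0)
    next
      case False
      then have p: "block k I i \<in> {1..k}" using block(1)[of i] by simp
      show ?thesis unfolding tree_sum_factor[OF p block(2) X0]
        using sd p block(2)[of i] unfolding sdse_def by blast
    qed
  qed
next
  assume X: "\<forall>i. X i = tree_sum i (factor X)"
  \<comment> \<open>A sum of grafted series consists of trees only, so it has no constant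
    term.\<close>
  have X0: "coef (X i) {#} = 0" for i
    by (subst spec[OF X, of i]) (simp add: coef_tree_sum_0)
  show "sdse k I A b b' X"
    unfolding sdse_def
  proof (intro conjI ballI allI X0)
    fix p i assume p: "p \<in> {1..k}" "i \<in> I p"
    from spec[OF X, of i] show "X i = series_sum (\<lambda>\<alpha>. series_graft (i, \<alpha>)
          ((\<Prod>q = 1..k. series_F (dot (A q) \<alpha>) (b q) (\<Sum>j\<in>I q. X j)) *
           (1 + series_const (b p) * (\<Sum>j\<in>I p. X j))))"
      unfolding tree_sum_factor[OF p X0] .
  next
    fix i assume i: "i \<in> I 0"
    from spec[OF X, of i] show "X i = series_sum (\<lambda>\<alpha>. series_graft (i, \<alpha>)
          ((\<Prod>q = 1..k. series_F (dot (A q) \<alpha>) (b q) (\<Sum>j\<in>I q. X j)) *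
           (\<Prod>q = 1..k. series_F (b' i q) (b q) (\<Sum>j\<in>I q. X j))))"
      unfolding tree_sum_factor_0[OF i] .
  qed
qed

section \<open>The system as a fixed-point problem\<close>

definition step :: "('m \<Rightarrow> (('m, 'n) deco rtree, 'k) series) \<Rightarrow> ('m \<Rightarrow> (('m, 'n) deco rtree, 'k) series)" where
  "step X = (\<lambda>i. tree_sum i (factor X))"

text \<open>Grafting adds a root, so \<open>step\<close> is a contraction with respect to the number
  of vertices. This yields both existence and uniqueness.\<close>

lemma agree_step:
  assumes "\<And>i. agree nvert n (X i) (X' i)"
  shows "agree nvert (Suc n) (step X i) (step X' i)"
proof -
  have "agree nvert n (factor X d) (factor X' d)" for d
    unfolding factor_def degree_factor_def index_factor_def block_sum_def
    by (intro agree_mult agree_prod agree_series_F agree_sum nvert_add assms)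
  then have "coef (step X i) F = coef (step X' i) F" if "nvert F < Suc n" for F
    using that by (cases rule: single_tree_cases[of F])
      (auto simp: step_def coef_tree_sum coef_tree_sum_0 agree_def)
  then show ?thesis by (simp add: agree_def)
qed

lemma sdse_unique:
  assumes "sdse k I A b b' X" "sdse k I A b b' X'"
  shows "X = X'"
proof -
  have X: "step X = X" "step X' = X'" using assms by (auto simp: sdse_iff step_def)
  have "agree nvert n (X i) (X' i)" for n i
  proof (induction n arbitrary: i)
    case 0
    show ?case by (simp add: agree_def)
  next
    case (Suc n)
    then show ?case using agree_step[of n X X' i] by (simp add: X)
  qed
  then have "coef (X i) F = coef (X' i) F" for i F
    by (metis agree_def lessI)
  then show ?thesis by (intro ext series_eqI) auto
qed

lemma sdse_exists: "\<exists>X. sdse k I A b b' X"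
proof -
  define Z where "Z n = (step ^^ n) (\<lambda>_. 0)" for n
  have Z_Suc: "Z (Suc n) = step (Z n)" for n by (simp add: Z_def)
  have Z: "agree nvert n (Z n i) (Z (n + m) i)" for n m i
  proof (induction n arbitrary: i)
    case 0
    show ?case by (simp add: agree_def)
  next
    case (Suc n)
    then show ?case using agree_step[of n "Z n" "Z (n + m)" i] by (simp add: Z_Suc)
  qed
  \<comment> \<open>The coefficient at \<open>F\<close> is constant from the iterate
    \<open>Suc (nvert F)\<close> on.\<close>
  define X where "X i = Series (\<lambda>F. coef (Z (Suc (nvert F)) i) F)" for i
  have XZ: "agree nvert n (X i) (Z n i)" for n i
    unfolding agree_def
  proof (intro allI impI)
    fix F :: "('m, 'n) deco forest" assume "nvert F < n"
    then have "n = Suc (nvert F) + (n - Suc (nvert F))" by simp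
    with Z[of "Suc (nvert F)" i "n - Suc (nvert F)"]
    have "agree nvert (Suc (nvert F)) (Z (Suc (nvert F)) i) (Z n i)" by metis
    then show "coef (X i) F = coef (Z n i) F" by (simp add: X_def agree_def)
  qed
  have "agree nvert (Suc n) (X i) (step X i)" for n i
    by (rule agree_trans[OF XZ], unfold Z_Suc, rule agree_step, rule agree_sym, rule XZ)
  then have "coef (X i) F = coef (step X i) F" for i F
    by (metis agree_def lessI)
  then have "X i = step X i" for i by (intro series_eqI) auto
  then show ?thesis unfolding sdse_iff step_def by blast
qed

end


section \<open>The coproduct of the solution\<close>

text \<open>The completion of the tensor square of the Connes-Kreimer algebra is the algebra of series
  over the disjoint union of two copies of the set of trees.\<close>

definition mk_pair :: "'a multiset \<Rightarrow> 'b multiset \<Rightarrow> ('a + 'b) multiset" where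
  "mk_pair F G = image_mset Inl F + image_mset Inr G"

definition left_part :: "('a + 'b) multiset \<Rightarrow> 'a multiset" where
  "left_part M = (\<Sum>x\<in>#M. case x of Inl a \<Rightarrow> {#a#} | Inr _ \<Rightarrow> {#})"

definition right_part :: "('a + 'b) multiset \<Rightarrow> 'b multiset" where
  "right_part M = (\<Sum>x\<in>#M. case x of Inl _ \<Rightarrow> {#} | Inr a \<Rightarrow> {#a#})"

lemma parts_add [simp]:
  "left_part (M + N) = left_part M + left_part N" "right_part (M + N) = right_part M + right_part N"
  by (simp_all add: left_part_def right_part_def)

lemma parts_mk_pair [simp]: "left_part (mk_pair F G) = F" "right_part (mk_pair F G) = G"
  by (simp_all add: left_part_def right_part_def mk_pair_def image_mset.compositionality o_def)

lemma mk_pair_parts [simp]: "mk_pair (left_part M) (right_part M) = M"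
  by (induction M) (auto simp: left_part_def right_part_def mk_pair_def split: sum.splits)

lemma mk_pair_empty [simp]: "mk_pair {#} {#} = {#}"
  by (simp add: mk_pair_def)

lemma mk_pair_eq_empty_iff: "mk_pair F G = {#} \<longleftrightarrow> F = {#} \<and> G = {#}"
  by (simp add: mk_pair_def)

lemma parts_empty [simp]: "left_part {#} = {#}" "right_part {#} = {#}"
  by (simp_all add: left_part_def right_part_def)

lemma series_pair_eqI: "(\<And>F G. coef f (mk_pair F G) = coef g (mk_pair F G)) \<Longrightarrow> f = g"
  by (rule series_eqI) (metis mk_pair_parts)

lemma add_eq_mk_pair_iff:
  "M + N = mk_pair F G \<longleftrightarrow> left_part M + left_part N = F \<and> right_part M + right_part N = G"
  by (metis mk_pair_parts parts_add parts_mk_pair)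

lemma sum_splits_pair:
  "(\<Sum>(M, N) | M + N = mk_pair F G. h M N) =
   (\<Sum>(F1, F2) | F1 + F2 = F. \<Sum>(G1, G2) | G1 + G2 = G. h (mk_pair F1 G1) (mk_pair F2 G2))"
proof -
  have "(\<Sum>(M, N) | M + N = mk_pair F G. h M N) =
      (\<Sum>((F1, F2), (G1, G2))\<in>{(F1, F2). F1 + F2 = F} \<times> {(G1, G2). G1 + G2 = G}.
        h (mk_pair F1 G1) (mk_pair F2 G2))"
    by (rule sum.reindex_bij_witness[of _
          "\<lambda>((F1, F2), (G1, G2)). (mk_pair F1 G1, mk_pair F2 G2)"
          "\<lambda>(M, N). ((left_part M, left_part N), (right_part M, right_part N))"])
      (auto simp: add_eq_mk_pair_iff)
  then show ?thesis by (simp add: sum.cartesian_product case_prod_unfold)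
qed

lemma coef_mult_pair:
  "coef (f * g) (mk_pair F G) =
   (\<Sum>(F1, F2) | F1 + F2 = F. \<Sum>(G1, G2) | G1 + G2 = G. coef f (mk_pair F1 G1) * coef g (mk_pair F2 G2))"
  by (simp add: coef_mult sum_splits_pair)

text \<open>The embedding of \<open>f\<close> as \<open>f \<otimes> 1\<close>.\<close>

definition left_series :: "('a, 'k::comm_ring_1) series \<Rightarrow> ('a + 'b, 'k) series" where
  "left_series f = Series (\<lambda>M. if right_part M = {#} then coef f (left_part M) else 0)"

lemma coef_left_series [simp]:
  "coef (left_series f) (mk_pair F G) = (if G = {#} then coef f F else 0)"
  "coef (left_series f) {#} = coef f {#}"
  by (simp_all add: left_series_def)

lemma coef_left_series_mult:
  "coef (left_series f * g) (mk_pair F G) = (\<Sum>(F1, F2) | F1 + F2 = F. coef f F1 * coef g (mk_pair F2 G))"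
proof -
  have "(\<Sum>(G1, G2) | G1 + G2 = G. coef (left_series f) (mk_pair F1 G1) * coef g (mk_pair F2 G2)) =
      coef f F1 * coef g (mk_pair F2 G)" for F1 F2
  proof -
    have "(\<Sum>(G1, G2) | G1 + G2 = G. coef (left_series f) (mk_pair F1 G1) * coef g (mk_pair F2 G2)) =
        (\<Sum>p\<in>{(G1, G2). G1 + G2 = G}. if p = ({#}, G) then coef f F1 * coef g (mk_pair F2 G) else 0)"
      by (rule sum.cong) (auto split: if_splits)
    then show ?thesis by simp
  qed
  then show ?thesis by (simp add: coef_mult_pair)
qed

lemma left_series_add: "left_series (f + g) = left_series f + left_series g"
  by (rule series_pair_eqI) simp

lemma left_series_mult: "left_series (f * g) = left_series f * left_series g"
proof (rule series_pair_eqI)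
  fix F G
  show "coef (left_series (f * g)) (mk_pair F G) = coef (left_series f * left_series g) (mk_pair F G)"
    by (cases "G = {#}") (simp_all add: coef_left_series_mult coef_mult[of f g])
qed

lemma left_series_const: "left_series (series_const c) = series_const c"
  by (rule series_eqI) (metis (no_types, lifting) coef_left_series(1) coef_series_const mk_pair_empty mk_pair_parts parts_empty)

lemma left_series_F:
  fixes f :: "('a, 'c::field_char_0) series"
  shows "coef f {#} = 0 \<Longrightarrow> left_series (series_F a b f) = series_F a b (left_series f)"
proof (rule series_F_hom)
  fix M :: "('a + 'b) multiset"
  show "\<exists>N. \<forall>f g. agree size N f g \<longrightarrow> coef (left_series f) M = coef (left_series g :: (_, 'c) series) M"
    by (rule exI[of _ "Suc (size (left_part M))"]) (auto simp: agree_def left_series_def)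
qed (simp_all add: left_series_add left_series_mult left_series_const)

section \<open>Extension of the coproduct to formal series\<close>

lemma finite_submultisets: "finite {D'. D' \<subseteq># (D :: 'a multiset)}"
proof -
  have "{D'. D' \<subseteq># D} \<subseteq> fst ` {(G, H). G + H = D}"
    by (force simp: subset_mset.le_iff_add image_iff)
  then show ?thesis by (rule finite_surj[OF finite_splits])
qed

text \<open>Splitting off a tree with root decoration \<open>d\<close> distributes
  \<open>D - {#d#}\<close> over the forest below the root and the remaining trees, in finitely many
  ways.\<close>

lemma finite_forest_decos_eq: "finite {F. forest_decos F = (D :: 'd multiset)}"
proof (induction "size D" arbitrary: D rule: less_induct)
  case less
  let ?S = "\<Union>d\<in>set_mset D. \<Union>(D1, D2)\<in>{(D1, D2). D1 + D2 = D - {#d#}}.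
    (\<lambda>(K, G). add_mset (Node d K) G) ` ({K. forest_decos K = D1} \<times> {G. forest_decos G = D2})"
  have "{F. forest_decos F = D} \<subseteq> {{#}} \<union> ?S"
  proof
    fix F assume "F \<in> {F. forest_decos F = D}"
    then have F: "forest_decos F = D" by simp
    show "F \<in> {{#}} \<union> ?S"
    proof (cases F)
      case (add t G)
      obtain d K where t: "t = Node d K" by (cases t)
      have D: "D = add_mset d (forest_decos K + forest_decos G)"
        using F unfolding add t by (simp add: forest_decos_add_mset forest_decos_def)
      have "(forest_decos K, forest_decos G) \<in> {(D1, D2). D1 + D2 = D - {#d#}}" "d \<in># D"
        by (simp_all add: D)
      then show ?thesis unfolding add t by (intro UnI2 UN_I[of d] UN_I[of "(forest_decos K, forest_decos G)"]) auto
    qed simp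
  qed
  moreover have "finite ?S"
  proof (intro finite_UN_I finite_splits finite_set_mset, clarify)
    fix d D1 D2 assume *: "d \<in># D" "D1 + D2 = D - {#d#}"
    then have "size D1 + size D2 < size D"
      using size_Diff1_less[of d D] size_union[of D1 D2] by simp
    then show "finite ((\<lambda>(K, G). add_mset (Node d K) G) ` ({K. forest_decos K = D1} \<times> {G. forest_decos G = D2}))"
      using less by (intro finite_imageI finite_SigmaI) auto
  qed
  ultimately show ?case by (meson finite.simps finite_UnI finite_subset)
qed

lemma finite_forest_decos_subset: "finite {F. forest_decos F \<subseteq># D}"
proof -
  have "{F. forest_decos F \<subseteq># D} = (\<Union>D'\<in>{D'. D' \<subseteq># D}. {F. forest_decos F = D'})" by auto
  then show ?thesis using finite_submultisets[of D] finite_forest_decos_eq by (auto intro!: finite_UN_I)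
qed

text \<open>The continuous extension of the coproduct, with values in the completed tensor square.
  By \<open>cop_keys\<close> only the forests \<open>H\<close> listed here contribute to the
  coefficient, and they are finite in number.\<close>

definition series_coproduct :: "('d rtree, 'k::field) series \<Rightarrow> ('d rtree + 'd rtree, 'k) series" where
  "series_coproduct f = Series (\<lambda>M.
     \<Sum>H | forest_decos H = forest_decos (left_part M) + forest_decos (right_part M).
       coef f H * lookup (cop H) (left_part M, right_part M))"

lemma cop_lookup_eq_0:
  "forest_decos H \<noteq> forest_decos F + forest_decos G \<Longrightarrow> lookup (cop H) (F, G) = (0 :: 'k::field)"
  using cop_keys[of F G H] by (metis in_keys_iff)

lemma coef_series_coproduct:
  assumes "finite S" "{H. forest_decos H = forest_decos F + forest_decos G} \<subseteq> S"
  shows "coef (series_coproduct f) (mk_pair F G) = (\<Sum>H\<in>S. coef f H * lookup (cop H) (F, G))"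
  unfolding series_coproduct_def
  by (simp, rule sum.mono_neutral_left) (use assms in \<open>auto simp: cop_lookup_eq_0\<close>)

lemma finite_pair_splits: "finite {(u, v). u + v = (w :: 'a multiset \<times> 'b multiset)}"
proof -
  have "{(u, v). u + v = w} \<subseteq> (\<lambda>((a, b), (c, d)). ((a, c), (b, d))) `
      ({(G, H). G + H = fst w} \<times> {(G, H). G + H = snd w})"
  proof clarify
    fix a c :: "'a multiset" and e d :: "'b multiset"
    show "((a, e), (c, d)) \<in> (\<lambda>((a, b), (c, d)). ((a, c), (b, d))) `
      ({(G, H). G + H = fst ((a, e) + (c, d))} \<times> {(G, H). G + H = snd ((a, e) + (c, d))})"
      by (rule image_eqI[of _ _ "((a, c), (e, d))"]) auto
  qed
  then show ?thesis by (rule finite_subset) auto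
qed

lemma lookup_mult_pair:
  fixes x y :: "'a multiset \<times> 'b multiset \<Rightarrow>\<^sub>0 'k::field"
  shows "lookup (x * y) (F, G) =
    (\<Sum>(F1, F2) | F1 + F2 = F. \<Sum>(G1, G2) | G1 + G2 = G. lookup x (F1, G1) * lookup y (F2, G2))"
proof -
  have "lookup (x * y) (F, G) = (\<Sum>(u, v) | u + v = (F, G). lookup x u * lookup y v)"
    by (rule lookup_mult_splits[OF finite_pair_splits])
  also have "\<dots> = (\<Sum>((F1, F2), (G1, G2))\<in>{(F1, F2). F1 + F2 = F} \<times> {(G1, G2). G1 + G2 = G}.
        lookup x (F1, G1) * lookup y (F2, G2))"
    by (rule sum.reindex_bij_witness[of _ "\<lambda>((F1, F2), (G1, G2)). ((F1, G1), (F2, G2))"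
          "\<lambda>((F1, G1), (F2, G2)). ((F1, F2), (G1, G2))"]) auto
  finally show ?thesis by (simp add: sum.cartesian_product case_prod_unfold)
qed

text \<open>The coefficients are compared by exchanging sums. The finite set \<open>S\<close>
  contains every forest that contributes, and with a forest also its subforests.\<close>

lemma series_coproduct_mult: "series_coproduct (f * g) = series_coproduct f * series_coproduct g"
proof (rule series_pair_eqI)
  fix F G :: "'a forest"
  define D where "D = forest_decos F + forest_decos G"
  define S where "S = {H. forest_decos H \<subseteq># D}"
  have fin: "finite S" unfolding S_def by (rule finite_forest_decos_subset)
  let ?c = "\<lambda>H1 H2. coef f H1 * coef g H2 * lookup (cop (H1 + H2)) (F, G)"
  have "coef (series_coproduct (f * g)) (mk_pair F G) = (\<Sum>H\<in>S. coef (f * g) H * lookup (cop H) (F, G))"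
    by (rule coef_series_coproduct[OF fin]) (auto simp: S_def D_def)
  also have "\<dots> = (\<Sum>(H, p)\<in>(SIGMA H:S. {(H1, H2). H1 + H2 = H}). ?c (fst p) (snd p))"
    by (subst sum.Sigma[symmetric])
      (auto simp: fin finite_splits[unfolded case_prod_unfold] coef_mult sum_distrib_right case_prod_unfold intro!: sum.cong)
  also have "\<dots> = (\<Sum>p\<in>{p \<in> S \<times> S. fst p + snd p \<in> S}. ?c (fst p) (snd p))"
    by (rule sum.reindex_bij_witness[of _ "\<lambda>p. (fst p + snd p, p)" snd])
      (auto simp: S_def intro: subset_mset.order_trans[OF mset_subset_eq_add_left]
          subset_mset.order_trans[OF mset_subset_eq_add_right])
  also have "\<dots> = (\<Sum>p\<in>S \<times> S. ?c (fst p) (snd p))"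
  \<comment> \<open>If the union of the pair leaves \<open>S\<close>, its decorations are not those
    of \<open>F\<close> and \<open>G\<close> together, so its coproduct has coefficient zero
    there.\<close>
  proof (rule sum.mono_neutral_left)
    show "\<forall>p\<in>S \<times> S - {p \<in> S \<times> S. fst p + snd p \<in> S}. ?c (fst p) (snd p) = 0"
      by (auto simp: S_def D_def intro!: cop_lookup_eq_0)
  qed (use fin in auto)
  also have "\<dots> = (\<Sum>p\<in>S \<times> S. \<Sum>(F1, F2) | F1 + F2 = F. \<Sum>(G1, G2) | G1 + G2 = G.
      (coef f (fst p) * lookup (cop (fst p)) (F1, G1)) * (coef g (snd p) * lookup (cop (snd p)) (F2, G2)))"
    by (intro sum.cong refl) (simp add: cop_add lookup_mult_pair sum_distrib_left case_prod_unfold ac_simps)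
  also have "\<dots> = (\<Sum>(F1, F2) | F1 + F2 = F. \<Sum>(G1, G2) | G1 + G2 = G. \<Sum>p\<in>S \<times> S.
      (coef f (fst p) * lookup (cop (fst p)) (F1, G1)) * (coef g (snd p) * lookup (cop (snd p)) (F2, G2)))"
    by (subst sum.swap, intro sum.cong refl, simp add: case_prod_unfold, subst sum.swap, simp)
  also have "\<dots> = (\<Sum>(F1, F2) | F1 + F2 = F. \<Sum>(G1, G2) | G1 + G2 = G.
      (\<Sum>H\<in>S. coef f H * lookup (cop H) (F1, G1)) * (\<Sum>H\<in>S. coef g H * lookup (cop H) (F2, G2)))"
    by (intro sum.cong refl) (simp add: sum_product sum.cartesian_product case_prod_unfold)
  also have "\<dots> = coef (series_coproduct f * series_coproduct g) (mk_pair F G)"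
    unfolding coef_mult_pair
  proof (intro sum.cong refl, clarify, intro sum.cong refl, clarify)
    fix F1 F2 G1 G2 assume "F = F1 + F2" "G = G1 + G2"
    then show "(\<Sum>H\<in>S. coef f H * lookup (cop H) (F1, G1)) * (\<Sum>H\<in>S. coef g H * lookup (cop H) (F2, G2)) =
      coef (series_coproduct f) (mk_pair F1 G1) * coef (series_coproduct g) (mk_pair F2 G2)"
      by (subst (1 2) coef_series_coproduct[OF fin])
        (auto simp: S_def D_def intro: subset_mset.add_mono mset_subset_eq_add_left mset_subset_eq_add_right)
  qed
  finally show "coef (series_coproduct (f * g)) (mk_pair F G) =
      coef (series_coproduct f * series_coproduct g) (mk_pair F G)" .
qed

lemma series_coproduct_add: "series_coproduct (f + g) = series_coproduct f + series_coproduct g"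
  by (rule series_eqI) (simp add: series_coproduct_def distrib_right sum.distrib)

lemma series_coproduct_sum: "series_coproduct (sum f S) = (\<Sum>i\<in>S. series_coproduct (f i))"
  by (rule series_eqI) (simp add: series_coproduct_def coef_sum sum_distrib_right sum.swap[of _ S])

lemma series_coproduct_const: "series_coproduct (series_const c) = series_const c"
proof (rule series_pair_eqI)
  fix F G :: "'a forest"
  have fin: "finite (insert {#} {H. forest_decos H = forest_decos F + forest_decos G})"
    by (simp add: finite_forest_decos_eq)
  have "coef (series_coproduct (series_const c)) (mk_pair F G) =
      (\<Sum>H\<in>insert {#} {H. forest_decos H = forest_decos F + forest_decos G}. if H = {#} then c * lookup (cop {#}) (F, G) else 0)"
    by (subst coef_series_coproduct[OF fin]) (auto intro!: sum.cong)
  also have "\<dots> = c * lookup (cop {#}) (F, G)" using fin by simp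
  also have "\<dots> = coef (series_const c) (mk_pair F G)"
    by (auto simp: one_pair lookup_single when_def mk_pair_def)
  finally show "coef (series_coproduct (series_const c)) (mk_pair F G) = coef (series_const c) (mk_pair F G)" .
qed

lemma coef_series_coproduct_empty: "coef (series_coproduct f) {#} = coef f {#}"
  using coef_series_coproduct[of "{{#}}" "{#}" "{#}" f] by (simp add: one_pair)

lemma series_coproduct_F:
  fixes f :: "('a rtree, 'b::field_char_0) series"
  shows "coef f {#} = 0 \<Longrightarrow> series_coproduct (series_F a b f) = series_F a b (series_coproduct f)"
proof (rule series_F_hom)
  fix M :: "('a rtree + 'a rtree) multiset"
  show "\<exists>N. \<forall>f g. agree size N f g \<longrightarrow> coef (series_coproduct f) M = coef (series_coproduct g :: (_, 'b) series) M"
  proof (intro exI allI impI)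
    fix f g :: "('a rtree, 'b) series"
    assume ag: "agree size (Suc (size (forest_decos (left_part M) + forest_decos (right_part M)))) f g"
    \<comment> \<open>A forest has at least as many vertices as trees, so a bound on the vertices
      bounds the sizes on which the coefficient depends.\<close>
    have "coef f H = coef g H" if "forest_decos H = forest_decos (left_part M) + forest_decos (right_part M)" for H
      using ag size_le_forest_decos[of H] that by (simp add: agree_def)
    then show "coef (series_coproduct f) M = coef (series_coproduct g) M"
      by (simp add: series_coproduct_def)
  qed
qed (simp_all add: series_coproduct_add series_coproduct_mult series_coproduct_const coef_series_coproduct_empty)

lemma lookup_graft_right:
  "lookup (graft_right d x) (F, {#Node e K#}) = (if d = e then lookup x (F, K) else 0)"
proof -
  have "lookup (graft_right d x) (F, {#Node e K#}) = ev (\<lambda>p. if p = (F, K) then (if d = e then 1 else 0) else 0) x"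
    unfolding graft_right_def lookup_lin_ext by (rule ev_cong) (auto simp: lookup_single when_def split: if_splits)
  then show ?thesis by (simp add: ev_lookup_delta)
qed

lemma lookup_graft_right_0: "size G \<noteq> 1 \<Longrightarrow> lookup (graft_right d x) (F, G) = 0"
proof -
  assume "size G \<noteq> 1"
  then have "lookup (graft_right d x) (F, G) = ev (\<lambda>p. 0) x"
    unfolding graft_right_def lookup_lin_ext by (intro ev_cong) (auto simp: lookup_single when_def)
  then show ?thesis by simp
qed

lemma lookup_cop_right_empty: "lookup (cop H) (F, {#}) = (if H = F then 1 else (0 :: 'k::field))"
proof -
  have "ev (\<lambda>p. if p = (F, {#}) then 1 else 0) (cop H) =
      lookup (lin_ext (\<lambda>(G, H). if H = {#} then single G 1 else 0) (cop H)) F"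
    unfolding lookup_lin_ext by (rule ev_cong) (auto simp: lookup_single when_def split: if_splits)
  then show ?thesis by (simp add: counit_right ev_lookup_delta lookup_single when_def)
qed

lemma sum_hom:
  assumes "\<phi> 0 = 0" "\<And>f g. \<phi> (f + g) = \<phi> f + \<phi> g"
  shows "\<phi> (sum h S) = (\<Sum>i\<in>S. \<phi> (h i))"
  by (induction S rule: infinite_finite_induct) (simp_all add: assms)

lemma prod_hom:
  assumes "\<phi> 1 = 1" "\<And>f g. \<phi> (f * g) = \<phi> f * \<phi> g"
  shows "\<phi> (prod h S) = (\<Prod>i\<in>S. \<phi> (h i))"
  by (induction S rule: infinite_finite_induct) (simp_all add: assms)

section \<open>The factors of the solution and their twisted copies\<close>

type_synonym ('m, 'n, 'k) pair_series = "(('m, 'n) deco rtree + ('m, 'n) deco rtree, 'k) series"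

locale dse_solution = dse k I A b b'
  for k and I :: "nat \<Rightarrow> 'm::finite set" and A :: "nat \<Rightarrow> 'k::field_char_0 ^ 'n::finite" and b b' +
  fixes X :: "'m \<Rightarrow> (('m, 'n) deco rtree, 'k) series"
  assumes sol: "sdse k I A b b' X"
begin

lemma X_eq: "X i = tree_sum i (factor X)"
  using sol unfolding sdse_iff by blast

lemma coef_X_graft: "coef (X i) {#Node d K#} = (if fst d = i then coef (factor X d) K else 0)"
  by (subst X_eq) (rule coef_tree_sum)

lemma coef_X_0: "size F \<noteq> 1 \<Longrightarrow> coef (X i) F = 0"
  by (subst X_eq) (rule coef_tree_sum_0)

lemma coef_X_empty [simp]: "coef (X i) {#} = 0"
  by (rule coef_X_0) simp

lemma block_sum_X_empty [simp]: "coef (block_sum X q) {#} = 0"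
  by (rule block_sum_empty) simp

lemma degree_factor_add: "degree_factor X (\<gamma> + \<delta>) = degree_factor X \<gamma> * degree_factor X \<delta>"
  by (simp add: degree_factor_def vdot_add series_F_add prod.distrib)

lemma degree_factor_0 [simp]: "degree_factor X 0 = 1"
  by (simp add: degree_factor_def series_F_0)

lemma coef_factor_empty [simp]: "coef (factor X d) {#} = 1"
  by (simp add: factor_def coef_mult_empty degree_factor_def index_factor_def coef_prod_empty)

text \<open>The algebra morphism that maps an element \<open>x\<close> of degree \<open>\<gamma>\<close> to the tensor product of
  \<open>degree_factor X \<gamma>\<close> and \<open>x\<close>.\<close>

definition twist :: "(('m, 'n) deco rtree, 'k) series \<Rightarrow> ('m, 'n, 'k) pair_series" where
  "twist f = Series (\<lambda>M. coef (degree_factor X (forest_degree (right_part M))) (left_part M) * coef f (right_part M))"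

lemma coef_twist [simp]:
  "coef (twist f) (mk_pair F G) = coef (degree_factor X (forest_degree G)) F * coef f G"
  "coef (twist f) {#} = coef f {#}"
  by (simp_all add: twist_def)

lemma twist_add: "twist (f + g) = twist f + twist g"
  by (rule series_eqI) (simp add: twist_def distrib_left)

lemma twist_const: "twist (series_const c) = series_const c"
  by (rule series_pair_eqI) (auto simp: mk_pair_eq_empty_iff)

text \<open>Multiplicativity holds because \<open>degree_factor\<close> turns sums of degrees into
  products: \<open>vdot\<close> is additive in the degree and F is exponential in its first
  parameter.\<close>

lemma twist_mult: "twist (f * g) = twist f * twist g"
proof (rule series_pair_eqI)
  fix F G :: "('m, 'n) deco forest"
  let ?Q = "\<lambda>G. degree_factor X (forest_degree G)"
  have "coef (twist (f * g)) (mk_pair F G) =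
      (\<Sum>(G1, G2) | G1 + G2 = G. coef (?Q G) F * (coef f G1 * coef g G2))"
    by (simp add: coef_mult[of f g] sum_distrib_left case_prod_unfold)
  also have "\<dots> = (\<Sum>(G1, G2) | G1 + G2 = G. \<Sum>(F1, F2) | F1 + F2 = F.
      (coef (?Q G1) F1 * coef f G1) * (coef (?Q G2) F2 * coef g G2))"
  proof (rule sum.cong[OF refl], clarify)
    fix G1 G2 assume "G = G1 + G2"
    show "coef (?Q (G1 + G2)) F * (coef f G1 * coef g G2) = (\<Sum>(F1, F2) | F1 + F2 = F.
      (coef (?Q G1) F1 * coef f G1) * (coef (?Q G2) F2 * coef g G2))"
      by (simp add: degree_factor_add coef_mult sum_distrib_right sum_distrib_left case_prod_unfold ac_simps)
  qed
  also have "\<dots> = coef (twist f * twist g) (mk_pair F G)"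
    unfolding coef_mult_pair coef_twist case_prod_unfold by (rule sum.swap)
  finally show "coef (twist (f * g)) (mk_pair F G) = coef (twist f * twist g) (mk_pair F G)" .
qed

lemma twist_F:
  assumes "coef f {#} = 0"
  shows "twist (series_F a c f) = series_F a c (twist f)"
proof (rule series_F_hom)
  fix M :: "(('m, 'n) deco rtree + ('m, 'n) deco rtree) multiset"
  show "\<exists>N. \<forall>f g. agree size N f g \<longrightarrow> coef (twist f) M = coef (twist g) M"
    by (rule exI[of _ "Suc (size (right_part M))"]) (simp add: agree_def twist_def)
qed (simp_all add: twist_add twist_mult twist_const assms)

lemma coef_left_twist:
  "coef (left_series f * twist g) (mk_pair F G) =
   coef (f * degree_factor X (forest_degree G)) F * coef g G"
  by (simp add: coef_left_series_mult coef_mult[of f] sum_distrib_right case_prod_unfold mult.assoc)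

definition pair_nvert :: "(('m, 'n) deco rtree + ('m, 'n) deco rtree) multiset \<Rightarrow> nat" where
  "pair_nvert M = nvert (left_part M) + nvert (right_part M)"

lemma pair_nvert_add: "pair_nvert (M + N) = pair_nvert M + pair_nvert N"
  by (simp add: pair_nvert_def)

abbreviation expected_coproduct where
  "expected_coproduct i \<equiv> left_series (X i) + left_series (index_factor X i) * twist (X i)"

text \<open>The coproduct is pushed into the arguments of F. There the expected coproduct of a block
  sum has the form \<open>x + (1 + b x) y\<close>, so \<open>series_F_formal_group\<close> splits
  each F into a left and a twisted part.\<close>

lemma agree_coproduct_factor:
  assumes "\<And>i. agree pair_nvert n (series_coproduct (X i)) (expected_coproduct i)"
  shows "agree pair_nvert n (series_coproduct (factor X d)) (left_series (factor X d) * twist (factor X d))"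
proof -
  let ?W = "\<lambda>q. left_series (block_sum X q) +
    (1 + series_const (b q) * left_series (block_sum X q)) * twist (block_sum X q)"
  have one: "left_series 1 = (1 :: ('m, 'n, 'k) pair_series)"
    "series_coproduct 1 = (1 :: ('m, 'n, 'k) pair_series)" "twist 1 = 1"
    using left_series_const[of 1] series_coproduct_const[of 1] twist_const[of 1] by simp_all
  have zero: "left_series 0 = (0 :: ('m, 'n, 'k) pair_series)"
    "series_coproduct 0 = (0 :: ('m, 'n, 'k) pair_series)" "twist 0 = 0"
    using left_series_const[of 0] series_coproduct_const[of 0] twist_const[of 0] by simp_all
  have sums: "left_series (sum h S) = (\<Sum>i\<in>S. left_series (h i) :: ('m, 'n, 'k) pair_series)"
    "twist (sum h S) = (\<Sum>i\<in>S. twist (h i))" for h and S :: "'m set"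
    by (rule sum_hom; simp add: zero left_series_add twist_add)+
  have prods: "left_series (prod h S) = (\<Prod>i\<in>S. left_series (h i) :: ('m, 'n, 'k) pair_series)"
    "series_coproduct (prod h S) = (\<Prod>i\<in>S. series_coproduct (h i))"
    "twist (prod h S) = (\<Prod>i\<in>S. twist (h i))" for h and S :: "nat set"
    by (rule prod_hom; simp add: one left_series_mult series_coproduct_mult twist_mult)+
  have W: "agree pair_nvert n (series_coproduct (block_sum X q)) (?W q)" if q: "q \<in> {1..k}" for q
  proof -
    \<comment> \<open>All indices in the block \<open>I q\<close> share the same index factor, which
      can therefore be taken out of the sum.\<close>
    have "?W q = (\<Sum>j\<in>I q. expected_coproduct j)"
    proof -
      have "(left_series (index_factor X j) :: ('m, 'n, 'k) pair_series) = 1 + series_const (b q) * left_series (block_sum X q)"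
        if "j \<in> I q" for j
        using index_factor_block[OF q that, of X]
        by (simp add: left_series_add left_series_mult left_series_const one)
      then show ?thesis
        by (simp add: sum.distrib block_sum_def sums sum_distrib_left)
    qed
    then show ?thesis
      unfolding block_sum_def[of X q] series_coproduct_sum by (metis (no_types, lifting) agree_sum assms)
  qed
  have F: "agree pair_nvert n (\<Prod>q = 1..k. series_F (a q) (b q) (series_coproduct (block_sum X q)))
      (left_series (\<Prod>q = 1..k. series_F (a q) (b q) (block_sum X q)) *
       twist (\<Prod>q = 1..k. series_F (a q) (b q) (block_sum X q)))" for a
  proof -
    have "agree pair_nvert n (\<Prod>q = 1..k. series_F (a q) (b q) (series_coproduct (block_sum X q)))
        (\<Prod>q = 1..k. series_F (a q) (b q) (?W q))"
      by (intro agree_prod agree_series_F pair_nvert_add W)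
    then show ?thesis
      by (simp add: prods left_series_F twist_F series_F_formal_group prod.distrib)
  qed
  have "series_coproduct (factor X d) =
      (\<Prod>q = 1..k. series_F (vdot (A q) (deco_degree d)) (b q) (series_coproduct (block_sum X q))) *
      (\<Prod>q = 1..k. series_F (expo (fst d) q) (b q) (series_coproduct (block_sum X q)))"
    by (simp add: factor_def degree_factor_def index_factor_def series_coproduct_mult prods series_coproduct_F)
  moreover have "left_series (factor X d) * twist (factor X d) =
      (left_series (degree_factor X (deco_degree d)) * twist (degree_factor X (deco_degree d))) *
      (left_series (index_factor X (fst d)) * twist (index_factor X (fst d)))"
    by (simp add: factor_def left_series_mult twist_mult ac_simps)
  ultimately show ?thesis
    using agree_mult[where \<mu> = pair_nvert, OF pair_nvert_add F[of "\<lambda>q. vdot (A q) (deco_degree d)"]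
        F[of "\<lambda>q. expo (fst d) q"]]
    by (simp add: degree_factor_def index_factor_def)
qed

text \<open>The cocycle property of the grafting operators, read on coefficients. Since the solution
  consists of trees, a nonempty right factor must be a tree, and its root is the root that was
  grafted.\<close>

lemma coef_series_coproduct_X:
  "coef (series_coproduct (X i)) (mk_pair F {#}) = coef (X i) F"
  "coef (series_coproduct (X i)) (mk_pair F {#Node d K#}) =
     (if fst d = i then coef (series_coproduct (factor X d)) (mk_pair F K) else 0)"
  "G \<noteq> {#} \<Longrightarrow> size G \<noteq> 1 \<Longrightarrow> coef (series_coproduct (X i)) (mk_pair F G) = 0"
proof -
  show "coef (series_coproduct (X i)) (mk_pair F {#}) = coef (X i) F"
    by (simp add: coef_series_coproduct[OF _ subset_refl] lookup_cop_right_empty finite_forest_decos_eq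
        if_distrib[of "(*) _"] cong: if_cong)
next
  let ?N = "{H. forest_decos H = forest_decos F + forest_decos K}"
  let ?H = "{H. forest_decos H = forest_decos F + forest_decos {#Node d K#}}"
  have tree: "lookup (cop {#Node e L#}) (F, {#Node d K#}) = (if e = d then lookup (cop L) (F, K) else (0::'k))" for e L
    by (simp add: cop_graft lookup_add lookup_graft_right lookup_single)
  have "coef (series_coproduct (X i)) (mk_pair F {#Node d K#}) =
      (\<Sum>H\<in>?H. coef (X i) H * lookup (cop H) (F, {#Node d K#}))"
    by (rule coef_series_coproduct) (simp_all add: finite_forest_decos_eq)
  also have "\<dots> = (\<Sum>H\<in>(\<lambda>L. {#Node d L#}) ` ?N. coef (X i) H * lookup (cop H) (F, {#Node d K#}))"
  proof (rule sum.mono_neutral_right)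
    show "\<forall>H\<in>?H - (\<lambda>L. {#Node d L#}) ` ?N. coef (X i) H * lookup (cop H) (F, {#Node d K#}) = 0"
    proof
      fix H assume H: "H \<in> ?H - (\<lambda>L. {#Node d L#}) ` ?N"
      show "coef (X i) H * lookup (cop H) (F, {#Node d K#}) = 0"
      proof (cases rule: single_tree_cases[of H])
        case (2 e L)
        then show ?thesis using H by (cases "e = d") (auto simp: tree)
      qed (simp add: coef_X_0)
    qed
  qed (auto simp: finite_forest_decos_eq)
  also have "\<dots> = (\<Sum>L\<in>?N. coef (X i) {#Node d L#} * lookup (cop L) (F, K))"
    by (subst sum.reindex) (auto simp: inj_on_def tree)
  also have "\<dots> = (if fst d = i then coef (series_coproduct (factor X d)) (mk_pair F K) else 0)"
    by (auto simp: coef_X_graft coef_series_coproduct[OF _ subset_refl] finite_forest_decos_eq)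
  finally show "coef (series_coproduct (X i)) (mk_pair F {#Node d K#}) =
     (if fst d = i then coef (series_coproduct (factor X d)) (mk_pair F K) else 0)" .
next
  assume G: "G \<noteq> {#}" "size G \<noteq> 1"
  have "coef (X i) H * lookup (cop H) (F, G) = 0" for H
  proof (cases rule: single_tree_cases[of H])
    case (2 e L)
    then show ?thesis using G by (auto simp: cop_graft lookup_add lookup_graft_right_0 lookup_single when_def)
  qed (simp add: coef_X_0)
  then show "coef (series_coproduct (X i)) (mk_pair F G) = 0"
    by (subst coef_series_coproduct[OF _ subset_refl])
      (simp_all add: finite_forest_decos_eq sum.neutral del: mult_eq_0_iff)
qed

lemma coef_expected_coproduct:
  "coef (expected_coproduct i) (mk_pair F G) =
    (if G = {#} then coef (X i) F else 0) +
    coef (index_factor X i * degree_factor X (forest_degree G)) F * coef (X i) G"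
  by (simp add: coef_left_twist)

text \<open>Induction on the number of vertices of both tensor factors. Removing the root of the
  right factor lowers this number and leads from \<open>X i\<close> to \<open>factor X d\<close>,
  where \<open>agree_coproduct_factor\<close> applies.\<close>

theorem series_coproduct_X: "series_coproduct (X i) = expected_coproduct i"
proof -
  have "agree pair_nvert n (series_coproduct (X i)) (expected_coproduct i)" for n i
  proof (induction n arbitrary: i)
    case 0
    show ?case by (simp add: agree_def)
  next
    case (Suc n)
    have *: "coef (series_coproduct (X i)) (mk_pair F G) = coef (expected_coproduct i) (mk_pair F G)"
      if "nvert F + nvert G < Suc n" for F G
    proof (cases rule: single_tree_cases[of G])
      case 1
      then show ?thesis
        by (cases "G = {#}") (simp_all add: coef_series_coproduct_X coef_left_twist coef_X_0)
    next
      case (2 d K)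
      then have "coef (series_coproduct (factor X d)) (mk_pair F K) =
          coef (left_series (factor X d) * twist (factor X d)) (mk_pair F K)"
        using agree_coproduct_factor[OF Suc, of d] that by (simp add: agree_def pair_nvert_def)
      \<comment> \<open>The degree of the removed root is the one in \<open>factor X d\<close>; it
        combines with the degree of \<open>K\<close> to that of the whole tree.\<close>
      moreover have "factor X d * degree_factor X (forest_degree K) =
          index_factor X (fst d) * degree_factor X (forest_degree {#Node d K#})"
        by (simp add: factor_def degree_factor_add ac_simps)
      ultimately show ?thesis
        by (simp add: 2 coef_series_coproduct_X coef_left_twist coef_X_graft del: forest_degree_simps)
    qed
    then show ?case
      unfolding agree_def
    proof (intro allI impI)
      fix M :: "(('m, 'n) deco rtree + ('m, 'n) deco rtree) multiset"
      assume "pair_nvert M < Suc n"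
      then show "coef (series_coproduct (X i)) M = coef (expected_coproduct i) M"
        using *[of "left_part M" "right_part M"] by (simp add: pair_nvert_def)
    qed
  qed
  then have "agree pair_nvert (Suc (pair_nvert M)) (series_coproduct (X i)) (expected_coproduct i)" for M .
  then have "coef (series_coproduct (X i)) M = coef (expected_coproduct i) M" for M
    by (auto simp: agree_def)
  then show ?thesis by (rule series_eqI)
qed

end


section \<open>Graded subalgebras of the Connes-Kreimer algebra\<close>

lemma lookup_component: "lookup (component deg \<gamma> x) a = (if deg a = \<gamma> then lookup x a else 0)"
proof -
  have "lookup (component deg \<gamma> x) a =
      (\<Sum>c | c \<in> keys x \<and> deg c = \<gamma>. if c = a then lookup x a else 0)"
    by (auto simp: component_def lookup_sum lookup_single when_def intro!: sum.cong)
  then show ?thesis by (auto simp: in_keys_iff)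
qed

lemma component_add: "component deg \<gamma> (x + y) = component deg \<gamma> x + component deg \<gamma> y"
  by (rule poly_mapping_eqI) (simp add: lookup_component lookup_add)

lemma component_smul: "component deg \<gamma> (smul c x) = smul c (component deg \<gamma> x)"
  by (rule poly_mapping_eqI) (simp add: lookup_component)

lemma component_homogeneous:
  "homogeneous deg \<delta> x \<Longrightarrow> component deg \<gamma> x = (if \<delta> = \<gamma> then x else 0)"
  by (rule poly_mapping_eqI) (auto simp: lookup_component homogeneous_def in_keys_iff)

lemma homogeneous_mult:
  assumes "homogeneous forest_degree \<gamma> x" "homogeneous forest_degree \<delta> y"
  shows "homogeneous forest_degree (\<gamma> + \<delta>) (x * y :: _ \<Rightarrow>\<^sub>0 'k::field)"
proof -
  have "forest_degree a = \<gamma> + \<delta>" if "a \<in> keys (x * y)" for a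
    using that keys_mult[of x y] assms by (fastforce simp: homogeneous_def)
  then show ?thesis by (simp add: homogeneous_def)
qed

lemma lookup_series_component:
  fixes f :: "(('m::finite, 'n::finite) deco rtree, 'k::comm_monoid_add) series"
  shows "lookup (series_component \<gamma> f) F = (if forest_degree F = \<gamma> then coef f F else 0)"
proof -
  have "lookup (series_component \<gamma> f) F =
      (\<Sum>G | forest_degree G = \<gamma>. if G = F then coef f F else 0)"
    by (auto simp: series_component_def lookup_sum lookup_single when_def intro!: sum.cong)
  then show ?thesis by (simp add: finite_forest_degree)
qed

lemma homogeneous_series_component:
  "homogeneous forest_degree \<gamma> (series_component \<gamma> f)"
  for f :: "(('m::finite, 'n::finite) deco rtree, 'k::comm_monoid_add) series"
  by (auto simp: homogeneous_def in_keys_iff lookup_series_component split: if_splits)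

text \<open>Passage from the completed coproduct back to the algebraic one: as the coproduct is
  homogeneous, taking a component selects the pairs of the corresponding total degree.\<close>

lemma lookup_coproduct_series_component:
  fixes f :: "(('m::finite, 'n::finite) deco rtree, 'k::field) series"
  shows "lookup (coproduct (series_component \<gamma> f)) (F, G) =
    (if forest_degree F + forest_degree G = \<gamma> then coef (series_coproduct f) (mk_pair F G) else 0)"
proof -
  define S where "S = {H. forest_degree H = \<gamma>} \<union> {H. forest_decos H = forest_decos F + forest_decos G}"
  have fin: "finite S" by (simp add: S_def finite_forest_degree finite_forest_decos_eq)
  have "lookup (coproduct (series_component \<gamma> f)) (F, G) =
      (\<Sum>H\<in>S. (if forest_degree H = \<gamma> then coef f H else 0) * lookup (cop H) (F, G))"
    unfolding coproduct_eq lookup_lin_ext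
    by (subst ev_superset[OF fin])
      (auto simp: S_def in_keys_iff lookup_series_component split: if_splits)
  also have "\<dots> = (\<Sum>H\<in>S. if forest_degree F + forest_degree G = \<gamma> then coef f H * lookup (cop H) (F, G) else 0)"
  proof (rule sum.cong[OF refl])
    fix H
    have "forest_degree H = forest_degree F + forest_degree G" if "lookup (cop H) (F, G) \<noteq> (0::'k)"
    proof -
      have "(F, G) \<in> keys (cop H :: _ \<Rightarrow>\<^sub>0 'k)" using that by (simp add: in_keys_iff)
      from cop_keys[OF this, symmetric] show ?thesis by (simp add: forest_degree_eq)
    qed
    then show "(if forest_degree H = \<gamma> then coef f H else 0) * lookup (cop H) (F, G) =
        (if forest_degree F + forest_degree G = \<gamma> then coef f H * lookup (cop H) (F, G) else 0)"
      by auto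
  qed
  also have "\<dots> = (if forest_degree F + forest_degree G = \<gamma> then coef (series_coproduct f) (mk_pair F G) else 0)"
    by (subst coef_series_coproduct[OF fin]) (auto simp: S_def)
  finally show ?thesis .
qed

lemma finite_vec_splits: "finite {(\<alpha>, \<beta>). \<alpha> + \<beta> = (\<gamma> :: nat ^ 'n::finite)}"
proof -
  let ?S = "vec_lambda ` (\<Pi>\<^sub>E i\<in>UNIV. {..\<gamma> $ i})"
  have mem: "\<alpha> \<in> ?S" if "\<And>i. \<alpha> $ i \<le> \<gamma> $ i" for \<alpha>
    by (rule image_eqI[of _ _ "vec_nth \<alpha>"]) (use that in auto)
  have "{(\<alpha>, \<beta>). \<alpha> + \<beta> = \<gamma>} \<subseteq> ?S \<times> ?S"
  proof
    fix p assume "p \<in> {(\<alpha>, \<beta>). \<alpha> + \<beta> = \<gamma>}"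
    then have "\<gamma> $ i = fst p $ i + snd p $ i" for i by auto
    then have "fst p \<in> ?S" "snd p \<in> ?S" by (intro mem; simp)+
    then show "p \<in> ?S \<times> ?S" by (simp add: mem_Times_iff)
  qed
  moreover have "finite ?S" by (intro finite_imageI finite_PiE) auto
  ultimately show ?thesis by (meson finite_SigmaI finite_subset)
qed

lemma series_component_mult:
  fixes f g :: "(('m::finite, 'n::finite) deco rtree, 'k::field) series"
  shows "series_component \<gamma> (f * g) =
    (\<Sum>(\<alpha>, \<beta>) | \<alpha> + \<beta> = \<gamma>. series_component \<alpha> f * series_component \<beta> g)"
proof (rule poly_mapping_eqI)
  fix F :: "('m, 'n) deco forest"
  let ?P = "{(\<alpha>, \<beta>). \<alpha> + \<beta> = \<gamma>}"
  have "lookup (\<Sum>(\<alpha>, \<beta>)\<in>?P. series_component \<alpha> f * series_component \<beta> g) F =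
      (\<Sum>p\<in>?P. \<Sum>(G, H) | G + H = F. if p = (forest_degree G, forest_degree H) then coef f G * coef g H else 0)"
    by (auto simp: lookup_sum case_prod_unfold lookup_mult_splits[OF finite_splits, unfolded case_prod_unfold]
        lookup_series_component intro!: sum.cong)
  also have "\<dots> = (\<Sum>(G, H) | G + H = F. \<Sum>p\<in>?P. if p = (forest_degree G, forest_degree H) then coef f G * coef g H else 0)"
    unfolding case_prod_unfold by (rule sum.swap)
  also have "\<dots> = (\<Sum>(G, H) | G + H = F. if forest_degree F = \<gamma> then coef f G * coef g H else 0)"
    by (intro sum.cong refl) (auto simp: finite_vec_splits)
  also have "\<dots> = lookup (series_component \<gamma> (f * g)) F"
    by (auto simp: lookup_series_component coef_mult)
  finally show "lookup (series_component \<gamma> (f * g)) F =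
    lookup (\<Sum>(\<alpha>, \<beta>)\<in>?P. series_component \<alpha> f * series_component \<beta> g) F" by simp
qed

lemma lin_ext_tens: "lin_ext h (tens x y) = lin_ext (\<lambda>a. lin_ext (\<lambda>b. h (a, b)) y) x"
  by (simp add: tens_eq_lin_ext lin_ext_lin_ext)

section \<open>Closure properties of subalgebras and of series with components in them\<close>

lemma is_subalgebraD:
  assumes "is_subalgebra V"
  shows "1 \<in> V" "0 \<in> V" "x \<in> V \<Longrightarrow> y \<in> V \<Longrightarrow> x + y \<in> V" "x \<in> V \<Longrightarrow> smul c x \<in> V"
    "x \<in> V \<Longrightarrow> y \<in> V \<Longrightarrow> x * y \<in> V" "x \<in> V \<Longrightarrow> - x \<in> V"
    "(\<And>i. i \<in> S \<Longrightarrow> h i \<in> V) \<Longrightarrow> sum h S \<in> V"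
proof -
  show *: "1 \<in> V" "x \<in> V \<Longrightarrow> y \<in> V \<Longrightarrow> x + y \<in> V" "x \<in> V \<Longrightarrow> smul c x \<in> V"
    "x \<in> V \<Longrightarrow> y \<in> V \<Longrightarrow> x * y \<in> V" for x y c
    using assms by (auto simp: is_subalgebra_def)
  show "0 \<in> V" using *(3)[OF *(1), of 0] by simp
  then show "(\<And>i. i \<in> S \<Longrightarrow> h i \<in> V) \<Longrightarrow> sum h S \<in> V"
    by (induction S rule: infinite_finite_induct) (auto intro: *)
  show "x \<in> V \<Longrightarrow> - x \<in> V" using *(3)[of x "- 1"] by (simp add: smul_minus_one)
qed

lemma subalgebra_prod_mset:
  assumes "is_subalgebra (V :: ('a::comm_monoid_add \<Rightarrow>\<^sub>0 'k::field) set)" "\<And>i. i \<in># M \<Longrightarrow> h i \<in> V"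
  shows "\<Prod>\<^sub># (image_mset h M) \<in> V"
  using assms(2) by (induction M) (auto intro: is_subalgebraD[OF assms(1)])

lemma subalgebra_lin_ext:
  assumes "is_subalgebra V" "\<And>a. a \<in> keys x \<Longrightarrow> h a \<in> V"
  shows "lin_ext h x \<in> V"
  unfolding lin_ext_def by (intro is_subalgebraD[OF assms(1)] assms(2))

text \<open>This plays the role of the completion of \<open>V\<close>. It is closed under the
  operations from which the right-hand sides of the system are built.\<close>

definition components_in :: "(('m, 'n::finite) deco, 'k::field) ck set \<Rightarrow> (('m, 'n) deco rtree, 'k) series set" where
  "components_in V = {f. \<forall>\<gamma>. series_component \<gamma> f \<in> V}"

context
  fixes V :: "(('m::finite, 'n::finite) deco, 'k::field_char_0) ck set"
  assumes V: "is_subalgebra V"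
begin

lemma components_in_add: "f \<in> components_in V \<Longrightarrow> g \<in> components_in V \<Longrightarrow> f + g \<in> components_in V"
proof -
  have "series_component \<gamma> (f + g) = series_component \<gamma> f + series_component \<gamma> g" for \<gamma>
    by (rule poly_mapping_eqI) (simp add: lookup_series_component lookup_add)
  then show "f \<in> components_in V \<Longrightarrow> g \<in> components_in V \<Longrightarrow> f + g \<in> components_in V"
    by (simp add: components_in_def is_subalgebraD[OF V])
qed

lemma components_in_mult: "f \<in> components_in V \<Longrightarrow> g \<in> components_in V \<Longrightarrow> f * g \<in> components_in V"
  by (auto simp: components_in_def series_component_mult intro!: is_subalgebraD[OF V])

lemma components_in_const: "series_const c \<in> components_in V"
proof -
  have "series_component \<gamma> (series_const c :: (('m, 'n) deco rtree, 'k) series) =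
      (if \<gamma> = 0 then smul c 1 else 0)" for \<gamma>
    by (rule poly_mapping_eqI) (auto simp: lookup_series_component lookup_one when_def)
  then show ?thesis by (simp add: components_in_def is_subalgebraD[OF V])
qed

lemma components_in_sum: "(\<And>i. i \<in> S \<Longrightarrow> h i \<in> components_in V) \<Longrightarrow> sum h S \<in> components_in V"
  using components_in_const[of 0]
  by (induction S rule: infinite_finite_induct) (auto intro: components_in_add)

lemma components_in_prod: "(\<And>i. i \<in> S \<Longrightarrow> h i \<in> components_in V) \<Longrightarrow> prod h S \<in> components_in V"
  using components_in_const[of 1]
  by (induction S rule: infinite_finite_induct) (auto intro: components_in_mult)

lemma components_in_F:
  assumes "f \<in> components_in V" "coef f {#} = 0"
  shows "series_F a b f \<in> components_in V"
  unfolding components_in_def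
proof (intro CollectI allI)
  fix \<gamma> :: "nat ^ 'n"
  \<comment> \<open>Only finitely many forests have degree \<gamma>, so one truncation of F has the
    right component in this degree.\<close>
  let ?N = "Max (size ` {F :: ('m, 'n) deco forest. forest_degree F = \<gamma>})"
  have "size F \<le> ?N" if "forest_degree F = \<gamma>" for F :: "('m, 'n) deco forest"
    using that by (intro Max_ge) (auto simp: finite_forest_degree)
  then have "series_component \<gamma> (series_F a b f) = series_component \<gamma> (partial_F a b ?N f)"
    by (intro poly_mapping_eqI) (simp add: lookup_series_component coef_partial_F assms)
  moreover have "f ^ n \<in> components_in V" for n
    using components_in_const[of 1] by (induction n) (auto intro: components_in_mult assms)
  then have "partial_F a b ?N f \<in> components_in V"
    unfolding partial_F_def by (intro components_in_sum components_in_mult components_in_const)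
  ultimately show "series_component \<gamma> (series_F a b f) \<in> V" by (simp add: components_in_def)
qed

end


section \<open>The subalgebra generated by the solution\<close>

definition total_degree :: "nat ^ 'n::finite \<Rightarrow> nat" where
  "total_degree \<gamma> = (\<Sum>i\<in>UNIV. \<gamma> $ i)"

lemma total_degree_add: "total_degree (\<gamma> + \<delta>) = total_degree \<gamma> + total_degree \<delta>"
  by (simp add: total_degree_def sum.distrib)

lemma total_degree_eq_0 [simp]: "total_degree \<gamma> = 0 \<longleftrightarrow> \<gamma> = 0"
  by (simp add: total_degree_def vec_eq_iff)

lemma total_degree_pos [simp]: "0 < total_degree \<gamma> \<longleftrightarrow> \<gamma> \<noteq> 0"
  using total_degree_eq_0[of \<gamma>] by linarith

lemma total_degree_0 [simp]: "total_degree 0 = 0"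
  by simp

lemma deco_degree_nonzero [simp]: "deco_degree d \<noteq> 0"
  using deg_vec[of "snd d"] by (simp add: deco_degree_def)

lemma deco_degree_eq_iff: "fst d = fst e \<Longrightarrow> deco_degree d = deco_degree e \<longleftrightarrow> d = e"
  by (simp add: deco_degree_def deg_vec_inject prod_eq_iff)

definition mset_degree :: "('m, 'n::finite) deco multiset \<Rightarrow> nat ^ 'n" where
  "mset_degree M = (\<Sum>d\<in>#M. deco_degree d)"

lemma mset_degree_simps [simp]:
  "mset_degree {#} = 0" "mset_degree (M + N) = mset_degree M + mset_degree N"
  "mset_degree (add_mset d M) = deco_degree d + mset_degree M"
  by (simp_all add: mset_degree_def)

lemma total_degree_deco_le_mset_degree: "d \<in># M \<Longrightarrow> total_degree (deco_degree d) \<le> total_degree (mset_degree M)"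
  by (auto simp: total_degree_add dest!: multi_member_split)

context dse_solution
begin

definition gen :: "('m, 'n) deco \<Rightarrow> (('m, 'n) deco, 'k) ck" where
  "gen d = series_component (deco_degree d) (X (fst d))"

definition mon :: "('m, 'n) deco multiset \<Rightarrow> (('m, 'n) deco, 'k) ck" where
  "mon M = \<Prod>\<^sub># (image_mset gen M)"

text \<open>The source is the polynomial algebra with one variable for each decoration, the
  multisets being its monomials. The variables are replaced by the components of the solution, and
  the image is the whole subalgebra by \<open>V_eq\<close>.\<close>

definition incl :: "(('m, 'n) deco multiset \<Rightarrow>\<^sub>0 'k) \<Rightarrow> (('m, 'n) deco, 'k) ck" where
  "incl = lin_ext mon"

abbreviation V where
  "V \<equiv> sdse_subalgebra X"

lemma mon_simps [simp]:
  "mon {#} = 1" "mon (M + N) = mon M * mon N" "mon (add_mset d M) = gen d * mon M"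
  by (simp_all add: mon_def)

lemma incl_mult: "incl (p * q) = incl p * incl q"
  unfolding incl_def by (rule lin_ext_mult) simp

lemma series_component_X:
  "series_component \<gamma> (X i) = (if \<gamma> = 0 then 0 else gen (i, Posdeg \<gamma>))"
proof -
  have "coef (X i) F = 0" if "forest_degree F = 0" for F
  proof (cases rule: single_tree_cases[of F])
    case (2 d K)
    then have "total_degree (deco_degree d) = 0" using that total_degree_add[of "deco_degree d" "forest_degree K"] by simp
    then show ?thesis by simp
  qed (rule coef_X_0)
  then have "series_component 0 (X i) = 0"
    by (intro poly_mapping_eqI) (simp add: lookup_series_component)
  then show ?thesis by (simp add: gen_def deco_degree_def Posdeg_inverse)
qed

lemma is_subalgebra_range_incl: "is_subalgebra (range incl)"
  unfolding is_subalgebra_def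
proof (intro conjI ballI allI)
  show "1 \<in> range incl"
    by (rule range_eqI[of _ _ 1]) (simp add: incl_def flip: single_one)
next
  fix x y c assume "x \<in> range incl" "y \<in> range incl"
  then obtain p q where pq: "x = incl p" "y = incl q" by blast
  show "x + y \<in> range incl"
    by (rule range_eqI[of _ _ "p + q"]) (simp add: pq incl_def lin_ext_add)
  show "x * y \<in> range incl"
    by (rule range_eqI[of _ _ "p * q"]) (simp add: pq incl_mult)
next
  fix x c assume "x \<in> range incl"
  then obtain p where p: "x = incl p" by blast
  show "smul c x \<in> range incl"
    by (rule range_eqI[of _ _ "smul c p"]) (simp add: p incl_def lin_ext_smul)
qed

lemma is_subalgebra_V: "is_subalgebra V"
  unfolding sdse_subalgebra_def
  by (rule hull_in) (auto simp: is_subalgebra_def)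

lemma series_component_X_in_V: "series_component \<gamma> (X i) \<in> V"
  unfolding sdse_subalgebra_def by (rule hull_inc) blast

lemma gen_in_V: "gen d \<in> V"
  unfolding gen_def by (rule series_component_X_in_V)

lemma mon_in_V: "mon M \<in> V"
  unfolding mon_def by (intro subalgebra_prod_mset is_subalgebra_V gen_in_V)

lemma V_eq: "V = range incl"
proof
  have "gen d = incl (single {#d#} 1)" for d by (simp add: incl_def)
  moreover have "0 = incl 0" by (simp add: incl_def)
  ultimately have "{series_component \<alpha> (X i) |i \<alpha>. True} \<subseteq> range incl"
    by (auto simp: series_component_X)
  then show "V \<subseteq> range incl"
    unfolding sdse_subalgebra_def by (rule hull_minimal) (rule is_subalgebra_range_incl)
  show "range incl \<subseteq> V"
    unfolding incl_def by (auto intro!: subalgebra_lin_ext is_subalgebra_V mon_in_V)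
qed

lemma lookup_gen: "lookup (gen d) F = (if forest_degree F = deco_degree d then coef (X (fst d)) F else 0)"
  by (simp add: gen_def lookup_series_component)

lemma lookup_gen_leaf: "lookup (gen d) {#Node e {#}#} = (if d = e then 1 else 0)"
  using deco_degree_eq_iff[of d e] by (auto simp: lookup_gen coef_X_graft)

lemma homogeneous_mon: "homogeneous forest_degree (mset_degree M) (mon M)"
proof (induction M)
  case empty
  show ?case by (simp add: homogeneous_def flip: single_one)
next
  case (add d M)
  then show ?case by (simp add: homogeneous_mult gen_def homogeneous_series_component)
qed

lemma component_incl: "component forest_degree \<gamma> (incl p) = incl (component mset_degree \<gamma> p)"
proof (induction p rule: free_induct)
  case (single M c)
  have "homogeneous mset_degree (mset_degree M) (single M c)" by (simp add: homogeneous_def)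
  then show ?case
    by (simp add: incl_def component_smul component_homogeneous[OF homogeneous_mon] component_homogeneous)
qed (simp add: incl_def lin_ext_add component_add)

lemma graded_V: "graded_subspace forest_degree V"
  by (auto simp: graded_subspace_def V_eq component_incl)

lemma X_in_components_in: "X i \<in> components_in V"
  by (simp add: components_in_def series_component_X_in_V)

lemma factors_in_components_in:
  "index_factor X i * degree_factor X \<gamma> \<in> components_in V"
  unfolding index_factor_def degree_factor_def block_sum_def[of X]
  by (intro components_in_mult components_in_prod components_in_F components_in_sum X_in_components_in is_subalgebra_V)
    (simp_all add: coef_sum)

section \<open>Stability under the coproduct and the antipode\<close>

lemma lookup_coproduct_gen:
  "lookup (coproduct (gen d)) (F, G) =
    (if forest_degree F + forest_degree G = deco_degree d then
      (if G = {#} then coef (X (fst d)) F else 0) +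
      coef (index_factor X (fst d) * degree_factor X (forest_degree G)) F * coef (X (fst d)) G
     else 0)"
  unfolding gen_def lookup_coproduct_series_component series_coproduct_X coef_expected_coproduct ..

lemma coproduct_gen:
  "coproduct (gen d) = tens (gen d) 1 +
    (\<Sum>(\<alpha>, \<beta>) | \<alpha> + \<beta> = deco_degree d.
      tens (series_component \<alpha> (index_factor X (fst d) * degree_factor X \<beta>)) (series_component \<beta> (X (fst d))))"
proof (rule poly_mapping_eqI, clarify)
  fix F G :: "('m, 'n) deco forest"
  let ?P = "{(\<alpha>, \<beta>). \<alpha> + \<beta> = deco_degree d}"
  let ?c = "coef (index_factor X (fst d) * degree_factor X (forest_degree G)) F * coef (X (fst d)) G"
  have "(\<Sum>(\<alpha>, \<beta>)\<in>?P. lookup (tens (series_component \<alpha> (index_factor X (fst d) * degree_factor X \<beta>))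
      (series_component \<beta> (X (fst d)))) (F, G)) =
      (\<Sum>p\<in>?P. if p = (forest_degree F, forest_degree G) then ?c else 0)"
    by (intro sum.cong refl) (auto simp: lookup_tens lookup_series_component split: if_splits)
  also have "\<dots> = (if forest_degree F + forest_degree G = deco_degree d then ?c else 0)"
    by (simp add: finite_vec_splits)
  finally show "lookup (coproduct (gen d)) (F, G) = lookup (tens (gen d) 1 +
    (\<Sum>(\<alpha>, \<beta>)\<in>?P. tens (series_component \<alpha> (index_factor X (fst d) * degree_factor X \<beta>))
      (series_component \<beta> (X (fst d))))) (F, G)"
    by (auto simp: lookup_coproduct_gen lookup_add lookup_sum lookup_tens lookup_gen case_prod_unfold
        lookup_one when_def)
qed

text \<open>The image of \<open>V \<otimes> V\<close>, written with lists of pure tensors as in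
  \<open>tensor_form\<close>; this form also gives an induction over the number of pure
  tensors.\<close>

definition V_tensors :: "(('m, 'n) deco forest \<times> ('m, 'n) deco forest \<Rightarrow>\<^sub>0 'k) set" where
  "V_tensors = {(\<Sum>(y, z)\<leftarrow>ps. tens y z) |ps. set ps \<subseteq> V \<times> V}"

lemma V_tensors_add: "x \<in> V_tensors \<Longrightarrow> y \<in> V_tensors \<Longrightarrow> x + y \<in> V_tensors"
proof -
  assume "x \<in> V_tensors" "y \<in> V_tensors"
  then obtain ps qs where "x = (\<Sum>(y, z)\<leftarrow>ps. tens y z)" "set ps \<subseteq> V \<times> V"
    "y = (\<Sum>(y, z)\<leftarrow>qs. tens y z)" "set qs \<subseteq> V \<times> V" by (auto simp: V_tensors_def)
  then have "x + y = (\<Sum>(y, z)\<leftarrow>ps @ qs. tens y z)" "set (ps @ qs) \<subseteq> V \<times> V" by auto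
  then show ?thesis unfolding V_tensors_def by blast
qed

lemma V_tensors_0: "0 \<in> V_tensors"
proof -
  have "0 = (\<Sum>(y, z)\<leftarrow>[]. tens y z)" "set [] \<subseteq> V \<times> V" by auto
  then show ?thesis unfolding V_tensors_def by blast
qed

lemma V_tensors_tens: "y \<in> V \<Longrightarrow> z \<in> V \<Longrightarrow> tens y z \<in> V_tensors"
proof -
  assume "y \<in> V" "z \<in> V"
  then have "tens y z = (\<Sum>(y, z)\<leftarrow>[(y, z)]. tens y z)" "set [(y, z)] \<subseteq> V \<times> V" by auto
  then show ?thesis unfolding V_tensors_def by blast
qed

lemma V_tensors_induct [consumes 1, case_names zero add]:
  assumes "x \<in> V_tensors" and "P 0"
    and "\<And>y z x. y \<in> V \<Longrightarrow> z \<in> V \<Longrightarrow> x \<in> V_tensors \<Longrightarrow> P x \<Longrightarrow> P (tens y z + x)"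
  shows "P x"
proof -
  obtain ps where "x = (\<Sum>(y, z)\<leftarrow>ps. tens y z)" "set ps \<subseteq> V \<times> V"
    using assms(1) by (auto simp: V_tensors_def)
  then show ?thesis
  proof (induction ps arbitrary: x)
    case (Cons p ps)
    then have "(\<Sum>(y, z)\<leftarrow>ps. tens y z) \<in> V_tensors" unfolding V_tensors_def by auto
    with Cons show ?case by (cases p) (auto intro!: assms(3))
  qed (simp add: assms(2))
qed

lemma V_tensors_smul: "x \<in> V_tensors \<Longrightarrow> smul c x \<in> V_tensors"
  by (induction rule: V_tensors_induct)
    (auto simp: V_tensors_0 smul_add tens_smul[symmetric] intro!: V_tensors_add V_tensors_tens is_subalgebraD[OF is_subalgebra_V])

lemma V_tensors_mult: "x \<in> V_tensors \<Longrightarrow> y \<in> V_tensors \<Longrightarrow> x * y \<in> V_tensors"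
proof (induction rule: V_tensors_induct)
  case (add u v x)
  from add.prems add.hyps(1,2) have "tens u v * y \<in> V_tensors"
    by (induction rule: V_tensors_induct)
      (auto simp: V_tensors_0 distrib_left tens_mult intro!: V_tensors_add V_tensors_tens is_subalgebraD[OF is_subalgebra_V])
  with add show ?case by (simp add: distrib_right V_tensors_add)
qed (simp add: V_tensors_0)

lemma V_tensors_sum: "(\<And>i. i \<in> S \<Longrightarrow> h i \<in> V_tensors) \<Longrightarrow> sum h S \<in> V_tensors"
  by (induction S rule: infinite_finite_induct) (auto intro: V_tensors_0 V_tensors_add)

lemma coproduct_V: "x \<in> V \<Longrightarrow> coproduct x \<in> V_tensors"
proof -
  have one: "coproduct 1 = (tens 1 1 :: (('m, 'n) deco forest \<times> ('m, 'n) deco forest \<Rightarrow>\<^sub>0 'k))"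
    by (simp add: tens_single one_pair flip: single_one)
  have gen: "coproduct (gen d) \<in> V_tensors" for d
    unfolding coproduct_gen using factors_in_components_in
    by (auto simp: components_in_def intro!: V_tensors_add V_tensors_sum V_tensors_tens gen_in_V
        is_subalgebraD[OF is_subalgebra_V] series_component_X_in_V)
  have mon: "coproduct (mon M) \<in> V_tensors" for M
    by (induction M) (auto simp: coproduct_mult one intro!: V_tensors_mult gen V_tensors_tens is_subalgebraD[OF is_subalgebra_V])
  assume "x \<in> V"
  then obtain p where "x = incl p" by (auto simp: V_eq)
  then have "coproduct x = lin_ext (\<lambda>M. coproduct (mon M)) p"
    by (simp add: incl_def coproduct_eq lin_ext_lin_ext)
  then show ?thesis
    unfolding lin_ext_def by (auto intro!: V_tensors_sum V_tensors_smul mon)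
qed

lemma V_tensors_subset_span: "V_tensors \<subseteq> module.span smul {tens y z |y z. y \<in> V \<and> z \<in> V}"
proof
  interpret vs: vector_space "smul :: 'k \<Rightarrow> (('m, 'n) deco forest \<times> ('m, 'n) deco forest \<Rightarrow>\<^sub>0 'k) \<Rightarrow> _"
    by (rule vector_space_smul)
  fix x assume "x \<in> V_tensors"
  then show "x \<in> module.span smul {tens y z |y z. y \<in> V \<and> z \<in> V}"
  proof (induction rule: V_tensors_induct)
    case (add y z x)
    have "tens y z \<in> vs.span {tens y z |y z. y \<in> V \<and> z \<in> V}"
      by (rule vs.span_base) (use add in blast)
    then show ?case using add.IH by (rule vs.span_add)
  qed (rule vs.span_zero)
qed

text \<open>The left antipode axiom, applied to \<open>coproduct_gen\<close>, expresses the antipode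
  of a generator through antipodes of elements of \<open>V\<close> of smaller degree. These are
  polynomials in generators of smaller degree, so induction applies.\<close>

lemma antipode_gen: "antipode (gen d) \<in> V"
proof (induction "total_degree (deco_degree d)" arbitrary: d rule: less_induct)
  case less
  have IH: "antipode y \<in> V" if "y \<in> V" "homogeneous forest_degree \<gamma> y" "total_degree \<gamma> < total_degree (deco_degree d)" for y \<gamma>
  proof -
    obtain p where p: "y = incl p" using \<open>y \<in> V\<close> by (auto simp: V_eq)
    \<comment> \<open>The polynomial \<open>p\<close> might contain monomials of larger degree whose
      images cancel. Its part of degree \<gamma> has the same image and only involves generators
      within reach of the induction.\<close>
    define p' where "p' = component mset_degree \<gamma> p"
    have y: "y = incl p'"
      using component_homogeneous[OF that(2), of \<gamma>] by (simp add: p'_def p component_incl)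
    have "antipode (mon M) \<in> V" if "M \<in> keys p'" for M
    proof -
      have "mset_degree M = \<gamma>" using that by (auto simp: p'_def in_keys_iff lookup_component split: if_splits)
      then have "antipode (gen e) \<in> V" if "e \<in># M" for e
        using total_degree_deco_le_mset_degree[OF that] less[of e] \<open>total_degree \<gamma> < _\<close> by simp
      moreover have "antipode (mon M) = \<Prod>\<^sub># (image_mset (\<lambda>e. antipode (gen e)) M)"
        by (induction M) (simp_all add: antipode_mult, simp add: antipode_def flip: single_one)
      ultimately show ?thesis by (simp add: subalgebra_prod_mset is_subalgebra_V)
    qed
    moreover have "antipode y = lin_ext (\<lambda>M. antipode (mon M)) p'"
      by (simp add: y incl_def antipode_def lin_ext_lin_ext)
    ultimately show ?thesis by (simp add: subalgebra_lin_ext is_subalgebra_V)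
  qed
  let ?conv = "lin_ext (\<lambda>(F, G). antipode (single F 1) * single G (1::'k))"
  have conv_tens: "?conv (tens x y) = antipode x * y" for x y
  proof -
    have "antipode x = lin_ext (\<lambda>F. antipode (single F 1)) x" by (simp add: antipode_def)
    then show ?thesis by (simp add: lin_ext_tens lin_ext_mult_left lin_ext_mult_right)
  qed
  let ?P = "{(\<alpha>, \<beta>). \<alpha> + \<beta> = deco_degree d}"
  let ?x = "\<lambda>\<alpha> \<beta>. series_component \<alpha> (index_factor X (fst d) * degree_factor X \<beta>)"
    and ?y = "\<lambda>\<beta>. series_component \<beta> (X (fst d))"
  have "counit (gen d) = 0"
    by (simp add: counit_def lookup_gen)
  then have "0 = ?conv (coproduct (gen d))"
    using is_antipode_antipode[where ?'k = 'k and ?'d = "('m, 'n) deco"] by (simp add: is_antipode_def)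
  also have "\<dots> = antipode (gen d) + (\<Sum>(\<alpha>, \<beta>)\<in>?P. antipode (?x \<alpha> \<beta>) * ?y \<beta>)"
    unfolding coproduct_gen by (simp add: lin_ext_add lin_ext_sum case_prod_unfold conv_tens[unfolded case_prod_unfold])
  finally have eq: "antipode (gen d) = - (\<Sum>(\<alpha>, \<beta>)\<in>?P. antipode (?x \<alpha> \<beta>) * ?y \<beta>)"
    by (simp add: eq_neg_iff_add_eq_0)
  \<comment> \<open>For \<beta> = 0 the left factor would have full degree, but then the right
    factor is zero because the solution has no component of degree zero.\<close>
  have "antipode (?x \<alpha> \<beta>) * ?y \<beta> \<in> V" if "\<alpha> + \<beta> = deco_degree d" for \<alpha> \<beta>
  proof (cases "\<beta> = 0")
    case True
    then show ?thesis by (simp add: series_component_X is_subalgebraD[OF is_subalgebra_V])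
  next
    case False
    then have "total_degree \<alpha> < total_degree (deco_degree d)"
      using total_degree_add[of \<alpha> \<beta>] by (simp add: that)
    then have "antipode (?x \<alpha> \<beta>) \<in> V"
      using IH[OF _ homogeneous_series_component] factors_in_components_in
      by (auto simp: components_in_def)
    then show ?thesis using series_component_X_in_V by (simp add: is_subalgebraD[OF is_subalgebra_V])
  qed
  then show ?case
    unfolding eq by (intro is_subalgebraD(6,7)[OF is_subalgebra_V]) auto
qed

theorem hopf_subalgebra_V: "hopf_subalgebra V"
  unfolding hopf_subalgebra_def
proof (intro conjI ballI exI[of _ antipode])
  fix x assume "x \<in> V"
  then show "coproduct x \<in> module.span smul {tens y z |y z. y \<in> V \<and> z \<in> V}"
    using coproduct_V V_tensors_subset_span by blast
next
  have mon: "antipode (mon M) = \<Prod>\<^sub># (image_mset (\<lambda>e. antipode (gen e)) M)" for M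
    by (induction M) (simp_all add: antipode_mult, simp add: antipode_def flip: single_one)
  have "antipode (incl p) = lin_ext (\<lambda>M. antipode (mon M)) p" for p
    by (simp add: incl_def antipode_def lin_ext_lin_ext)
  then have "antipode (incl p) \<in> V" for p
    by (simp add: mon subalgebra_lin_ext is_subalgebra_V subalgebra_prod_mset antipode_gen)
  then show "antipode ` V \<subseteq> V" by (auto simp: V_eq)
qed (rule is_subalgebra_V is_antipode_antipode)+

end


section \<open>Linear forms on the Connes-Kreimer algebra\<close>

text \<open>The convolution product, that is, the transpose of the coproduct, on forms given by
  their values on forests.\<close>

definition conv :: "('d forest \<Rightarrow> 'k::field) \<Rightarrow> ('d forest \<Rightarrow> 'k) \<Rightarrow> 'd forest \<Rightarrow> 'k" where
  "conv f g F = ev (\<lambda>(G, H). f G * g H) (cop F)"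

definition unit_form :: "'d forest \<Rightarrow> 'k::field" where
  "unit_form F = (if F = {#} then 1 else 0)"

definition leaf_form :: "'d \<Rightarrow> 'd forest \<Rightarrow> 'k::field" where
  "leaf_form d F = (if F = {#Node d {#}#} then 1 else 0)"

primrec word_form :: "'d list \<Rightarrow> 'd forest \<Rightarrow> 'k::field" where
  "word_form [] = unit_form"
| "word_form (d # w) = conv (leaf_form d) (word_form w)"

lemma conv_assoc: "conv (conv f g) h = conv f (conv g h)"
proof
  fix F
  show "conv (conv f g) h F = conv f (conv g h) F"
    using coassoc_ev[of "\<lambda>a b c. f a * (g b * h c)" F]
    by (simp add: conv_def ev_pointwise_mult[symmetric] case_prod_unfold mult.assoc)
qed

lemma conv_unit_form: "conv unit_form f = f"
proof
  fix F
  have "conv unit_form f F = ev f (lin_ext (\<lambda>(G, H). if G = {#} then single H 1 else 0) (cop F))"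
    unfolding conv_def ev_lin_ext by (rule ev_cong) (auto simp: unit_form_def)
  then show "conv unit_form f F = f F" by (simp add: counit_left)
qed

lemma word_form_append: "word_form (v @ w) = conv (word_form v) (word_form w)"
  by (induction v) (simp_all add: conv_unit_form conv_assoc)

text \<open>Each letter of the word takes one vertex with this decoration, since the coproduct
  distributes the decorations. This makes the pairing of words and forests homogeneous.\<close>

lemma word_form_decos: "word_form w F \<noteq> (0 :: 'k::field) \<Longrightarrow> forest_decos F = mset w"
proof (induction w arbitrary: F)
  case Nil
  then show ?case by (simp add: unit_form_def split: if_splits)
next
  case (Cons d w)
  have "\<exists>G H. (G, H) \<in> keys (cop F :: _ \<Rightarrow>\<^sub>0 'k) \<and> leaf_form d G * word_form w H \<noteq> (0 :: 'k)"
  proof (rule ccontr)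
    assume "\<not> ?thesis"
    then have "conv (leaf_form d) (word_form w) F = ev (\<lambda>_. 0 :: 'k) (cop F)"
      unfolding conv_def by (intro ev_cong) auto
    with Cons.prems show False by simp
  qed
  then obtain G H where GH: "(G, H) \<in> keys (cop F :: _ \<Rightarrow>\<^sub>0 'k)" "leaf_form d G \<noteq> (0 :: 'k)" "word_form w H \<noteq> (0 :: 'k)"
    by auto
  then have "G = {#Node d {#}#}" by (simp add: leaf_form_def split: if_splits)
  then show ?case using cop_keys[OF GH(1)] Cons.IH[OF GH(3)] by simp
qed

text \<open>The algebra morphism from the tensor algebra to the convolution algebra that sends each
  letter to its leaf form. Restriction to the subalgebra comes later.\<close>

definition dual_form :: "('d mword \<Rightarrow>\<^sub>0 'k::field) \<Rightarrow> 'd forest \<Rightarrow> 'k" where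
  "dual_form t F = ev (\<lambda>w. word_form (letters w) F) t"

lemma ev_dual_form: "ev (dual_form t) x = ev (\<lambda>w. ev (word_form (letters w)) x) t"
  unfolding dual_form_def[abs_def] by (rule ev_swap)

lemma letters_add [simp]: "letters (v + w) = letters v @ letters w"
  and letters_zero [simp]: "letters 0 = []"
  and letters_letter [simp]: "letters (letter d) = [d]"
  by (simp_all add: plus_mword_def zero_mword_def letter_def)

lemma dual_form_mult: "dual_form (s * t) = conv (dual_form s) (dual_form t)"
proof
  fix F
  have "dual_form (s * t) F = ev (\<lambda>v. ev (\<lambda>w. ev (\<lambda>(G, H). word_form (letters v) G * word_form (letters w) H) (cop F)) t) s"
    by (simp add: dual_form_def ev_mult_bilinear word_form_append conv_def)
  also have "\<dots> = ev (\<lambda>v. ev (\<lambda>(G, H). word_form (letters v) G * dual_form t H) (cop F)) s"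
    by (simp add: ev_swap[of _ "cop F"] dual_form_def ev_pointwise_mult case_prod_unfold)
  also have "\<dots> = conv (dual_form s) (dual_form t) F"
    by (simp add: ev_swap[of _ "cop F"] conv_def dual_form_def[of s] ev_pointwise_mult case_prod_unfold)
  finally show "dual_form (s * t) F = conv (dual_form s) (dual_form t) F" .
qed

lemma ev_conv: "ev (conv f g) x = ev (\<lambda>(G, H). f G * g H) (coproduct x)"
  by (simp add: conv_def[abs_def] coproduct_eq ev_lin_ext)

section \<open>Contraction of the coproduct with a leaf\<close>

definition leaf_deriv :: "'d \<Rightarrow> ('d, 'k::field) ck \<Rightarrow> ('d, 'k) ck" where
  "leaf_deriv d x = lin_ext (\<lambda>(G, H). if G = {#Node d {#}#} then single H 1 else 0) (coproduct x)"

lemma leaf_deriv_add: "leaf_deriv d (x + y) = leaf_deriv d x + leaf_deriv d y"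
  by (simp add: leaf_deriv_def coproduct_eq lin_ext_add)

text \<open>A union of two forests is a single leaf only if one of them is empty and the other is
  the leaf; the empty one is absorbed by the counit axiom.\<close>

lemma leaf_deriv_mult: "leaf_deriv d (x * y) = leaf_deriv d x * y + x * leaf_deriv d y"
proof -
  let ?D = "\<lambda>(G, H). if G = {#Node d {#}#} then single H 1 else 0"
  let ?E = "\<lambda>(G, H). if G = {#} then single H 1 else 0"
  have E: "lin_ext ?E (coproduct x) = x" for x
    by (simp add: coproduct_eq lin_ext_lin_ext counit_left)
  have "lin_ext ?D (coproduct x * coproduct y) =
      lin_ext ?D (coproduct x) * lin_ext ?E (coproduct y) + lin_ext ?E (coproduct x) * lin_ext ?D (coproduct y)"
    by (rule lin_ext_derivation) (auto simp: union_is_single mult_single)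
  then show ?thesis by (simp add: leaf_deriv_def coproduct_mult E)
qed

lemma leaf_deriv_one: "leaf_deriv d 1 = 0"
  using leaf_deriv_mult[of d 1 1] by simp

lemma lookup_leaf_deriv: "lookup (leaf_deriv d x) H = lookup (coproduct x) ({#Node d {#}#}, H)"
proof -
  have "lookup (leaf_deriv d x) H = ev (\<lambda>p. if p = ({#Node d {#}#}, H) then 1 else 0) (coproduct x)"
    unfolding leaf_deriv_def lookup_lin_ext by (rule ev_cong) (auto simp: lookup_single when_def split: if_splits)
  then show ?thesis by (simp add: ev_lookup_delta)
qed

lemma ev_word_form_Nil: "ev (word_form []) x = lookup x {#}"
  using ev_lookup_delta[of "{#}" 1 x] by (simp add: unit_form_def[abs_def])

text \<open>With \<open>ev_word_form_Nil\<close>, pairing with a word means applying the derivations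
  of its letters one after the other and then the counit.\<close>

lemma ev_word_form_Cons: "ev (word_form (d # w)) x = ev (word_form w) (leaf_deriv d x)"
  unfolding word_form.simps ev_conv leaf_deriv_def ev_lin_ext
  by (rule ev_cong) (auto simp: leaf_form_def)

lemma lookup_mult_empty: "lookup (x * y) {#} = lookup x {#} * lookup y ({#} :: 'a multiset)"
  for x y :: "'a multiset \<Rightarrow>\<^sub>0 'k::field"
  by (simp add: lookup_mult_splits[OF finite_splits] splits_empty)

text \<open>The Leibniz rule for the derivation of a letter is the transpose of the primitivity of
  this letter in the tensor algebra.\<close>

lemma ev_dual_form_mult:
  fixes x y :: "('a, 'b::field) ck"
  shows "ev (dual_form t) (x * y) =
     ev (\<lambda>(v, w). ev (word_form (letters v)) x * ev (word_form (letters w)) y) (tensor_coproduct t)"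
proof -
  let ?h = "\<lambda>x y (v, w). ev (word_form (letters v)) x * ev (word_form (letters w)) (y :: ('a, 'b) ck)"
  let ?p = "\<lambda>d :: 'a. single (letter d, 0) (1 :: 'b) + single (0, letter d) 1"
  have "ev (word_form l) (x * y) = ev (?h x y) (\<Prod>d\<leftarrow>l. ?p d)" for l
  proof (induction l arbitrary: x y)
    case Nil
    show ?case
      by (simp add: ev_word_form_Nil lookup_mult_empty one_pair del: word_form.simps)
  next
    case (Cons d l)
    have "?h x y ((letter d, 0) + p) = ?h (leaf_deriv d x) y p"
      "?h x y ((0, letter d) + p) = ?h x (leaf_deriv d y) p" for p
      by (cases p; simp add: ev_word_form_Cons del: word_form.simps)+
    then have "ev (?h x y) (\<Prod>d\<leftarrow>d # l. ?p d) =
        ev (?h (leaf_deriv d x) y) (\<Prod>d\<leftarrow>l. ?p d) + ev (?h x (leaf_deriv d y)) (\<Prod>d\<leftarrow>l. ?p d)"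
      by (simp add: distrib_right ev_add ev_mult_bilinear)
    then show ?case
      by (simp only: ev_word_form_Cons leaf_deriv_mult ev_add Cons.IH)
  qed
  then show ?thesis
    by (simp add: ev_dual_form tensor_coproduct_def ev_lin_ext)
qed


section \<open>The action of the leaves on the generators\<close>

lemma posdeg_add_right_cancel [simp]: "\<alpha> + \<gamma> = \<beta> + \<gamma> \<longleftrightarrow> \<alpha> = (\<beta> :: 'n::finite posdeg)"
  by transfer simp

text \<open>A multiset of decorations is encoded as a forest of leaves of the same degree.\<close>

lemma finite_mset_degree: "finite {M :: ('m::finite, 'n::finite) deco multiset. mset_degree M = \<gamma>}"
proof -
  let ?l = "image_mset (\<lambda>d :: ('m, 'n) deco. Node d {#})"
  have deg: "forest_degree (?l M) = mset_degree M" for M :: "('m, 'n) deco multiset"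
    by (induction M) (simp_all add: forest_degree_def)
  have "inj ?l" by (rule multiset.inj_map) (simp add: inj_def)
  then have "finite (?l -` {F. forest_degree F = \<gamma>})"
    by (intro finite_vimageI finite_forest_degree)
  then show ?thesis by (simp add: deg vimage_def)
qed

context dse_solution
begin

text \<open>At a single tree only the linear term of each F survives, with its first parameter as
  coefficient. The leaf occurs in the sum of its own block only, and block 0 does not enter the
  factors at all.\<close>

lemma coef_factor_leaf:
  "coef (index_factor X i * degree_factor X \<gamma>) {#Node (j, \<beta>) {#}#} =
    (if block k I j = 0 then 0 else vdot (A (block k I j)) \<gamma> + expo i (block k I j))"
proof -
  have "coef (block_sum X q) {#Node (j, \<beta>) {#}#} = (if q = block k I j then 1 else 0)" if "q \<in> {1..k}" for q
  proof -
    have "j \<in> I q \<longleftrightarrow> q = block k I j" using that block_eqI[of q j] block(2)[of j] by auto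
    then show ?thesis by (simp add: block_sum_def coef_sum coef_X_graft)
  qed
  then have "coef (index_factor X i * degree_factor X \<gamma>) {#Node (j, \<beta>) {#}#} =
      (\<Sum>q = 1..k. vdot (A q) \<gamma> * (if q = block k I j then 1 else 0)) +
      (\<Sum>q = 1..k. expo i q * (if q = block k I j then 1 else 0))"
    by (simp add: coef_mult_single coef_prod_empty coef_prod_single coef_series_F_single
        index_factor_def degree_factor_def)
  also have "\<dots> = (\<Sum>q = 1..k. if q = block k I j then vdot (A q) \<gamma> + expo i q else 0)"
    by (simp add: sum.distrib[symmetric] if_distrib cong: if_cong)
  finally show ?thesis using block(1)[of j] by auto
qed

lemma leaf_deriv_gen_add:
  "leaf_deriv (j, \<beta>) (gen (i, \<alpha> + \<beta>)) = smul (deg1_coeff k I A b b' j (i, \<alpha>)) (gen (i, \<alpha>))"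
proof (rule poly_mapping_eqI)
  fix H
  have [simp]: "deco_degree (l, \<alpha> + \<beta>) = deg_vec \<alpha> + deg_vec \<beta>" "deco_degree (l, \<alpha>) = deg_vec \<alpha>"
    "deco_degree (l, \<beta>) = deg_vec \<beta>" for l :: 'm
    by (simp_all add: deco_degree_def plus_posdeg.rep_eq)
  \<comment> \<open>Therefore the summand of the coproduct with empty right factor does not meet the
    leaf.\<close>
  have "deg_vec \<alpha> \<noteq> 0" using deg_vec[of \<alpha>] by simp
  then show "lookup (leaf_deriv (j, \<beta>) (gen (i, \<alpha> + \<beta>))) H =
      lookup (smul (deg1_coeff k I A b b' j (i, \<alpha>)) (gen (i, \<alpha>))) H"
    by (auto simp: lookup_leaf_deriv lookup_coproduct_gen coef_factor_leaf lookup_gen deg1_coeff_eq add.commute)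
qed

text \<open>For degree reasons only the summand with empty right factor can contribute, and the leaf
  has coefficient 1 in its own generator.\<close>

lemma leaf_deriv_gen_other:
  assumes "\<nexists>\<alpha>. \<delta> = \<alpha> + \<beta>"
  shows "leaf_deriv (j, \<beta>) (gen (i, \<delta>)) = (if (i, \<delta>) = (j, \<beta>) then 1 else 0)"
proof (rule poly_mapping_eqI)
  fix H :: "('m, 'n) deco forest"
  have [simp]: "deco_degree (l, \<beta>) = deg_vec \<beta>" "deco_degree (l, \<delta>) = deg_vec \<delta>" for l :: 'm
    by (simp_all add: deco_degree_def)
  show "lookup (leaf_deriv (j, \<beta>) (gen (i, \<delta>))) H = lookup (if (i, \<delta>) = (j, \<beta>) then 1 else 0) H"
  proof (cases "H = {#}")
    case True
    then show ?thesis
      by (auto simp: lookup_leaf_deriv lookup_coproduct_gen coef_X_graft lookup_one deg_vec_inject)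
  next
    case False
    have "coef (X i) H = 0" if "deg_vec \<beta> + forest_degree H = deg_vec \<delta>"
    proof (cases rule: single_tree_cases[of H])
      case (2 e K)
      have "forest_degree H \<noteq> 0"
        using 2 total_degree_add[of "deco_degree e" "forest_degree K"]
          total_degree_eq_0[of "deco_degree e + forest_degree K"] total_degree_eq_0[of "deco_degree e"] by auto
      then have "\<delta> = Posdeg (forest_degree H) + \<beta>"
        using that by (simp add: deg_vec_inject[symmetric] plus_posdeg.rep_eq Posdeg_inverse add.commute)
      with assms show ?thesis by blast
    qed (rule coef_X_0)
    then show ?thesis using False
      by (auto simp: lookup_leaf_deriv lookup_coproduct_gen lookup_one when_def)
  qed
qed

text \<open>The number of generators in a monomial is what counts here, not the degree of the
  grading.\<close>

definition mons :: "nat \<Rightarrow> (('m, 'n) deco, 'k) ck set" where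
  "mons n = {incl p |p. \<forall>M\<in>keys p. size M = n}"

lemma mons_add: "x \<in> mons n \<Longrightarrow> y \<in> mons n \<Longrightarrow> x + y \<in> mons n"
proof -
  assume "x \<in> mons n" "y \<in> mons n"
  then obtain p q where "x = incl p" "\<forall>M\<in>keys p. size M = n" "y = incl q" "\<forall>M\<in>keys q. size M = n"
    by (auto simp: mons_def)
  then have "x + y = incl (p + q)" "\<forall>M\<in>keys (p + q). size M = n"
    using Poly_Mapping.keys_add[of p q] by (auto simp: incl_def lin_ext_add)
  then show ?thesis unfolding mons_def by blast
qed

lemma mons_smul: "x \<in> mons n \<Longrightarrow> smul c x \<in> mons n"
proof -
  assume "x \<in> mons n"
  then obtain p where "x = incl p" "\<forall>M\<in>keys p. size M = n" by (auto simp: mons_def)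
  then have "smul c x = incl (smul c p)" "\<forall>M\<in>keys (smul c p). size M = n"
    by (auto simp: incl_def lin_ext_smul in_keys_iff)
  then show ?thesis unfolding mons_def by blast
qed

lemma mons_mult: "x \<in> mons m \<Longrightarrow> y \<in> mons n \<Longrightarrow> x * y \<in> mons (m + n)"
proof -
  assume "x \<in> mons m" "y \<in> mons n"
  then obtain p q where "x = incl p" "\<forall>M\<in>keys p. size M = m" "y = incl q" "\<forall>M\<in>keys q. size M = n"
    by (auto simp: mons_def)
  then have "x * y = incl (p * q)" "\<forall>M\<in>keys (p * q). size M = m + n"
    using keys_mult[of p q] by (auto simp: incl_mult)
  then show ?thesis unfolding mons_def by blast
qed

lemma mons_0: "0 \<in> mons n"
proof -
  have "0 = incl 0" "\<forall>M\<in>keys (0 :: _ \<Rightarrow>\<^sub>0 'k). size M = n" by (simp_all add: incl_def)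
  then show ?thesis unfolding mons_def by blast
qed

lemma mons_mon: "size M = n \<Longrightarrow> mon M \<in> mons n"
proof -
  assume "size M = n"
  then have "mon M = incl (single M 1)" "\<forall>M\<in>keys (single M (1::'k)). size M = n" by (simp_all add: incl_def)
  then show ?thesis unfolding mons_def by blast
qed

lemma leaf_deriv_gen: "\<exists>r\<in>mons 1. leaf_deriv d (gen e) = (if d = e then 1 else 0) + r"
proof -
  obtain j \<beta> i \<delta> where [simp]: "d = (j, \<beta>)" "e = (i, \<delta>)" by (cases d; cases e)
  show ?thesis
  proof (cases "\<exists>\<alpha>. \<delta> = \<alpha> + \<beta>")
    case True
    then obtain \<alpha> where \<alpha>: "\<delta> = \<alpha> + \<beta>" ..
    have "d \<noteq> e"
    proof
      assume "d = e"
      then have "deg_vec \<beta> = deg_vec \<alpha> + deg_vec \<beta>" by (simp add: \<alpha> flip: plus_posdeg.rep_eq)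
      then show False using deg_vec[of \<alpha>] by simp
    qed
    moreover have "leaf_deriv d (gen e) \<in> mons 1"
      using mons_smul[OF mons_mon[of "{#(i, \<alpha>)#}"]] by (simp add: \<alpha> leaf_deriv_gen_add)
    ultimately show ?thesis by auto
  next
    case False
    then show ?thesis using mons_0 by (intro bexI[of _ 0]) (auto simp: leaf_deriv_gen_other)
  qed
qed

text \<open>The leading part is the partial derivative with respect to the generator of
  \<open>d\<close>, which lowers the number of generators by one; the structure constants only enter
  the remainder, where this number is unchanged.\<close>

lemma leaf_deriv_mon:
  "\<exists>r\<in>mons (size M). leaf_deriv d (mon M) = smul (of_nat (count M d)) (mon (M - {#d#})) + r"
proof (induction M)
  case empty
  show ?case by (simp add: leaf_deriv_one mons_0)
next
  case (add e M)
  obtain r where r: "r \<in> mons (size M)"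
    "leaf_deriv d (mon M) = smul (of_nat (count M d)) (mon (M - {#d#})) + r" using add.IH by blast
  obtain s where s: "s \<in> mons 1" "leaf_deriv d (gen e) = (if d = e then 1 else 0) + s"
    using leaf_deriv_gen by blast
  let ?c = "of_nat (count M d) :: 'k"
  \<comment> \<open>If \<open>d\<close> does not occur in \<open>M\<close> the multisets may differ,
    but then the coefficient \<open>?c\<close> is zero.\<close>
  have c: "smul ?c (gen e * mon (M - {#d#})) = smul ?c (mon (add_mset e M - {#d#}))"
  proof (cases "d \<in># M")
    case True
    then have "add_mset e M - {#d#} = add_mset e (M - {#d#})" by simp
    then show ?thesis by (simp only: mon_simps)
  qed (simp add: not_in_iff)
  have "leaf_deriv d (mon (add_mset e M)) =
      ((if d = e then 1 else 0) + s) * mon M + gen e * (smul ?c (mon (M - {#d#})) + r)"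
    by (simp only: mon_simps leaf_deriv_mult r(2) s(2))
  also have "\<dots> = (if d = e then mon M else 0) + smul ?c (gen e * mon (M - {#d#})) + (s * mon M + gen e * r)"
    by (simp add: distrib_left distrib_right smul_mult)
  also have "(if d = e then mon M else 0) + smul ?c (gen e * mon (M - {#d#})) =
      smul (of_nat (count (add_mset e M) d)) (mon (add_mset e M - {#d#}))"
    unfolding c by (cases "d = e") (simp_all add: smul_add_left)
  finally have "leaf_deriv d (mon (add_mset e M)) =
      smul (of_nat (count (add_mset e M) d)) (mon (add_mset e M - {#d#})) + (s * mon M + gen e * r)" .
  moreover have "s * mon M + gen e * r \<in> mons (size (add_mset e M))"
    using mons_mult[OF s(1) mons_mon[OF refl]] mons_mult[OF mons_mon[of "{#e#}" 1] r(1)]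
    by (intro mons_add) simp_all
  ultimately show ?case by blast
qed

lemma lookup_mon_empty: "lookup (mon M) {#} = (if M = {#} then 1 else 0)"
proof (induction M)
  case empty
  show ?case by (simp add: lookup_one)
next
  case (add d M)
  show ?case by (simp add: lookup_mult_empty lookup_gen)
qed

lemma ev_mons:
  assumes "x \<in> mons n" "\<And>M. size M = n \<Longrightarrow> ev f (mon M) = 0"
  shows "ev f x = 0"
proof -
  obtain p where p: "x = incl p" "\<forall>M\<in>keys p. size M = n" using assms(1) by (auto simp: mons_def)
  have "ev f x = ev (\<lambda>M. ev f (mon M)) p" by (simp add: p incl_def ev_lin_ext)
  also have "\<dots> = ev (\<lambda>_. 0) p" by (rule ev_cong) (use p assms in auto)
  finally show ?thesis by simp
qed

text \<open>Each letter removes at most one generator, and the counit kills every monomial but 1. If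
  the lengths agree only the partial derivatives matter, and they multiply up to a product of
  multiplicities, nonzero in characteristic zero.\<close>

lemma word_form_mon:
  shows "length w < size M \<Longrightarrow> ev (word_form w) (mon M) = (0 :: 'k)"
    and "length w = size M \<Longrightarrow> ev (word_form w) (mon M) = (0 :: 'k) \<longleftrightarrow> mset w \<noteq> M"
proof (induction w arbitrary: M)
  case Nil
  {
    case 1
    then show ?case by (auto simp: ev_word_form_Nil lookup_mon_empty simp del: word_form.simps)
  next
    case 2
    then show ?case by (auto simp: ev_word_form_Nil lookup_mon_empty simp del: word_form.simps)
  }
next
  case (Cons d w)
  \<comment> \<open>The remainder keeps \<open>size M\<close> generators, too many for the shorter
    word \<open>w\<close>.\<close>
  have eq: "ev (word_form (d # w)) (mon M) = of_nat (count M d) * ev (word_form w) (mon (M - {#d#}))"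
    if "length w < size M" for M
  proof -
    obtain r where r: "r \<in> mons (size M)"
      "leaf_deriv d (mon M) = smul (of_nat (count M d)) (mon (M - {#d#})) + r"
      using leaf_deriv_mon by blast
    then show ?thesis
      using ev_mons[OF r(1), of "word_form w"] Cons.IH(1) that
      by (simp add: ev_word_form_Cons r(2) ev_add ev_smul del: word_form.simps)
  qed
  {
    case 1
    then have "length w < size M" "length w < size (M - {#d#})"
      by (cases "d \<in># M"; simp add: size_Diff_singleton)+
    then show ?case using eq Cons.IH(1)[of "M - {#d#}"] by simp
  next
    case 2
    then show ?case
    proof (cases "d \<in># M")
      case True
      then have "mset (d # w) = M \<longleftrightarrow> mset w = M - {#d#}" by (auto dest!: multi_member_split)
      then show ?thesis using eq 2 True Cons.IH(2)[of "M - {#d#}"]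
        by (simp add: size_Diff_singleton count_eq_zero_iff)
    next
      case False
      then have "mset (d # w) \<noteq> M" by auto
      then show ?thesis using eq 2 False by (simp add: not_in_iff)
    qed
  }
qed

end


section \<open>The enveloping algebra\<close>

lemma tensor_ring_simps [simp]:
  "carrier tensor_ring = UNIV" "mult tensor_ring = (*)" "one tensor_ring = 1"
  "zero tensor_ring = 0" "add tensor_ring = (+)"
  by (simp_all add: tensor_ring_def)

lemma ring_tensor_ring: "ring (tensor_ring :: ('b mword \<Rightarrow>\<^sub>0 'k::field) ring)"
proof (rule ringI)
  show "abelian_group (tensor_ring :: ('b mword \<Rightarrow>\<^sub>0 'k) ring)"
  proof (rule abelian_groupI)
    fix x :: "'b mword \<Rightarrow>\<^sub>0 'k"
    show "\<exists>y\<in>carrier tensor_ring. y \<oplus>\<^bsub>tensor_ring\<^esub> x = \<zero>\<^bsub>tensor_ring\<^esub>"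
      by (intro bexI[of _ "- x"]) simp_all
  qed (simp_all add: ac_simps)
  show "Group.monoid (tensor_ring :: ('b mword \<Rightarrow>\<^sub>0 'k) ring)"
    by (rule monoidI) (simp_all add: mult.assoc)
qed (simp_all add: distrib_left distrib_right)

lemma ideal_tensor_ring:
  fixes J :: "('b mword \<Rightarrow>\<^sub>0 'k::field) set"
  assumes "0 \<in> J" "\<And>x y. x \<in> J \<Longrightarrow> y \<in> J \<Longrightarrow> x + y \<in> J"
    and "\<And>x a. x \<in> J \<Longrightarrow> a * x \<in> J" "\<And>x a. x \<in> J \<Longrightarrow> x * a \<in> J"
  shows "ideal J tensor_ring"
proof (rule idealI[OF ring_tensor_ring])
  interpret ring "tensor_ring :: ('b mword \<Rightarrow>\<^sub>0 'k) ring" by (rule ring_tensor_ring)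
  show "subgroup J (add_monoid tensor_ring)"
  proof (rule add.subgroupI)
    fix x assume "x \<in> J"
    then have "- x \<in> J" using assms(3)[of x "- 1"] by simp
    moreover have "\<ominus>\<^bsub>tensor_ring\<^esub> x = - x" by (rule minus_equality) simp_all
    ultimately show "\<ominus>\<^bsub>tensor_ring\<^esub> x \<in> J" by simp
  qed (use assms in auto)
qed (use assms in auto)

lemma envelope_ideal: "ideal (envelope_ideal br) tensor_ring"
  unfolding envelope_ideal_def by (rule ring.genideal_ideal[OF ring_tensor_ring]) simp

lemma envelope_ideal_closed:
  shows "0 \<in> envelope_ideal br"
    and "x \<in> envelope_ideal br \<Longrightarrow> y \<in> envelope_ideal br \<Longrightarrow> x + y \<in> envelope_ideal br"
    and "x \<in> envelope_ideal br \<Longrightarrow> a * x \<in> envelope_ideal br"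
    and "x \<in> envelope_ideal br \<Longrightarrow> x * a \<in> envelope_ideal br"
    and "x \<in> envelope_ideal br \<Longrightarrow> smul c x \<in> envelope_ideal br"
    and "x \<in> envelope_ideal br \<Longrightarrow> - x \<in> envelope_ideal br"
proof -
  interpret ideal "envelope_ideal br" tensor_ring by (rule envelope_ideal)
  show "0 \<in> envelope_ideal br" using additive_subgroup.zero_closed[OF is_additive_subgroup] by simp
  show "x \<in> envelope_ideal br \<Longrightarrow> y \<in> envelope_ideal br \<Longrightarrow> x + y \<in> envelope_ideal br"
    using additive_subgroup.a_closed[OF is_additive_subgroup] by simp
  show *: "x \<in> envelope_ideal br \<Longrightarrow> a * x \<in> envelope_ideal br" for a using I_l_closed by simp
  show "x \<in> envelope_ideal br \<Longrightarrow> x * a \<in> envelope_ideal br" using I_r_closed by simp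
  show "x \<in> envelope_ideal br \<Longrightarrow> smul c x \<in> envelope_ideal br" using *[of "single 0 c"] by (simp add: smul_eq_mult)
  show "x \<in> envelope_ideal br \<Longrightarrow> - x \<in> envelope_ideal br" using *[of "- 1"] by simp
qed

lemma envelope_ideal_relation:
  "tensor_incl x * tensor_incl y - tensor_incl y * tensor_incl x - tensor_incl (br x y) \<in> envelope_ideal br"
  unfolding envelope_ideal_def
  by (rule subsetD[OF ring.genideal_self[OF ring_tensor_ring]]) auto

lemma mem_env_class: "s \<in> env_class br t \<longleftrightarrow> s - t \<in> envelope_ideal br"
  unfolding env_class_def a_r_coset_def' by (auto simp: algebra_simps intro!: bexI[of _ "s - t"])

lemma env_class_eqI: "s - t \<in> envelope_ideal br \<Longrightarrow> env_class br s = env_class br t"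
proof -
  interpret ideal "envelope_ideal br" tensor_ring by (rule envelope_ideal)
  assume "s - t \<in> envelope_ideal br"
  then have "s \<in> env_class br t" by (simp add: mem_env_class)
  then show ?thesis unfolding env_class_def by (intro a_repr_independence'[symmetric]) simp_all
qed

lemma carrier_envelope: "carrier (envelope br) = range (env_class br)"
  by (auto simp: envelope_def FactRing_def A_RCOSETS_def' env_class_def)

lemma env_class_hom: "env_class br \<in> ring_hom tensor_ring (envelope br)"
  using ideal.rcos_ring_hom[OF envelope_ideal, of br]
  unfolding envelope_def env_class_def[abs_def] .

lemma tensor_incl_add: "tensor_incl (x + y) = tensor_incl x + tensor_incl y"
  and tensor_incl_diff: "tensor_incl (x - y) = tensor_incl x - tensor_incl y"
  and tensor_incl_single: "tensor_incl (single d c) = single (letter d) c"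
  by (simp_all add: tensor_incl_def lin_ext_add lin_ext_diff smul_single)

lemma keys_lin_ext: "a \<in> keys (lin_ext g x) \<Longrightarrow> \<exists>b\<in>keys x. a \<in> keys (g b)"
proof (rule ccontr)
  assume a: "a \<in> keys (lin_ext g x)" and "\<not> (\<exists>b\<in>keys x. a \<in> keys (g b))"
  then have "ev (\<lambda>b. lookup (g b) a) x = ev (\<lambda>_. 0) x" by (intro ev_cong) (auto simp: in_keys_iff)
  with a show False by (simp add: in_keys_iff lookup_lin_ext)
qed

lemma keys_tensor_incl: "w \<in> keys (tensor_incl x) \<Longrightarrow> length (letters w) = 1"
  unfolding tensor_incl_def by (auto dest!: keys_lin_ext split: if_splits)

section \<open>Reordering letters modulo the ideal and shorter words\<close>

abbreviation word :: "'b list \<Rightarrow> ('b mword \<Rightarrow>\<^sub>0 'k::field)" where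
  "word w \<equiv> single (MWord w) 1"

lemma word_Cons: "word (d # w) = single (letter d) 1 * (word w :: _ \<Rightarrow>\<^sub>0 'k::field)"
  by (simp add: mult_single letter_def plus_mword_def)

text \<open>The preimage in the tensor algebra of the filtration of the enveloping algebra by the
  length of words.\<close>

definition low :: "(('b \<Rightarrow>\<^sub>0 'k) \<Rightarrow> ('b \<Rightarrow>\<^sub>0 'k) \<Rightarrow> ('b \<Rightarrow>\<^sub>0 'k)) \<Rightarrow> nat \<Rightarrow> ('b mword \<Rightarrow>\<^sub>0 'k::field) set" where
  "low br n = {j + t |j t. j \<in> envelope_ideal br \<and> (\<forall>w\<in>keys t. length (letters w) < n)}"

lemma lowI: "j \<in> envelope_ideal br \<Longrightarrow> (\<And>w. w \<in> keys t \<Longrightarrow> length (letters w) < n) \<Longrightarrow> j + t \<in> low br n"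
  unfolding low_def by blast

lemma low_add: "x \<in> low br n \<Longrightarrow> y \<in> low br n \<Longrightarrow> x + y \<in> low br n"
proof -
  assume "x \<in> low br n" "y \<in> low br n"
  then obtain j t j' t' where *: "x = j + t" "y = j' + t'" "j \<in> envelope_ideal br" "j' \<in> envelope_ideal br"
    "\<forall>w\<in>keys t. length (letters w) < n" "\<forall>w\<in>keys t'. length (letters w) < n"
    by (auto simp: low_def)
  then have "(j + j') + (t + t') \<in> low br n"
    using Poly_Mapping.keys_add[of t t'] by (intro lowI envelope_ideal_closed) auto
  then show ?thesis by (simp add: * ac_simps)
qed

lemma low_smul: "x \<in> low br n \<Longrightarrow> smul c x \<in> low br n"
proof -
  assume "x \<in> low br n"
  then obtain j t where *: "x = j + t" "j \<in> envelope_ideal br" "\<forall>w\<in>keys t. length (letters w) < n"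
    by (auto simp: low_def)
  then have "smul c j + smul c t \<in> low br n"
    by (intro lowI envelope_ideal_closed) (auto simp: in_keys_iff)
  then show ?thesis by (simp add: * smul_add)
qed

lemma low_0: "0 \<in> low br n"
  using lowI[OF envelope_ideal_closed(1), of 0 n br] by simp

lemma low_lin_ext: "(\<And>a. a \<in> keys x \<Longrightarrow> g a \<in> low br n) \<Longrightarrow> lin_ext g x \<in> low br n"
proof -
  assume g: "\<And>a. a \<in> keys x \<Longrightarrow> g a \<in> low br n"
  have "(\<Sum>a\<in>S. smul (lookup x a) (g a)) \<in> low br n" if "S \<subseteq> keys x" for S
    using that g by (induction S rule: infinite_finite_induct) (auto intro: low_0 low_add low_smul)
  then show ?thesis by (simp add: lin_ext_def)
qed

lemma low_letter: "x \<in> low br n \<Longrightarrow> single (letter d) 1 * x \<in> low br (Suc n)"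
proof -
  assume "x \<in> low br n"
  then obtain j t where *: "x = j + t" "j \<in> envelope_ideal br" "\<forall>w\<in>keys t. length (letters w) < n"
    by (auto simp: low_def)
  have "length (letters w) < Suc n" if "w \<in> keys (single (letter d) 1 * t)" for w
    using that keys_mult[of "single (letter d) 1" t] * by (auto split: if_splits)
  then have "single (letter d) 1 * j + single (letter d) 1 * t \<in> low br (Suc n)"
    using * by (intro lowI envelope_ideal_closed)
  then show ?thesis by (simp add: * distrib_left)
qed

text \<open>Modulo the ideal the commutator of two letters is their bracket, a combination of single
  letters, so the difference has one letter less.\<close>

lemma word_swap: "word (d # e # u) - word (e # d # u) \<in> low br (length u + 2)"
proof -
  let ?b = "tensor_incl (br (single d 1) (single e 1)) :: 'a mword \<Rightarrow>\<^sub>0 'b"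
  let ?r = "single (letter d) 1 * single (letter e) 1 - single (letter e) 1 * single (letter d) 1 - ?b"
  have "length (letters w) < length u + 2" if "w \<in> keys (?b * word u)" for w
    using that keys_mult[of ?b "word u"] keys_tensor_incl by fastforce
  moreover have "?r * word u \<in> envelope_ideal br"
    using envelope_ideal_relation[of "single d 1" "single e 1" br]
    by (intro envelope_ideal_closed) (simp add: tensor_incl_single)
  ultimately have "?r * word u + ?b * word u \<in> low br (length u + 2)" by (rule lowI[rotated])
  then show ?thesis by (simp add: word_Cons left_diff_distrib mult.assoc)
qed

lemma word_move: "word (a @ d # u) - word (d # a @ u) \<in> low br (length (a @ d # u))"
proof (induction a)
  case (Cons x a)
  have "single (letter x) 1 * (word (a @ d # u) - word (d # a @ u)) +
      (word (x # d # a @ u) - word (d # x # a @ u)) \<in> low br (Suc (length (a @ d # u)))"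
    using word_swap[of x d "a @ u" br] by (intro low_add low_letter Cons) simp
  then show ?case by (simp add: right_diff_distrib word_Cons)
qed (simp add: low_0)

text \<open>The elementary half of the Poincare-Birkhoff-Witt theorem: up to shorter words only the
  multiset of letters matters. The first letter of \<open>v\<close> is moved to the front of
  \<open>w\<close>, and induction treats the rest.\<close>

lemma word_perm: "mset v = mset w \<Longrightarrow> word v - word w \<in> low br (length v)"
proof (induction v arbitrary: w)
  case (Cons d v)
  then have "d \<in> set w" by (metis list.set_intros(1) set_mset_mset)
  then obtain a u where w: "w = a @ d # u" by (metis split_list)
  with Cons.prems have "mset v = mset (a @ u)" by simp
  then have "single (letter d) 1 * (word v - word (a @ u)) + smul (- 1) (word (a @ d # u) - word (d # a @ u))
      \<in> low br (length (d # v))"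
    using low_letter[OF Cons.IH, of "a @ u"] low_smul[OF word_move, of "- 1" a d u br]
      mset_eq_length[of v "a @ u"] by (intro low_add) simp_all
  then show ?case by (simp add: w right_diff_distrib word_Cons smul_minus_one)
qed (simp add: low_0)

definition arrangement :: "'b multiset \<Rightarrow> 'b list" where
  "arrangement M = (SOME w. mset w = M)"

lemma mset_arrangement [simp]: "mset (arrangement M) = M"
  unfolding arrangement_def by (rule someI_ex) (rule ex_mset)

lemma length_arrangement [simp]: "length (arrangement M) = size M"
  by (metis mset_arrangement size_mset)

lemma deg1_prod_add:
  "deg1_prod k I A b b' (x + y) z = deg1_prod k I A b b' x z + deg1_prod k I A b b' y z"
  "deg1_prod k I A b b' x (y + z) = deg1_prod k I A b b' x y + deg1_prod k I A b b' x z"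
  by (simp_all add: deg1_prod_def lin_ext_add split_def lin_ext_pointwise)

lemma deg1_prod_single:
  "deg1_prod k I A b b' (single (j, \<beta>) c) (single (i, \<alpha>) c') =
    single (i, \<alpha> + \<beta>) (c * c' * deg1_coeff k I A b b' j (i, \<alpha>))"
  by (simp add: deg1_prod_def smul_single mult.assoc)

lemma mset_degree_mset: "mset_degree (mset w) = word_degree (MWord w)"
  by (simp add: mset_degree_def word_degree_def sum_mset_sum_list flip: mset_map)

lemma word_form_degree: "word_form (letters w) F \<noteq> (0::'k::field) \<Longrightarrow> forest_degree F = word_degree w"
proof -
  assume "word_form (letters w) F \<noteq> (0::'k)"
  from word_form_decos[OF this] have "forest_degree F = mset_degree (mset (letters w))"
    by (simp only: forest_degree_eq mset_degree_def)
  then show ?thesis by (simp add: mset_degree_mset)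
qed

lemma dual_form_degree:
  assumes "ev (dual_form t) x \<noteq> 0" "homogeneous forest_degree \<gamma> x"
  shows "\<exists>w\<in>keys t. word_degree w = \<gamma>"
proof (rule ccontr)
  assume *: "\<not> ?thesis"
  have "dual_form t F = ev (\<lambda>_. 0) t" if "F \<in> keys x" for F
    unfolding dual_form_def
  proof (rule ev_cong)
    fix w assume "w \<in> keys t"
    then show "word_form (letters w) F = 0"
      using * that assms(2) word_form_degree[of w F] by (auto simp: homogeneous_def)
  qed
  then have "ev (dual_form t) x = ev (\<lambda>_. 0) x" by (intro ev_cong) simp
  with assms(1) show False by simp
qed

lemma ev_dual_form_single: "ev (dual_form (single w c)) x = c * ev (word_form (letters w)) x"
  and ev_dual_form_add: "ev (dual_form (s + t)) x = ev (dual_form s) x + ev (dual_form t) x"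
  and ev_dual_form_diff: "ev (dual_form (s - t)) x = ev (dual_form s) x - ev (dual_form t) x"
  and ev_dual_form_smul: "ev (dual_form (smul c t)) x = c * ev (dual_form t) x"
  and ev_dual_form_lin_ext: "ev (dual_form (lin_ext g p)) x = ev (\<lambda>a. ev (dual_form (g a)) x) p"
  by (simp_all add: ev_dual_form ev_add ev_diff ev_smul ev_lin_ext)

lemma ev_word_form_one: "ev (word_form w) (1 :: ('a, 'b::field) ck) = (if w = [] then 1 else 0)"
proof (cases w)
  case Nil
  then show ?thesis by (simp add: ev_word_form_Nil lookup_one del: word_form.simps)
next
  case (Cons d v)
  then show ?thesis by (simp add: ev_word_form_Cons leaf_deriv_one del: word_form.simps)
qed

lemma ev_word_form_single_mult:
  "ev (word_form [d]) (x * y) = ev (word_form [d]) x * lookup y {#} + lookup x {#} * ev (word_form [d]) y"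
  by (simp add: ev_word_form_Cons ev_word_form_Nil leaf_deriv_mult lookup_add lookup_mult_empty del: word_form.simps)

text \<open>The mixed terms of the two Leibniz rules are symmetric in \<open>d\<close> and
  \<open>e\<close> and cancel: the commutator of two derivations is a derivation.\<close>

lemma ev_word_form_commutator_mult:
  fixes x y :: "('d, 'k::field) ck" and d e
  defines "h \<equiv> \<lambda>x. ev (word_form [d, e]) x - ev (word_form [e, d]) x"
  shows "h (x * y) = h x * lookup y {#} + lookup x {#} * h y"
  by (simp add: h_def ev_word_form_Cons ev_word_form_Nil leaf_deriv_mult leaf_deriv_add lookup_add
      lookup_mult_empty algebra_simps del: word_form.simps)

context dse_solution
begin

abbreviation "bracket \<equiv> lie_bracket (deg1_prod k I A b b')"

section \<open>The relations of the enveloping algebra on the subalgebra\<close>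

lemma ev_word_form_single_gen: "ev (word_form [d]) (gen f) = (if d = f then 1 else 0)"
proof -
  have "ev (word_form [d]) (gen f) = lookup (coproduct (gen f)) ({#Node d {#}#}, {#})"
    by (simp add: ev_word_form_Cons ev_word_form_Nil lookup_leaf_deriv del: word_form.simps)
  also have "\<dots> = lookup (gen f) {#Node d {#}#}"
    by (simp add: lookup_coproduct_gen lookup_gen)
  finally show ?thesis by (simp add: lookup_gen_leaf eq_commute)
qed

lemma ev_word_form_pair_gen:
  "ev (word_form [(j, \<beta>), (i, \<alpha>)]) (gen f) = (if f = (i, \<alpha> + \<beta>) then deg1_coeff k I A b b' j (i, \<alpha>) else 0)"
proof -
  obtain l \<delta> where f: "f = (l, \<delta>)" by (cases f)
  show ?thesis
  proof (cases "\<exists>\<alpha>'. \<delta> = \<alpha>' + \<beta>")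
    case True
    then obtain \<alpha>' where "\<delta> = \<alpha>' + \<beta>" ..
    then show ?thesis unfolding ev_word_form_Cons[of "(j, \<beta>)" "[(i, \<alpha>)]"]
      by (auto simp: f leaf_deriv_gen_add ev_smul ev_word_form_single_gen simp del: word_form.simps)
  next
    case False
    then show ?thesis unfolding ev_word_form_Cons[of "(j, \<beta>)" "[(i, \<alpha>)]"]
      by (auto simp: f leaf_deriv_gen_other ev_word_form_one simp del: word_form.simps)
  qed
qed

text \<open>Both the commutator and the single letters satisfy the Leibniz rule over the counit,
  hence so does their difference \<open>h\<close>. As generators have counit zero, it suffices that
  \<open>h\<close> vanishes on generators, where the structure constants cancel.\<close>

lemma relation_vanishes_mon:
  "ev (dual_form (tensor_incl (single d c) * tensor_incl (single e c') - tensor_incl (single e c') * tensor_incl (single d c) -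
     tensor_incl (bracket (single d c) (single e c')))) (mon M) = 0"
proof -
  obtain j \<beta> i \<alpha> where de: "d = (j, \<beta>)" "e = (i, \<alpha>)" by (cases d; cases e)
  let ?p = "deg1_coeff k I A b b' j (i, \<alpha>)" and ?q = "deg1_coeff k I A b b' i (j, \<beta>)"
  let ?u = "(i, \<alpha> + \<beta>)" and ?v = "(j, \<alpha> + \<beta>)"
  define h where "h x = ev (word_form [d, e]) x - ev (word_form [e, d]) x -
    (?p * ev (word_form [?u]) x - ?q * ev (word_form [?v]) x)" for x :: "(('m, 'n) deco, 'k) ck"
  have "ev (dual_form (tensor_incl (single d c) * tensor_incl (single e c') - tensor_incl (single e c') * tensor_incl (single d c) -
     tensor_incl (bracket (single d c) (single e c')))) x = c * c' * h x" for x
    by (simp add: lie_bracket_def de deg1_prod_single tensor_incl_single tensor_incl_diff mult_single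
        ev_dual_form_single ev_dual_form_diff del: word_form.simps)
      (simp add: h_def de algebra_simps add.commute[of \<beta>] del: word_form.simps)
  moreover have "h (mon M) = 0"
  proof (cases M)
    case empty
    then show ?thesis by (simp add: h_def ev_word_form_one del: word_form.simps)
  next
    case (add f N)
    have mult: "h (x * y) = h x * lookup y {#} + lookup x {#} * h y" for x y
      using ev_word_form_commutator_mult[of d e x y]
      by (simp add: h_def ev_word_form_single_mult algebra_simps del: word_form.simps)
    have "h (gen f) = 0"
      by (auto simp: h_def de ev_word_form_pair_gen ev_word_form_single_gen add.commute[of \<beta>] simp del: word_form.simps)
    moreover have "lookup (gen f) {#} = 0" by (simp add: lookup_gen)
    ultimately show ?thesis by (simp add: add mult)
  qed
  ultimately show ?thesis by simp
qed

text \<open>The kernel of the map from the tensor algebra to the dual of \<open>V\<close>. It is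
  identified with the ideal of the enveloping algebra in \<open>vanishing_eq\<close>.\<close>

definition vanishing :: "(('m, 'n) deco mword \<Rightarrow>\<^sub>0 'k) set" where
  "vanishing = {t. \<forall>x\<in>V. ev (dual_form t) x = 0}"

lemma vanishing_iff: "t \<in> vanishing \<longleftrightarrow> (\<forall>M. ev (dual_form t) (mon M) = 0)"
proof
  assume *: "\<forall>M. ev (dual_form t) (mon M) = 0"
  have "ev (dual_form t) (incl p) = 0" for p
    by (simp add: incl_def ev_lin_ext *)
  then show "t \<in> vanishing" by (auto simp: vanishing_def V_eq)
qed (simp add: vanishing_def mon_in_V)

lemma ev_dual_form_product:
  "ev (dual_form (s * t)) x = ev (\<lambda>(G, H). dual_form s G * dual_form t H) (coproduct x)"
  by (simp add: dual_form_mult ev_conv)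

text \<open>The coproduct of an element of \<open>V\<close> is a sum of tensors of elements of
  \<open>V\<close>, so it suffices that one of the two forms vanishes on \<open>V\<close>.\<close>

lemma vanishing_mult:
  assumes "s \<in> vanishing \<or> t \<in> vanishing"
  shows "s * t \<in> vanishing"
  unfolding vanishing_def
proof (intro CollectI ballI)
  fix x assume "x \<in> V"
  then have "coproduct x \<in> V_tensors" by (rule coproduct_V)
  then have "ev (\<lambda>(G, H). dual_form s G * dual_form t H) (coproduct x) = 0"
    by (induction rule: V_tensors_induct) (use assms in \<open>auto simp: ev_add ev_tens vanishing_def\<close>)
  then show "ev (dual_form (s * t)) x = 0" by (simp add: ev_dual_form_product)
qed

lemma ideal_vanishing: "ideal vanishing tensor_ring"
proof (rule ideal_tensor_ring)
  show "0 \<in> vanishing" by (simp add: vanishing_iff ev_dual_form)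
  show "x + y \<in> vanishing" if "x \<in> vanishing" "y \<in> vanishing" for x y
    using that by (simp add: vanishing_iff ev_dual_form_add)
qed (simp_all add: vanishing_mult)

lemma relation_vanishes:
  "tensor_incl x * tensor_incl y - tensor_incl y * tensor_incl x - tensor_incl (bracket x y) \<in> vanishing"
  (is "?r x y \<in> _")
proof (induction x rule: free_induct)
  case (single d c)
  show ?case
  proof (induction y rule: free_induct)
    case (single e c')
    show ?case unfolding vanishing_iff using relation_vanishes_mon by blast
  next
    case (add y z)
    have "?r (single d c) (y + z) = ?r (single d c) y + ?r (single d c) z"
      by (simp add: lie_bracket_def deg1_prod_add tensor_incl_add tensor_incl_diff algebra_simps)
    with add show ?case by (simp only: vanishing_iff ev_dual_form_add) simp
  qed
next
  case (add x z)
  have "?r (x + z) y = ?r x y + ?r z y"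
    by (simp add: lie_bracket_def deg1_prod_add tensor_incl_add tensor_incl_diff algebra_simps)
  with add show ?case by (simp only: vanishing_iff ev_dual_form_add) simp
qed

lemma envelope_ideal_vanishing: "envelope_ideal bracket \<subseteq> vanishing"
  unfolding envelope_ideal_def
  by (rule ring.genideal_minimal[OF ring_tensor_ring ideal_vanishing]) (use relation_vanishes in auto)

section \<open>Triangularity of the pairing: injectivity and surjectivity\<close>

definition arranged :: "(('m, 'n) deco multiset \<Rightarrow>\<^sub>0 'k) \<Rightarrow> (('m, 'n) deco mword \<Rightarrow>\<^sub>0 'k)" where
  "arranged = lin_ext (\<lambda>M. word (arrangement M))"

lemma keys_arranged: "w \<in> keys (arranged q) \<Longrightarrow> \<exists>M\<in>keys q. w = MWord (arrangement M)"
  unfolding arranged_def by (drule keys_lin_ext) (auto split: if_splits)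

lemma ev_short:
  assumes "\<forall>w\<in>keys t. length (letters w) < size M"
  shows "ev (dual_form t) (mon M) = 0"
proof -
  have "ev (dual_form t) (mon M) = ev (\<lambda>_. 0) t"
    unfolding ev_dual_form by (rule ev_cong) (simp add: word_form_mon(1) assms)
  then show ?thesis by simp
qed

abbreviation pairing_const where
  "pairing_const M \<equiv> ev (word_form (arrangement M)) (mon M)"

lemma pairing_const_nonzero: "pairing_const M \<noteq> 0"
  using word_form_mon(2)[of "arrangement M" M] by simp

lemma ev_arranged:
  assumes "\<forall>M\<in>keys q. size M = size N"
  shows "ev (dual_form (arranged q)) (mon N) = lookup q N * pairing_const N"
proof -
  have "ev (dual_form (arranged q)) (mon N) = ev (\<lambda>M. if M = N then pairing_const N else 0) q"
    unfolding arranged_def ev_dual_form_lin_ext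
    by (rule ev_cong) (use assms in \<open>simp add: ev_dual_form_single word_form_mon(2)\<close>)
  then show ?thesis by (simp add: ev_lookup_delta)
qed

text \<open>Induction on a bound for the length of the words. Pairing with the monomials of maximal
  size shows that the longest words cancel up to order, so that modulo the ideal the element can be
  written with shorter words.\<close>

lemma vanishing_subset_envelope_ideal:
  assumes "t \<in> vanishing"
  shows "t \<in> envelope_ideal bracket"
proof -
  have "t \<in> envelope_ideal bracket"
    if "t \<in> vanishing" "\<forall>w\<in>keys t. length (letters w) < n" for n t
    using that
  proof (induction n arbitrary: t)
    case 0
    then have "keys t = {}" by auto
    then show ?case by (simp add: envelope_ideal_closed)
  next
    case (Suc n)
    define top where "top = component (\<lambda>w. length (letters w)) n t"
    define q where "q = lin_ext (\<lambda>w. single (mset (letters w)) (1::'k)) top"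
    have top_keys: "length (letters w) = n" if "w \<in> keys top" for w
      using that by (auto simp: top_def in_keys_iff lookup_component split: if_splits)
    have q_keys: "\<forall>M\<in>keys q. size M = n"
      unfolding q_def by (auto dest!: keys_lin_ext simp: top_keys split: if_splits)
    have rest: "\<forall>w\<in>keys (t - top). length (letters w) < n"
    proof
      fix w assume "w \<in> keys (t - top)"
      then have "lookup t w \<noteq> 0" "length (letters w) \<noteq> n"
        by (auto simp: in_keys_iff lookup_minus top_def lookup_component split: if_splits)
      then show "length (letters w) < n" using Suc.prems(2) by (force simp: in_keys_iff)
    qed
    \<comment> \<open>The longest words are replaced by one fixed word for each multiset of letters,
      at the cost of an element of the ideal and of shorter words.\<close>
    have "top - arranged q = lin_ext (\<lambda>w. word (letters w) - word (arrangement (mset (letters w)))) top"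
    proof -
      have "lin_ext (\<lambda>w. word (letters w)) top = top" by simp
      moreover have "arranged q = lin_ext (\<lambda>w. word (arrangement (mset (letters w)))) top"
        by (simp add: arranged_def q_def lin_ext_lin_ext)
      ultimately show ?thesis
        using lin_ext_pointwise[of "\<lambda>w. word (letters w)" "\<lambda>w. - word (arrangement (mset (letters w)))" top]
        by (simp add: lin_ext_pointwise_uminus)
    qed
    also have "\<dots> \<in> low bracket n"
      by (rule low_lin_ext) (metis mset_arrangement top_keys word_perm)
    finally obtain j l where jl: "top - arranged q = j + l" "j \<in> envelope_ideal bracket"
      "\<forall>w\<in>keys l. length (letters w) < n" by (auto simp: low_def)
    have t: "t = arranged q + j + (l + (t - top))"
      using jl(1) by (simp add: algebra_simps)
    have l_keys: "\<forall>w\<in>keys (l + (t - top)). length (letters w) < n"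
      using jl(3) rest Poly_Mapping.keys_add[of l "t - top"] by blast
    have j: "j \<in> vanishing" using jl(2) envelope_ideal_vanishing by blast
    \<comment> \<open>On a monomial of size \<open>n\<close> the ideal and the shorter words vanish,
      and the pairing with the arranged words is diagonal.\<close>
    have "lookup q N = 0" for N
    proof (cases "size N = n")
      case True
      have "ev (dual_form t) (mon N) = 0" "ev (dual_form j) (mon N) = 0"
        using Suc.prems(1) j by (simp_all add: vanishing_iff)
      then have "ev (dual_form (arranged q)) (mon N) = 0"
        using ev_short[of "l + (t - top)" N] l_keys True
          arg_cong[OF t, of "\<lambda>t. ev (dual_form t) (mon N)"] by (simp add: ev_dual_form_add)
      then show ?thesis using ev_arranged[of q N] q_keys True pairing_const_nonzero[of N] by simp
    next
      case False
      then show ?thesis using q_keys by (auto simp: in_keys_iff)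
    qed
    then have "q = 0" by (intro poly_mapping_eqI) simp
    then have t': "t = j + (l + (t - top))" using t by (simp add: arranged_def)
    then have "ev (dual_form (l + (t - top))) (mon M) = 0" for M
      using Suc.prems(1) j arg_cong[OF t', of "\<lambda>t. ev (dual_form t) (mon M)"]
      by (simp add: vanishing_iff ev_dual_form_add)
    then have "l + (t - top) \<in> envelope_ideal bracket"
      by (intro Suc.IH l_keys) (simp add: vanishing_iff)
    then show ?case using jl(2) t' envelope_ideal_closed(2) by metis
  qed
  \<comment> \<open>For \<open>t = 0\<close> the value of \<open>Max\<close> is unspecified, but the
    statement is vacuous.\<close>
  moreover have "\<forall>w\<in>keys t. length (letters w) < Suc (Max ((\<lambda>w. length (letters w)) ` keys t))"
    by (auto simp: less_Suc_eq_le)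
  ultimately show ?thesis using assms by blast
qed

lemma vanishing_eq: "vanishing = envelope_ideal bracket"
  using envelope_ideal_vanishing vanishing_subset_envelope_ideal by blast

text \<open>The triangular system is solved from the largest monomials downwards: arranged words
  produce the values of size \<open>n\<close>, and the defect lives on smaller monomials. The set
  \<Gamma> keeps track of degrees, as required for homogeneous forms.\<close>

lemma dual_form_surj:
  fixes g :: "('m, 'n) deco multiset \<Rightarrow>\<^sub>0 'k"
  assumes "\<forall>M\<in>keys g. mset_degree M \<in> \<Gamma>"
  shows "\<exists>t. (\<forall>w\<in>keys t. word_degree w \<in> \<Gamma>) \<and> (\<forall>M. ev (dual_form t) (mon M) = lookup g M)"
proof -
  have "\<exists>t. (\<forall>w\<in>keys t. word_degree w \<in> \<Gamma>) \<and> (\<forall>M. ev (dual_form t) (mon M) = lookup g M)"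
    if "\<forall>M\<in>keys g. mset_degree M \<in> \<Gamma>" "\<forall>M\<in>keys g. size M < n" for n and g :: "('m, 'n) deco multiset \<Rightarrow>\<^sub>0 'k"
    using that
  proof (induction n arbitrary: g)
    case 0
    then have "g = 0" by auto
    then show ?case by (intro exI[of _ 0]) (simp add: ev_dual_form)
  next
    case (Suc n)
    define q where "q = (\<Sum>M | M \<in> keys g \<and> size M = n. single M (lookup g M / pairing_const M))"
    have q: "lookup q M = (if size M = n then lookup g M / pairing_const M else 0)" for M
    proof -
      have "lookup q M = (\<Sum>N | N \<in> keys g \<and> size N = n. if N = M then lookup g M / pairing_const M else 0)"
        by (auto simp: q_def lookup_sum lookup_single when_def intro!: sum.cong)
      then show ?thesis by (auto simp: in_keys_iff)
    qed
    let ?t = "arranged q"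
    have keys_t: "word_degree w \<in> \<Gamma>" if "w \<in> keys ?t" for w
    proof -
      obtain M where "M \<in> keys q" "w = MWord (arrangement M)"
        using keys_arranged[OF \<open>w \<in> keys ?t\<close>] by blast
      then have "mset_degree M \<in> \<Gamma>" using Suc.prems(1) by (auto simp: in_keys_iff q split: if_splits)
      then show ?thesis by (simp add: \<open>w = _\<close> flip: mset_degree_mset)
    qed
    \<comment> \<open>The values still to be realised after the contribution of the arranged
      words.\<close>
    define f where "f M = lookup g M - ev (dual_form ?t) (mon M)" for M
    have f_deg: "mset_degree M \<in> \<Gamma> \<and> (M \<in> keys g \<or> mset_degree M \<in> word_degree ` keys ?t)" if "f M \<noteq> 0" for M
    proof (cases "M \<in> keys g")
      case False
      then have "ev (dual_form ?t) (mon M) \<noteq> 0" using that by (simp add: f_def in_keys_iff)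
      from dual_form_degree[OF this homogeneous_mon] obtain w
        where "w \<in> keys ?t" "word_degree w = mset_degree M" ..
      then show ?thesis using keys_t[of w] imageI[of w "keys ?t" word_degree] by simp
    qed (use Suc.prems(1) in auto)
    \<comment> \<open>The correction only affects monomials whose degree is that of some word, and
      each degree has finitely many monomials.\<close>
    have "{M. f M \<noteq> 0} \<subseteq> keys g \<union> (\<Union>w\<in>keys ?t. {M. mset_degree M = word_degree w})"
      using f_deg by auto
    then have "finite {M. f M \<noteq> 0}"
      by (rule finite_subset) (auto simp: finite_mset_degree)
    then have g': "lookup (Abs_poly_mapping f) = f" by (simp add: Abs_poly_mapping_inverse)
    have "size M < n" if "f M \<noteq> 0" for M
    proof (rule ccontr)
      assume "\<not> size M < n"
      then consider "size M = n" | "size M > n" by linarith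
      then have "f M = 0"
      proof cases
        case 1
        then have "ev (dual_form ?t) (mon M) = lookup q M * pairing_const M"
          by (intro ev_arranged) (auto simp: in_keys_iff q split: if_splits)
        then show ?thesis using 1 pairing_const_nonzero[of M] by (simp add: f_def q)
      next
        case 2
        have "\<forall>w\<in>keys ?t. length (letters w) < size M"
          using 2 by (auto simp: in_keys_iff q dest!: keys_arranged split: if_splits)
        then have "ev (dual_form ?t) (mon M) = 0" by (rule ev_short)
        moreover have "lookup g M = 0" using 2 Suc.prems(2) by (force simp: in_keys_iff)
        ultimately show ?thesis by (simp add: f_def)
      qed
      with that show False by simp
    qed
    then obtain t where t: "\<forall>w\<in>keys t. word_degree w \<in> \<Gamma>" "\<forall>M. ev (dual_form t) (mon M) = f M"
      using Suc.IH[of "Abs_poly_mapping f"] f_deg by (auto simp: in_keys_iff g')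
    have "\<forall>w\<in>keys (t + ?t). word_degree w \<in> \<Gamma>"
      using t(1) keys_t Poly_Mapping.keys_add[of t ?t] by blast
    moreover have "\<forall>M. ev (dual_form (t + ?t)) (mon M) = lookup g M"
      by (simp add: ev_dual_form_add t(2) f_def)
    ultimately show ?case by blast
  qed
  moreover have "\<forall>M\<in>keys g. size M < Suc (Max (size ` keys g))"
    by (auto simp: less_Suc_eq_le)
  ultimately show ?thesis using assms by blast
qed


section \<open>The isomorphism with the graded dual\<close>

definition dual_elem :: "(('m, 'n) deco mword \<Rightarrow>\<^sub>0 'k) \<Rightarrow> (('m, 'n) deco, 'k) ck \<Rightarrow> 'k" where
  "dual_elem t x = (if x \<in> V then ev (dual_form t) x else 0)"

lemma dual_elem_eq_iff: "dual_elem s = dual_elem t \<longleftrightarrow> s - t \<in> envelope_ideal bracket"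
proof -
  have "dual_elem s = dual_elem t \<longleftrightarrow> (\<forall>x\<in>V. ev (dual_form s) x = ev (dual_form t) x)"
    by (auto simp: dual_elem_def fun_eq_iff)
  then show ?thesis by (simp add: vanishing_eq[symmetric] vanishing_def ev_dual_form_diff)
qed

lemma dual_elem_in_gdual: "dual_elem t \<in> gdual V"
proof -
  have "{\<gamma>. \<exists>x\<in>V. homogeneous forest_degree \<gamma> x \<and> dual_elem t x \<noteq> 0} \<subseteq> word_degree ` keys t"
    using dual_form_degree[of t] by (fastforce simp: dual_elem_def)
  then have "finite {\<gamma>. \<exists>x\<in>V. homogeneous forest_degree \<gamma> x \<and> dual_elem t x \<noteq> 0}"
    by (rule finite_subset) simp
  then show ?thesis
    by (auto simp: gdual_def dual_elem_def ev_add ev_smul is_subalgebraD[OF is_subalgebra_V])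
qed

lemma gdual_incl:
  assumes "f \<in> gdual V"
  shows "f (incl p) = ev (\<lambda>M. f (mon M)) p"
proof (induction p rule: free_induct)
  case (single M c)
  show ?case using assms mon_in_V by (simp add: incl_def gdual_def)
next
  case (add p q)
  then show ?case using assms by (simp add: incl_def lin_ext_add ev_add gdual_def flip: V_eq)
    (simp add: V_eq incl_def)
qed

text \<open>A form in the graded dual is determined by its values on monomials, of which finitely
  many are nonzero: it lives in finitely many degrees with finitely many monomials each.\<close>

lemma gdual_surj:
  assumes f: "f \<in> gdual V" and deg: "\<And>M. f (mon M) \<noteq> 0 \<Longrightarrow> mset_degree M \<in> \<Gamma>"
  shows "\<exists>t. (\<forall>w\<in>keys t. word_degree w \<in> \<Gamma>) \<and> dual_elem t = f"
proof -
  let ?\<Gamma> = "{\<gamma>. \<exists>x\<in>V. homogeneous forest_degree \<gamma> x \<and> f x \<noteq> 0}"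
  have "{M. f (mon M) \<noteq> 0} \<subseteq> (\<Union>\<gamma>\<in>?\<Gamma>. {M. mset_degree M = \<gamma>})"
    using mon_in_V homogeneous_mon by blast
  moreover have "finite (\<Union>\<gamma>\<in>?\<Gamma>. {M :: ('m, 'n) deco multiset. mset_degree M = \<gamma>})"
    using f by (intro finite_UN_I finite_mset_degree) (simp add: gdual_def)
  ultimately have "finite {M. f (mon M) \<noteq> 0}"
    by (rule finite_subset)
  then have g: "lookup (Abs_poly_mapping (\<lambda>M. f (mon M))) M = f (mon M)" for M
    by (simp add: Abs_poly_mapping_inverse)
  then obtain t where t: "\<forall>w\<in>keys t. word_degree w \<in> \<Gamma>" "\<And>M. ev (dual_form t) (mon M) = f (mon M)"
    using dual_form_surj[of "Abs_poly_mapping (\<lambda>M. f (mon M))" \<Gamma>] deg by (auto simp: in_keys_iff)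
  have "dual_elem t x = f x" for x
  proof (cases "x \<in> V")
    case True
    then obtain p where p: "x = incl p" by (auto simp: V_eq)
    have "dual_elem t (incl p) = ev (\<lambda>M. dual_elem t (mon M)) p"
      by (rule gdual_incl[OF dual_elem_in_gdual])
    then show ?thesis by (simp add: p gdual_incl[OF f] t(2) dual_elem_def mon_in_V)
  next
    case False
    then show ?thesis using f by (simp add: dual_elem_def gdual_def)
  qed
  then show ?thesis using t(1) by blast
qed

text \<open>The right-hand side depends on \<open>z\<close> alone, which proves that the value is
  independent of the chosen decomposition into pure tensors.\<close>

lemma tensor_form_dual_elem:
  assumes "z \<in> V_tensors"
  shows "tensor_form V (dual_elem s) (dual_elem t) z = ev (\<lambda>(G, H). dual_form s G * dual_form t H) z"
proof -
  have eq: "(\<Sum>(x, y)\<leftarrow>ps. dual_elem s x * dual_elem t y) =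
      ev (\<lambda>(G, H). dual_form s G * dual_form t H) (\<Sum>(x, y)\<leftarrow>ps. tens x y)" if "set ps \<subseteq> V \<times> V" for ps
    using that by (induction ps) (auto simp: ev_add ev_tens dual_elem_def)
  obtain ps where "z = (\<Sum>(y, z)\<leftarrow>ps. tens y z)" "set ps \<subseteq> V \<times> V"
    using assms by (auto simp: V_tensors_def)
  then show ?thesis
    unfolding tensor_form_def by (intro the_equality) (auto simp: eq)
qed

lemma dual_elem_mult:
  "dual_elem (s * t) = (\<lambda>x. if x \<in> V then tensor_form V (dual_elem s) (dual_elem t) (coproduct x) else 0)"
  by (auto simp: dual_elem_def ev_dual_form_product tensor_form_dual_elem coproduct_V fun_eq_iff)

lemma dual_elem_one: "dual_elem 1 = (\<lambda>x. if x \<in> V then counit x else 0)"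
proof -
  have "ev (dual_form 1) x = counit x" for x :: "(('m, 'n) deco, 'k) ck"
    using ev_dual_form_single[of 0 1 x] by (simp add: counit_def ev_word_form_Nil del: word_form.simps)
  then show ?thesis by (auto simp: dual_elem_def)
qed

text \<open>The choice of a representative is harmless, because \<open>dual_elem\<close> is constant
  on classes by \<open>dual_elem_eq_iff\<close>.\<close>

definition dual_iso :: "(('m, 'n) deco mword \<Rightarrow>\<^sub>0 'k) set \<Rightarrow> (('m, 'n) deco, 'k) ck \<Rightarrow> 'k" where
  "dual_iso C = dual_elem (SOME t. t \<in> C)"

lemma dual_iso_env_class: "dual_iso (env_class bracket t) = dual_elem t"
proof -
  have "t \<in> env_class bracket t" by (simp add: mem_env_class envelope_ideal_closed)
  then have "(SOME s. s \<in> env_class bracket t) \<in> env_class bracket t" by (rule someI)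
  then show ?thesis by (simp add: dual_iso_def dual_elem_eq_iff mem_env_class)
qed

lemma dual_iso_ring_iso: "dual_iso \<in> ring_iso (envelope bracket) (gdual_ring V)"
proof -
  have hom: "env_class bracket (s * t) = env_class bracket s \<otimes>\<^bsub>envelope bracket\<^esub> env_class bracket t"
    "env_class bracket (s + t) = env_class bracket s \<oplus>\<^bsub>envelope bracket\<^esub> env_class bracket t"
    "env_class bracket 1 = \<one>\<^bsub>envelope bracket\<^esub>" for s t
    using env_class_hom[of bracket] by (simp_all add: ring_hom_def)
  have "dual_iso \<in> ring_hom (envelope bracket) (gdual_ring V)"
  proof (rule ring_hom_memI)
    fix C D assume "C \<in> carrier (envelope bracket)" "D \<in> carrier (envelope bracket)"
    then obtain s t where CD: "C = env_class bracket s" "D = env_class bracket t"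
      by (auto simp: carrier_envelope)
    show "dual_iso C \<in> carrier (gdual_ring V)"
      by (simp add: CD dual_iso_env_class dual_elem_in_gdual gdual_ring_def)
    show "dual_iso (C \<otimes>\<^bsub>envelope bracket\<^esub> D) = dual_iso C \<otimes>\<^bsub>gdual_ring V\<^esub> dual_iso D"
      by (simp add: CD hom(1)[symmetric] dual_iso_env_class dual_elem_mult gdual_ring_def)
    show "dual_iso (C \<oplus>\<^bsub>envelope bracket\<^esub> D) = dual_iso C \<oplus>\<^bsub>gdual_ring V\<^esub> dual_iso D"
      by (auto simp: CD hom(2)[symmetric] dual_iso_env_class gdual_ring_def dual_elem_def ev_dual_form_add)
  next
    show "dual_iso \<one>\<^bsub>envelope bracket\<^esub> = \<one>\<^bsub>gdual_ring V\<^esub>"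
      by (simp add: hom(3)[symmetric] dual_iso_env_class dual_elem_one gdual_ring_def)
  qed
  moreover have "bij_betw dual_iso (carrier (envelope bracket)) (carrier (gdual_ring V))"
    unfolding bij_betw_def
  proof
    show "inj_on dual_iso (carrier (envelope bracket))"
    proof (rule inj_onI)
      fix C D assume "C \<in> carrier (envelope bracket)" "D \<in> carrier (envelope bracket)" "dual_iso C = dual_iso D"
      then obtain s t where "C = env_class bracket s" "D = env_class bracket t" "dual_elem s = dual_elem t"
        by (auto simp: carrier_envelope dual_iso_env_class)
      then show "C = D" using env_class_eqI by (simp add: dual_elem_eq_iff)
    qed
    have "range dual_elem = gdual V"
      using dual_elem_in_gdual gdual_surj[of _ UNIV] by blast
    then show "dual_iso ` carrier (envelope bracket) = carrier (gdual_ring V)"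
      by (simp add: carrier_envelope image_image dual_iso_env_class gdual_ring_def)
  qed
  ultimately show ?thesis by (simp add: ring_iso_def)
qed

lemma dual_elem_homogeneous: "dual_elem ` {t. homogeneous word_degree \<gamma> t} = gdual_component V \<gamma>"
proof
  show "dual_elem ` {t. homogeneous word_degree \<gamma> t} \<subseteq> gdual_component V \<gamma>"
    using dual_form_degree by (fastforce simp: gdual_component_def dual_elem_in_gdual homogeneous_def[of word_degree] dual_elem_def)
  show "gdual_component V \<gamma> \<subseteq> dual_elem ` {t. homogeneous word_degree \<gamma> t}"
  proof
    fix f assume f: "f \<in> gdual_component V \<gamma>"
    then have "f (mon M) \<noteq> 0 \<Longrightarrow> mset_degree M \<in> {\<gamma>}" for M
      using mon_in_V homogeneous_mon by (auto simp: gdual_component_def)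
    then obtain t where "\<forall>w\<in>keys t. word_degree w \<in> {\<gamma>}" "dual_elem t = f"
      using gdual_surj[of f "{\<gamma>}"] f by (auto simp: gdual_component_def)
    then show "f \<in> dual_elem ` {t. homogeneous word_degree \<gamma> t}"
      by (auto simp: homogeneous_def)
  qed
qed

theorem envelope_gdual_iso_dual_iso: "envelope_gdual_iso bracket V dual_iso"
  unfolding envelope_gdual_iso_def
proof (intro conjI allI dual_iso_ring_iso)
  fix c t
  show "dual_iso (env_class bracket (smul c t)) = (\<lambda>x. c * dual_iso (env_class bracket t) x)"
    by (auto simp: dual_iso_env_class dual_elem_def ev_dual_form_smul)
next
  fix t :: "('m, 'n) deco mword \<Rightarrow>\<^sub>0 'k"
  have "ev (dual_form t) 1 = ev (\<lambda>w. if w = 0 then 1 else 0) t"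
    unfolding ev_dual_form ev_word_form_one
    by (rule ev_cong) (auto simp: zero_mword_def mword.expand)
  then show "dual_iso (env_class bracket t) 1 = counit t"
    by (simp add: dual_iso_env_class dual_elem_def is_subalgebraD[OF is_subalgebra_V] ev_lookup_delta counit_def)
next
  fix t :: "('m, 'n) deco mword \<Rightarrow>\<^sub>0 'k"
  show "gdual_coproduct V (dual_iso (env_class bracket t)) =
        (\<lambda>x y. \<Sum>(v, w)\<in>keys (tensor_coproduct t).
           lookup (tensor_coproduct t) (v, w) *
           (dual_iso (env_class bracket (single v 1)) x * dual_iso (env_class bracket (single w 1)) y))"
  proof (intro ext)
    fix x y
    show "gdual_coproduct V (dual_iso (env_class bracket t)) x y =
        (\<Sum>(v, w)\<in>keys (tensor_coproduct t).
           lookup (tensor_coproduct t) (v, w) *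
           (dual_iso (env_class bracket (single v 1)) x * dual_iso (env_class bracket (single w 1)) y))"
      by (auto simp: gdual_coproduct_def dual_iso_env_class dual_elem_def ev_dual_form_mult
          is_subalgebraD[OF is_subalgebra_V] ev_dual_form_single ev_def[of _ "tensor_coproduct t"] case_prod_unfold)
  qed
next
  fix \<gamma>
  show "dual_iso ` env_class bracket ` {t. homogeneous word_degree \<gamma> t} = gdual_component V \<gamma>"
    by (simp add: image_image dual_iso_env_class dual_elem_homogeneous)
qed

end

theorem theorem27:
  fixes k :: nat
    and I :: "nat \<Rightarrow> 'm::finite set"
    and A :: "nat \<Rightarrow> 'k::field_char_0 ^ 'n::finite"
    and b :: "nat \<Rightarrow> 'k"
    and b' :: "'m \<Rightarrow> nat \<Rightarrow> 'k"
  assumes "disjoint_family_on I {0..k}"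
    and "(\<Union>p\<in>{0..k}. I p) = UNIV"
    and "\<forall>p\<in>{1..k}. I p \<noteq> {}"
  shows "(\<exists>!X. sdse k I A b b' X) \<and>
    (\<forall>X. sdse k I A b b' X \<longrightarrow>
       graded_subspace forest_degree (sdse_subalgebra X) \<and>
       hopf_subalgebra (sdse_subalgebra X) \<and>
       (\<exists>\<phi>. envelope_gdual_iso (lie_bracket (deg1_prod k I A b b')) (sdse_subalgebra X) \<phi>))"
proof (intro conjI allI impI)
  interpret dse k I A b b' by unfold_locales (use assms in auto)
  show "\<exists>!X. sdse k I A b b' X" using sdse_exists sdse_unique by blast
  fix X assume "sdse k I A b b' X"
  then interpret dse_solution k I A b b' X by unfold_locales
  show "graded_subspace forest_degree (sdse_subalgebra X)" by (rule graded_V)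
  show "hopf_subalgebra (sdse_subalgebra X)" by (rule hopf_subalgebra_V)
  show "\<exists>\<phi>. envelope_gdual_iso (lie_bracket (deg1_prod k I A b b')) (sdse_subalgebra X) \<phi>"
    using envelope_gdual_iso_dual_iso by blast
qed

end
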